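(* Let $p=1+\sqrt2$. Let $\mu:[0,\infty)\to[0,\infty)$ be a continuous and increasing function such that the function $F:\mathbb{R}\to\mathbb{R}$, $F(u)=|u|^{p}\mu(|u|)$, belongs to $C^2(\mathbb{R})$, and such that $$\int_0^1\frac{\mu^{1+\sqrt2}(\lambda)}{\lambda}\,d\lambda<\infty .$$ Then the Cauchy problem $$\partial_t^2u-\Delta u=F(u),\qquad u(0,x)=u_0(x),\quad u_t(0,x)=u_1(x),\qquad x\in\mathbb{R}^3,$$ enjoys small data global existence. More precisely, for any $(f,g)\in C^3_c(\mathbb{R}^3)\times C^2_c(\mathbb{R}^3)$ there exists $\varepsilon_0>0$ such that for every $\varepsilon$ with $|\varepsilon|<\varepsilon_0$ the problem with data $(u_0,u_1)=(\varepsilon f,\varepsilon g)$ admits a global classical solution $u\in C^2(\mathbb{R}\times\mathbb{R}^3)$.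
   Context: The unknown $u$ is a real-valued scalar function of $(t,x)\in\mathbb{R}\times\mathbb{R}^3$, and $\Delta$ is the Laplacian in $x\in\mathbb{R}^3$. $\mu^{q}(\lambda)$ denotes the power $(\mu(\lambda))^{q}$. $C^k_c(\mathbb{R}^3)$ denotes compactly supported $C^k$ functions. *)

theory Defs
  imports "HOL-Analysis.Analysis"
begin

definition dir_deriv :: "'a::euclidean_space \<Rightarrow> ('a \<Rightarrow> real) \<Rightarrow> 'a \<Rightarrow> real"
  where "dir_deriv v f x = frechet_derivative f (at x) v"

text \<open>The class \<open>C\<^sup>k\<close> on the whole space. Each level demands Frechet differentiability
  everywhere, so \<^const>\<open>frechet_derivative\<close> is never evaluated at a point where it is
  unspecified.\<close>

primrec Ck :: "nat \<Rightarrow> ('a::euclidean_space \<Rightarrow> real) \<Rightarrow> bool" where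
  "Ck 0 f \<longleftrightarrow> continuous_on UNIV f"
| "Ck (Suc k) f \<longleftrightarrow> (\<forall>x. f differentiable (at x)) \<and> (\<forall>v. Ck k (dir_deriv v f))"

definition Ck_c :: "nat \<Rightarrow> ('a::euclidean_space \<Rightarrow> real) \<Rightarrow> bool"
  where "Ck_c k f \<longleftrightarrow> Ck k f \<and> compact (closure {x. f x \<noteq> 0})"

definition time_deriv :: "(real \<times> (real ^ 3) \<Rightarrow> real) \<Rightarrow> real \<times> (real ^ 3) \<Rightarrow> real"
  where "time_deriv u = dir_deriv (1, 0) u"

definition space_laplacian :: "(real \<times> (real ^ 3) \<Rightarrow> real) \<Rightarrow> real \<times> (real ^ 3) \<Rightarrow> real"
  where "space_laplacian u z =
    (\<Sum>i\<in>UNIV. dir_deriv (0, axis i 1) (dir_deriv (0, axis i 1) u) z)"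

definition global_classical_solution ::
    "(real \<Rightarrow> real) \<Rightarrow> (real ^ 3 \<Rightarrow> real) \<Rightarrow> (real ^ 3 \<Rightarrow> real) \<Rightarrow> (real \<times> (real ^ 3) \<Rightarrow> real) \<Rightarrow> bool"
  where "global_classical_solution F u\<^sub>0 u\<^sub>1 u \<longleftrightarrow>
    Ck 2 u \<and>
    (\<forall>t x. time_deriv (time_deriv u) (t, x) - space_laplacian u (t, x) = F (u (t, x))) \<and>
    (\<forall>x. u (0, x) = u\<^sub>0 x) \<and>
    (\<forall>x. time_deriv u (0, x) = u\<^sub>1 x)"

end

theory Submission
  imports Defs "HOL-Probability.Probability_Measure"
begin

text \<open>
  A solution is a fixed point \<open>u = U + L (F u)\<close>, where \<open>U\<close> is the free wave with the given data
  (\<open>free_wave_solution\<close>) and \<open>L\<close> is the Duhamel operator (\<open>wave_op_duhamel\<close>). In three space dimensions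
  \<open>L\<close> integrates its argument against a positive measure on the light cone, and \<open>F\<close> is increasing in
  \<open>\<bar>u\<bar>\<close>. So all Picard iterates stay below a function \<open>V\<close> as soon as \<open>\<bar>U\<bar> \<le> V / 2\<close> and
  \<open>L (F V) \<le> V / 2\<close>. Given such a bound, convergence is a matter of compact sets only.

  The majorant is \<open>V = c \<kappa>(\<bar>t\<bar> - r) / (1 + \<bar>t\<bar> + r)\<close> with \<open>r = norm x\<close> and
  \<open>\<kappa>(q) = (1 + \<bar>q\<bar>)\<^sup>-\<^sup>d (\<mu>(1 / (1 + \<bar>q\<bar>)) + 1 / (1 + \<bar>q\<bar>))\<close>, where \<open>d = p - 2 = sqrt 2 - 1\<close>. For
  radial functions \<open>L\<close> is a double integral over time and radius, with the factor \<open>1 / r\<close> in front, and it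
  separates in the characteristic coordinates \<open>\<alpha>\<close> and \<open>\<beta>\<close>, the sum and the difference of time and
  radius: \<open>F V\<close> is at most \<open>(1 + \<alpha>)\<^sup>-\<^sup>p (c \<kappa>(\<beta>))\<^sup>p \<mu>(1 / (1 + \<bar>q\<bar>))\<close> with \<open>q = \<bar>t\<bar> - r\<close>, since
  \<open>\<alpha> \<ge> \<bar>q\<bar>\<close> and \<open>\<mu>\<close> is increasing, and the radial weight is at most \<open>1 + \<alpha>\<close>. The \<open>\<alpha>\<close>-integral is
  bounded by a multiple of \<open>r (1 + \<bar>q\<bar>)\<^sup>-\<^sup>d / (1 + \<bar>t\<bar> + r)\<close>, so that
  \<open>L (F V)\<close> has the form of \<open>V\<close> again, with the constant \<open>c\<^sup>p\<close> times the integral of \<open>\<kappa>\<^sup>p\<close>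
  (\<open>duhamel_bound\<close>). The critical exponent satisfies \<open>p (p - 2) = 1\<close>, so \<open>\<kappa>(q)\<^sup>p\<close> is
  \<open>\<mu>(1 / (1 + \<bar>q\<bar>))\<^sup>p / (1 + \<bar>q\<bar>)\<close> up to a harmless term, and its integral is finite precisely by the hypothesis
  on \<open>\<mu>\<close> (\<open>profile_integral_finite\<close>). For small \<open>c\<close> the power \<open>c\<^sup>p\<close> beats \<open>c\<close>.

  Spherical means are integrals against a rotation invariant probability measure on the sphere.
  A rotational derivative has mean zero; the sum of the squares of the rotation fields is the spherical
  Laplacian; hence the Darboux equation, and with it the wave equation for Kirchhoff's and
  Duhamel's formulas. The Darboux equation also determines the moments of \<open>w \<bullet> e\<close> and thereby gives
  Archimedes' theorem, from which the radial form of \<open>L\<close> follows (\<open>spherical_mean_radial\<close>).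

  For the regularity of the limit, all operators are superpositions of a function composed with
  linear maps, and differentiation preserves this form. So the derivatives of the iterates solve linear
  iterations of the same kind. On a compact set that contains the light cones of its points, an
  exponential weight in time makes each of them a contraction, and the iterates converge together with their
  first and second derivatives (\<open>nonlinear_iteration_C2\<close>).\<close>

section \<open>Directional derivatives and superpositions along linear maps\<close>

lemma dir_deriv_eq: "(f has_derivative f') (at x) \<Longrightarrow> dir_deriv v f x = f' v"
  unfolding dir_deriv_def using frechet_derivative_at by metis

lemma has_derivative_dir_deriv:
  "f differentiable (at x) \<Longrightarrow> (f has_derivative (\<lambda>v. dir_deriv v f x)) (at x)"
  unfolding dir_deriv_def by (simp add: frechet_derivative_works)

lemma linear_dir_deriv: "f differentiable (at x) \<Longrightarrow> linear (\<lambda>v. dir_deriv v f x)"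
  using has_derivative_dir_deriv has_derivative_linear by blast

lemma dir_deriv_basis:
  assumes "f differentiable (at x)"
  shows "dir_deriv v f x = (\<Sum>b\<in>Basis. (v \<bullet> b) * dir_deriv b f x)"
proof -
  interpret linear "\<lambda>v. dir_deriv v f x" by (rule linear_dir_deriv[OF assms])
  have "dir_deriv v f x = dir_deriv (\<Sum>b\<in>Basis. (v \<bullet> b) *\<^sub>R b) f x"
    by (simp add: euclidean_representation)
  also have "\<dots> = (\<Sum>b\<in>Basis. (v \<bullet> b) * dir_deriv b f x)"
    unfolding sum scale by simp
  finally show ?thesis .
qed

lemma Ck_differentiable: "Ck (Suc k) f \<Longrightarrow> f differentiable (at x)"
  by simp

lemma Ck_SucD: "Ck (Suc k) f \<Longrightarrow> Ck k f"
proof (induction k arbitrary: f)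
  case 0
  then show ?case
    by (auto intro!: continuous_at_imp_continuous_on differentiable_imp_continuous_within)
next
  case (Suc k)
  then show ?case by fastforce
qed

lemma Ck_le: "Ck m f \<Longrightarrow> k \<le> m \<Longrightarrow> Ck k f"
  by (induction m) (auto simp: le_Suc_eq dest: Ck_SucD simp del: Ck.simps)

lemma Ck_continuous: "Ck k f \<Longrightarrow> continuous_on S f"
  using Ck_le[of k f 0] continuous_on_subset by auto

lemma Ck_dir_deriv: "Ck (Suc k) f \<Longrightarrow> Ck k (dir_deriv v f)"
  by simp

lemma Ck2_differentiable:
  assumes "Ck 2 f"
  shows "f differentiable (at x)" "dir_deriv v f differentiable (at x)"
  using assms by (simp_all add: numeral_2_eq_2)

lemma Ck_SucI:
  assumes "\<And>x. (f has_derivative (\<lambda>v. f' v x)) (at x)" and "\<And>v. Ck k (f' v)"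
  shows "Ck (Suc k) f"
proof -
  have "dir_deriv v f = f' v" for v
    using dir_deriv_eq[OF assms(1)] by fastforce
  then show ?thesis
    using assms by (auto simp: differentiable_def intro!: exI)
qed

lemma Ck_const: "Ck k (\<lambda>x. c)"
proof (induction k arbitrary: c)
  case (Suc k)
  show ?case by (rule Ck_SucI[of _ "\<lambda>v x. 0"]) (use Suc in auto)
qed simp

lemma Ck_linear:
  fixes f :: "'a::euclidean_space \<Rightarrow> real"
  assumes "linear f" shows "Ck k f"
proof (cases k)
  case 0
  then show ?thesis using assms by (simp add: linear_continuous_on linear_linear)
next
  case (Suc j)
  have "(f has_derivative f) (at x)" for x
    using assms by (simp add: linear_imp_has_derivative)
  then show ?thesis unfolding Suc
    by (intro Ck_SucI[of _ "\<lambda>v x. f v"]) (auto intro: Ck_const)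
qed

lemma dir_deriv_add:
  "f differentiable (at x) \<Longrightarrow> g differentiable (at x) \<Longrightarrow>
    dir_deriv v (\<lambda>x. f x + g x) x = dir_deriv v f x + dir_deriv v g x"
  by (rule dir_deriv_eq) (auto intro!: derivative_eq_intros has_derivative_dir_deriv)

lemma dir_deriv_mult:
  "f differentiable (at x) \<Longrightarrow> g differentiable (at x) \<Longrightarrow>
    dir_deriv v (\<lambda>x. f x * g x) x = f x * dir_deriv v g x + dir_deriv v f x * g x"
  by (rule dir_deriv_eq) (auto intro!: derivative_eq_intros has_derivative_dir_deriv)

lemma dir_deriv_cmult:
  "f differentiable (at x) \<Longrightarrow> dir_deriv v (\<lambda>x. c * f x) x = c * dir_deriv v f x"
  by (rule dir_deriv_eq) (auto intro!: derivative_eq_intros has_derivative_dir_deriv)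

lemma dir_deriv_sum:
  "(\<And>i. i \<in> I \<Longrightarrow> f i differentiable (at x)) \<Longrightarrow>
    dir_deriv v (\<lambda>x. \<Sum>i\<in>I. f i x) x = (\<Sum>i\<in>I. dir_deriv v (f i) x)"
  by (rule dir_deriv_eq) (auto intro!: has_derivative_sum has_derivative_dir_deriv)

lemma dir_deriv_compose:
  assumes "u differentiable (at x)" "F differentiable (at (u x))"
  shows "dir_deriv v (\<lambda>x. F (u x)) x = dir_deriv 1 F (u x) * dir_deriv v u x"
proof -
  have "((\<lambda>x. F (u x)) has_derivative (\<lambda>v. dir_deriv (dir_deriv v u x) F (u x))) (at x)"
    using has_derivative_compose[OF has_derivative_dir_deriv[OF assms(1)] has_derivative_dir_deriv[OF assms(2)]]
    by simp
  from dir_deriv_eq[OF this] show ?thesis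
    using dir_deriv_basis[OF assms(2), of "dir_deriv v u x"] by simp
qed

lemma Ck_add: "Ck k f \<Longrightarrow> Ck k g \<Longrightarrow> Ck k (\<lambda>x. f x + g x)"
proof (induction k arbitrary: f g)
  case (Suc k)
  show ?case
    by (rule Ck_SucI[of _ "\<lambda>v x. dir_deriv v f x + dir_deriv v g x"])
      (use Suc in \<open>auto intro!: derivative_eq_intros has_derivative_dir_deriv\<close>)
qed (auto intro: continuous_intros)

lemma Ck_mult: "Ck k f \<Longrightarrow> Ck k g \<Longrightarrow> Ck k (\<lambda>x. f x * g x)"
proof (induction k arbitrary: f g)
  case (Suc k)
  show ?case
    by (rule Ck_SucI[of _ "\<lambda>v x. f x * dir_deriv v g x + dir_deriv v f x * g x"])
      (use Suc in \<open>auto intro!: derivative_eq_intros has_derivative_dir_deriv Ck_add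
        intro: Ck_SucD Ck_dir_deriv simp del: Ck.simps simp: Ck_differentiable\<close>)
qed (auto intro: continuous_intros)

lemma Ck_cmult: "Ck k f \<Longrightarrow> Ck k (\<lambda>x. c * f x)"
  by (intro Ck_mult Ck_const)

lemma Ck_diff: "Ck k f \<Longrightarrow> Ck k g \<Longrightarrow> Ck k (\<lambda>x. f x - g x)"
  using Ck_add[of k f "\<lambda>x. (-1) * g x"] Ck_cmult[of k g "-1"] by simp

lemma Ck_sum: "(\<And>i. i \<in> I \<Longrightarrow> Ck k (f i)) \<Longrightarrow> Ck k (\<lambda>x. \<Sum>i\<in>I. f i x)"
  by (induction I rule: infinite_finite_induct) (auto intro: Ck_add Ck_const)

lemma Ck_compose:
  fixes F :: "real \<Rightarrow> real"
  shows "Ck k F \<Longrightarrow> Ck k u \<Longrightarrow> Ck k (\<lambda>x. F (u x))"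
proof (induction k arbitrary: F u)
  case 0
  then show ?case by (auto intro: continuous_on_compose2)
next
  case (Suc k)
  have d: "((\<lambda>x. F (u x)) has_derivative (\<lambda>v. dir_deriv 1 F (u x) * dir_deriv v u x)) (at x)" for x
  proof -
    have "(\<lambda>x. F (u x)) differentiable (at x)"
      using Suc.prems differentiable_chain_at[of u x F] by (simp add: o_def)
    from has_derivative_dir_deriv[OF this] show ?thesis
      by (subst (asm) dir_deriv_compose) (use Suc.prems in auto)
  qed
  show ?case
    by (rule Ck_SucI[OF d], rule Ck_mult[OF Suc.IH[OF Ck_dir_deriv Ck_SucD] Ck_dir_deriv])
      (rule Suc.prems)+
qed

text \<open>Both mixed derivatives are limits of the same second difference quotient: by the mean
  value theorem, applied in either order, that quotient equals either of them at nearby points.\<close>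

lemma dir_deriv_commute:
  assumes "Ck 2 f"
  shows "dir_deriv v (dir_deriv w f) x = dir_deriv w (dir_deriv v f) x"
proof -
  have C: "Ck (Suc (Suc 0)) f" using assms by (simp add: numeral_2_eq_2)
  have line: "((\<lambda>s. g (y + s *\<^sub>R a)) has_real_derivative dir_deriv a g (y + s *\<^sub>R a)) (at s)"
    if g: "Ck (Suc 0) g" for g :: "'a \<Rightarrow> real" and y a s
  proof -
    have g': "(g has_derivative (\<lambda>v. dir_deriv v g (y + s *\<^sub>R a))) (at (y + s *\<^sub>R a))"
      using g by (intro has_derivative_dir_deriv) simp
    have "((\<lambda>s. g (y + s *\<^sub>R a)) has_derivative (\<lambda>h. dir_deriv (h *\<^sub>R a) g (y + s *\<^sub>R a))) (at s)"
    proof -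
      have i: "((\<lambda>s. y + s *\<^sub>R a) has_derivative (\<lambda>h. h *\<^sub>R a)) (at s)"
        by (auto intro!: derivative_eq_intros)
      show ?thesis using has_derivative_compose[OF i g'] .
    qed
    moreover have "dir_deriv (h *\<^sub>R a) g (y + s *\<^sub>R a) = dir_deriv a g (y + s *\<^sub>R a) * h" for h
      using linear_scale[OF linear_dir_deriv, of g "y + s *\<^sub>R a" h a] g by simp
    ultimately show ?thesis by (simp add: has_field_derivative_def)
  qed
  define \<Delta> where "\<Delta> a b h = f (x + h *\<^sub>R a + h *\<^sub>R b) - f (x + h *\<^sub>R a) - f (x + h *\<^sub>R b) + f x" for a b h
  have quot: "\<exists>s\<in>{0..h}. \<exists>t\<in>{0..h}. \<Delta> a b h = h\<^sup>2 * dir_deriv b (dir_deriv a f) (x + s *\<^sub>R a + t *\<^sub>R b)"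
    if h: "h > 0" for a b h
  proof -
    have 1: "((\<lambda>s. f (x + s *\<^sub>R a + h *\<^sub>R b) - f (x + s *\<^sub>R a)) has_real_derivative
        (dir_deriv a f (x + s *\<^sub>R a + h *\<^sub>R b) - dir_deriv a f (x + s *\<^sub>R a))) (at s)" for s
      using line[OF Ck_SucD[OF C], of "x + h *\<^sub>R b" a s] line[OF Ck_SucD[OF C], of x a s]
      by (auto intro!: derivative_eq_intros simp: algebra_simps)
    obtain s where s: "0 < s" "s < h"
      "\<Delta> a b h = h * (dir_deriv a f (x + s *\<^sub>R a + h *\<^sub>R b) - dir_deriv a f (x + s *\<^sub>R a))"
      using MVT2[OF h 1] unfolding \<Delta>_def by (auto simp: algebra_simps)
    have "\<exists>t. 0 < t \<and> t < h \<and> dir_deriv a f (x + s *\<^sub>R a + h *\<^sub>R b) - dir_deriv a f (x + s *\<^sub>R a + 0 *\<^sub>R b) =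
        (h - 0) * dir_deriv b (dir_deriv a f) (x + s *\<^sub>R a + t *\<^sub>R b)"
      by (rule MVT2[OF h]) (use C in \<open>auto intro!: line\<close>)
    then obtain t where "0 < t" "t < h" "dir_deriv a f (x + s *\<^sub>R a + h *\<^sub>R b) - dir_deriv a f (x + s *\<^sub>R a) =
        h * dir_deriv b (dir_deriv a f) (x + s *\<^sub>R a + t *\<^sub>R b)"
      by auto
    then show ?thesis
      using s by (intro bexI[of _ s] bexI[of _ t]) (simp_all add: power2_eq_square)
  qed
  have lim: "((\<lambda>h. \<Delta> a b h / h\<^sup>2) \<longlongrightarrow> dir_deriv b (dir_deriv a f) x) (at_right 0)" for a b
  proof -
    obtain s t where st: "\<And>h. h > 0 \<Longrightarrow> s h \<in> {0..h} \<and> t h \<in> {0..h} \<and>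
        \<Delta> a b h = h\<^sup>2 * dir_deriv b (dir_deriv a f) (x + s h *\<^sub>R a + t h *\<^sub>R b)"
      using quot[of _ a b] by metis
    have 0: "(r \<longlongrightarrow> 0) (at_right 0)" if "\<And>h. h > 0 \<Longrightarrow> r h \<in> {0..h}" for r :: "real \<Rightarrow> real"
    proof (rule tendsto_sandwich[of "\<lambda>_. 0" _ _ "\<lambda>h. h"])
      show "\<forall>\<^sub>F h in at_right 0. 0 \<le> r h" "\<forall>\<^sub>F h in at_right 0. r h \<le> h"
        using that by (auto simp: eventually_at_right_less intro!: eventually_at_rightI[of 0 1])
    qed (auto intro: tendsto_eq_intros)
    have "((\<lambda>h. x + s h *\<^sub>R a + t h *\<^sub>R b) \<longlongrightarrow> x + 0 *\<^sub>R a + 0 *\<^sub>R b) (at_right 0)"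
      by (intro tendsto_intros 0) (use st in auto)
    moreover have "isCont (dir_deriv b (dir_deriv a f)) x"
      using C by (simp add: continuous_on_eq_continuous_at)
    ultimately have "((\<lambda>h. dir_deriv b (dir_deriv a f) (x + s h *\<^sub>R a + t h *\<^sub>R b)) \<longlongrightarrow> dir_deriv b (dir_deriv a f) x) (at_right 0)"
      using isCont_tendsto_compose[of x "dir_deriv b (dir_deriv a f)"] by simp
    moreover have "\<forall>\<^sub>F h in at_right 0. dir_deriv b (dir_deriv a f) (x + s h *\<^sub>R a + t h *\<^sub>R b) = \<Delta> a b h / h\<^sup>2"
      by (rule eventually_at_rightI[of 0 1]) (use st in auto)
    ultimately show ?thesis by (rule Lim_transform_eventually)
  qed
  have "\<Delta> v w h = \<Delta> w v h" for h by (simp add: \<Delta>_def algebra_simps)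
  then show ?thesis
    using tendsto_unique[OF _ lim[of v w] ] lim[of w v] by simp
qed

text \<open>The first order expansion of a \<open>C\<^sup>1\<close> function is uniform on balls, because the
  continuous partial derivatives are uniformly continuous there. This is what allows the expansion
  to be integrated against a measure.\<close>

lemma uniform_differentiability:
  fixes G :: "'b::euclidean_space \<Rightarrow> real"
  assumes G: "Ck (Suc 0) G" and e: "e > 0"
  shows "\<exists>d>0. \<forall>z\<in>cball 0 R. \<forall>k. norm k < d \<longrightarrow> \<bar>G (z + k) - G z - dir_deriv k G z\<bar> \<le> e * norm k"
proof -
  have diff: "G differentiable (at z)" for z using G by simp
  let ?n = "real (card (Basis :: 'b set))"
  have n: "?n > 0" by simp
  have "\<exists>d>0. \<forall>z\<in>cball 0 (R + 1). \<forall>z'\<in>cball 0 (R + 1). dist z' z < d \<longrightarrow>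
      \<bar>dir_deriv b G z' - dir_deriv b G z\<bar> < e / ?n" for b
  proof -
    have "uniformly_continuous_on (cball 0 (R + 1)) (dir_deriv b G)"
      by (rule compact_uniformly_continuous[OF Ck_continuous[OF Ck_dir_deriv[OF G]]]) simp
    from uniformly_continuous_onE[OF this, of "e / ?n"] show ?thesis
      using e n by (metis dist_real_def divide_pos_pos)
  qed
  then obtain \<delta> where \<delta>: "\<And>b. \<delta> b > 0"
    "\<And>b z z'. z \<in> cball 0 (R + 1) \<Longrightarrow> z' \<in> cball 0 (R + 1) \<Longrightarrow> dist z' z < \<delta> b \<Longrightarrow>
      \<bar>dir_deriv b G z' - dir_deriv b G z\<bar> < e / ?n"
    by metis
  define d where "d = min 1 (Min (\<delta> ` Basis))"
  have d: "d > 0" "d \<le> 1" "\<And>b. b \<in> Basis \<Longrightarrow> d \<le> \<delta> b"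
    using \<delta>(1) by (auto simp: d_def min_le_iff_disj)
  show ?thesis
  proof (intro exI[of _ d] conjI ballI allI impI)
    fix z :: 'b and k :: 'b
    assume z: "z \<in> cball 0 R" and k: "norm k < d"
    have near: "\<bar>dir_deriv v G z' - dir_deriv v G z\<bar> \<le> e * norm v"
      if z': "z' \<in> ball z d" for z' v
    proof -
      have zz: "z \<in> cball 0 (R + 1)" "z' \<in> cball 0 (R + 1)"
        using z z' d norm_triangle_ineq[of z "z' - z"] by (auto simp: dist_norm norm_minus_commute)
      have "\<bar>dir_deriv v G z' - dir_deriv v G z\<bar> =
          \<bar>\<Sum>b\<in>Basis. (v \<bullet> b) * (dir_deriv b G z' - dir_deriv b G z)\<bar>"
        by (simp add: dir_deriv_basis[OF diff, of v] sum_subtractf algebra_simps)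
      also have "\<dots> \<le> (\<Sum>b\<in>(Basis :: 'b set). norm v * (e / ?n))"
      proof (intro order_trans[OF sum_abs] sum_mono)
        fix b :: 'b assume b: "b \<in> Basis"
        have "\<bar>dir_deriv b G z' - dir_deriv b G z\<bar> \<le> e / ?n"
          using \<delta>(2)[OF zz, of b] d(3)[OF b] z' by (force simp: dist_commute)
        then show "\<bar>(v \<bullet> b) * (dir_deriv b G z' - dir_deriv b G z)\<bar> \<le> norm v * (e / ?n)"
          unfolding abs_mult using Basis_le_norm[OF b, of v] e by (intro mult_mono) auto
      qed
      also have "\<dots> = e * norm v" using n by simp
      finally show ?thesis .
    qed
    have on: "onorm ((\<lambda>v. dir_deriv v G z') - (\<lambda>v. dir_deriv v G z)) \<le> e" if "z' \<in> ball z d" for z'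
      by (rule onorm_le) (use near[OF that] in auto)
    have in_ball: "z + t *\<^sub>R k \<in> ball z d" if "t \<in> {0..1}" for t
    proof -
      have "\<bar>t\<bar> * norm k \<le> 1 * norm k" using that by (intro mult_right_mono) auto
      then show ?thesis using k by (simp add: dist_norm)
    qed
    have "norm (G (z + k) - G z - dir_deriv (z + k - z) G z) \<le> norm (z + k - z) * e"
    proof (rule differentiable_bound_linearization[where S = "ball z d" and f' = "\<lambda>z' v. dir_deriv v G z'"])
      show "z + t *\<^sub>R (z + k - z) \<in> ball z d" if "t \<in> {0..1}" for t
        using in_ball[OF that] by simp
      show "(G has_derivative (\<lambda>v. dir_deriv v G z')) (at z' within ball z d)" for z'
        by (rule has_derivative_at_withinI[OF has_derivative_dir_deriv[OF diff]])
      show "z \<in> ball z d" using d by simp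
    qed (rule on)
    then show "\<bar>G (z + k) - G z - dir_deriv k G z\<bar> \<le> e * norm k" by (simp add: mult.commute)
  qed (use d in auto)
qed

text \<open>Superpositions of a function composed with a bounded family of linear maps. Both spherical
  means and Duhamel integrals have this form, and so do all their derivatives, because
  differentiation in direction \<open>v\<close> replaces \<open>G\<close> by its partial derivatives and multiplies the weight
  \<open>a q\<close> by the components of \<open>A q v\<close>.\<close>

locale linear_superposition = finite_measure M for M :: "'q measure" +
  fixes A :: "'q \<Rightarrow> 'a::euclidean_space \<Rightarrow> 'b::euclidean_space" and C :: real
  assumes lin: "\<And>q. linear (A q)"
    and meas [measurable]: "\<And>v. (\<lambda>q. A q v) \<in> borel_measurable M"
    and bound: "AE q in M. \<forall>v. norm (A q v) \<le> C * norm v"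
begin

definition weight :: "('q \<Rightarrow> real) \<Rightarrow> bool"
  where "weight a \<longleftrightarrow> a \<in> borel_measurable M \<and> (\<exists>c. AE q in M. \<bar>a q\<bar> \<le> c)"

definition superpose :: "('q \<Rightarrow> real) \<Rightarrow> ('b \<Rightarrow> real) \<Rightarrow> 'a \<Rightarrow> real"
  where "superpose a G y = (\<integral>q. a q * G (A q y) \<partial>M)"

lemma weight_const: "weight (\<lambda>q. c)"
  unfolding weight_def by auto

lemma weight_mult: assumes "weight a" "weight b" shows "weight (\<lambda>q. a q * b q)"
proof -
  obtain c d where "AE q in M. \<bar>a q\<bar> \<le> c" "AE q in M. \<bar>b q\<bar> \<le> d"
    using assms by (auto simp: weight_def)
  then have "AE q in M. \<bar>a q * b q\<bar> \<le> c * d"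
    by eventually_elim (auto simp: abs_mult intro!: mult_mono order_trans[OF abs_ge_zero])
  then show ?thesis using assms by (auto simp: weight_def)
qed

lemma weight_inner: "weight (\<lambda>q. A q v \<bullet> b)"
proof -
  have "AE q in M. \<bar>A q v \<bullet> b\<bar> \<le> C * norm v * norm b"
    using bound by eventually_elim (meson Cauchy_Schwarz_ineq2 order_trans mult_right_mono norm_ge_zero)
  then show ?thesis by (auto simp: weight_def)
qed

lemma bound_on_ball:
  assumes G: "continuous_on UNIV (G :: 'b \<Rightarrow> real)"
  obtains B where "\<And>z. z \<in> cball 0 R \<Longrightarrow> \<bar>G z\<bar> \<le> (B::real)"
proof -
  have "compact (G ` cball 0 R)"
    by (rule compact_continuous_image[OF continuous_on_subset[OF G]]) auto
  then obtain B where "\<forall>y\<in>G ` cball 0 R. norm y \<le> B"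
    using compact_imp_bounded bounded_iff by blast
  then show ?thesis by (intro that[of B]) auto
qed

lemma meas_comp [measurable]:
  assumes "continuous_on UNIV (G :: 'b \<Rightarrow> real)"
  shows "(\<lambda>q. G (A q y)) \<in> borel_measurable M"
  using borel_measurable_continuous_onI[OF assms] by measurable

lemma superpose_integrable:
  assumes a: "weight a" and G: "continuous_on UNIV G"
  shows "integrable M (\<lambda>q. a q * G (A q y))"
proof -
  obtain c where c: "AE q in M. \<bar>a q\<bar> \<le> c" using a by (auto simp: weight_def)
  obtain B where B: "\<And>z. z \<in> cball 0 (C * norm y) \<Longrightarrow> \<bar>G z\<bar> \<le> B"
    using bound_on_ball[OF G] by blast
  have "AE q in M. norm (a q * G (A q y)) \<le> c * B"
    using c bound
  proof eventually_elim
    case (elim q)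
    then have "\<bar>G (A q y)\<bar> \<le> B" by (intro B) simp
    then show ?case using elim by (auto simp: abs_mult intro!: mult_mono order_trans[OF abs_ge_zero])
  qed
  moreover have "(\<lambda>q. a q * G (A q y)) \<in> borel_measurable M"
    using a meas_comp[OF G] by (auto simp: weight_def)
  ultimately show ?thesis by (intro integrable_const_bound[of _ "c * B"]) auto
qed

lemma superpose_add:
  assumes "weight a" "continuous_on UNIV G" "continuous_on UNIV H"
  shows "superpose a (\<lambda>z. G z + H z) y = superpose a G y + superpose a H y"
  using superpose_integrable[OF assms(1,2)] superpose_integrable[OF assms(1,3)]
  by (simp add: superpose_def algebra_simps)

lemma superpose_diff:
  assumes "weight a" "continuous_on UNIV G" "continuous_on UNIV H"
  shows "superpose a (\<lambda>z. G z - H z) y = superpose a G y - superpose a H y"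
  using superpose_integrable[OF assms(1,2)] superpose_integrable[OF assms(1,3)]
  by (simp add: superpose_def algebra_simps)

lemma superpose_continuous:
  assumes a: "weight a" and G: "continuous_on UNIV G"
  shows "continuous_on UNIV (superpose a G)"
  unfolding continuous_on_eq_continuous_within
proof (intro ballI continuous_at_sequentiallyI)
  fix y and Y :: "nat \<Rightarrow> 'a" assume Y: "Y \<longlonglongrightarrow> y"
  then obtain R where R: "\<And>n. norm (Y n) \<le> R" "norm y \<le> R" "R \<ge> 0"
    using convergent_imp_bounded[of Y] Lim_bounded[of "\<lambda>n. norm (Y n)" "norm y" 0] tendsto_norm[OF Y]
    by (auto simp: bounded_iff convergent_def) (meson norm_ge_zero order_trans)
  obtain c where c: "AE q in M. \<bar>a q\<bar> \<le> c" using a by (auto simp: weight_def)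
  obtain B where B: "\<And>z. z \<in> cball 0 (\<bar>C\<bar> * R) \<Longrightarrow> \<bar>G z\<bar> \<le> B"
    using bound_on_ball[OF G] by blast
  show "(\<lambda>n. superpose a G (Y n)) \<longlonglongrightarrow> superpose a G y"
    unfolding superpose_def
  proof (rule integral_dominated_convergence[where w = "\<lambda>_. c * B"])
    show "AE q in M. (\<lambda>n. a q * G (A q (Y n))) \<longlonglongrightarrow> a q * G (A q y)"
    proof (intro AE_I2 tendsto_intros)
      fix q
      have "isCont G (A q y)" using G by (simp add: continuous_on_eq_continuous_at)
      moreover have "(\<lambda>n. A q (Y n)) \<longlonglongrightarrow> A q y"
        by (rule isCont_tendsto_compose[OF linear_continuous_at Y]) (use lin in \<open>simp add: linear_linear\<close>)
      ultimately show "(\<lambda>n. G (A q (Y n))) \<longlonglongrightarrow> G (A q y)"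
        by (rule isCont_tendsto_compose)
    qed
    show "AE q in M. norm (a q * G (A q (Y n))) \<le> c * B" for n
      using c bound
    proof eventually_elim
      case (elim q)
      have "norm (A q (Y n)) \<le> \<bar>C\<bar> * R"
        using elim(2)[rule_format, of "Y n"] R(1)[of n] mult_mono[of C "\<bar>C\<bar>" "norm (Y n)" R] by force
      then have "\<bar>G (A q (Y n))\<bar> \<le> B" by (intro B) simp
      then show ?case using elim by (auto simp: abs_mult intro!: mult_mono order_trans[OF abs_ge_zero])
    qed
  qed (use superpose_integrable[OF a G] in auto)
qed

text \<open>The points \<open>A q y\<close> lie in one ball for almost all \<open>q\<close>, so the remainder of the
  expansion of \<open>G\<close> at \<open>A q y\<close> is small uniformly in \<open>q\<close>, and its integral is small too.\<close>

lemma superpose_has_derivative: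
  assumes a: "weight a" and G: "Ck (Suc 0) G"
  shows "(superpose a G has_derivative
    (\<lambda>v. \<Sum>b\<in>Basis. superpose (\<lambda>q. a q * (A q v \<bullet> b)) (dir_deriv b G) y)) (at y)"
proof -
  have diff: "G differentiable (at z)" for z using G by simp
  have cont: "continuous_on UNIV G" "\<And>b. continuous_on UNIV (dir_deriv b G)"
    using G Ck_SucD Ck_continuous by (blast, simp)
  define D where "D v = (\<integral>q. a q * dir_deriv (A q v) G (A q y) \<partial>M)" for v
  have int: "integrable M (\<lambda>q. a q * (A q v \<bullet> b) * dir_deriv b G (A q y))" for v b
    by (intro superpose_integrable weight_mult a weight_inner cont)
  have exp: "a q * dir_deriv (A q v) G (A q y) =
      (\<Sum>b\<in>Basis. a q * (A q v \<bullet> b) * dir_deriv b G (A q y))" for q v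
    by (simp add: dir_deriv_basis[OF diff, of "A q v"] sum_distrib_left algebra_simps)
  have D: "D v = (\<Sum>b\<in>Basis. superpose (\<lambda>q. a q * (A q v \<bullet> b)) (dir_deriv b G) y)" for v
    unfolding D_def exp superpose_def by (rule Bochner_Integration.integral_sum) (rule int)
  have intD: "integrable M (\<lambda>q. a q * dir_deriv (A q v) G (A q y))" for v
    unfolding exp by (intro Bochner_Integration.integrable_sum int)
  have linD: "linear D"
  proof (rule linearI)
    have l: "linear (\<lambda>v. dir_deriv (A q v) G (A q y))" for q
      using linear_compose[OF lin linear_dir_deriv[OF diff]] by (simp add: o_def)
    show "D (v + w) = D v + D w" for v w
      unfolding D_def linear_add[OF l] using intD by (simp add: algebra_simps)
    show "D (r *\<^sub>R v) = r *\<^sub>R D v" for r v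
      unfolding D_def linear_scale[OF l] by (simp add: algebra_simps)
  qed
  obtain c0 where c0: "AE q in M. \<bar>a q\<bar> \<le> c0" using a by (auto simp: weight_def)
  define c where "c = \<bar>c0\<bar>"
  have c: "AE q in M. \<bar>a q\<bar> \<le> c" "c \<ge> 0"
    using c0 by (auto simp: c_def intro: order_trans elim!: eventually_mono)
  define m where "m = measure M (space M)"
  have m: "m \<ge> 0" by (simp add: m_def)
  have "(superpose a G has_derivative D) (at y)"
    unfolding has_derivative_at_alt
  proof (intro conjI allI impI)
    show "bounded_linear D" using linD by (simp add: linear_linear)
    fix e :: real assume e: "e > 0"
    define \<epsilon> where "\<epsilon> = e / (c * (\<bar>C\<bar> + 1) * m + 1)"
    have pos: "c * (\<bar>C\<bar> + 1) * m + 1 > 0" using c m by (simp add: add_nonneg_pos)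
    have \<epsilon>: "\<epsilon> > 0" using e pos by (simp add: \<epsilon>_def)
    have \<epsilon>': "c * (\<epsilon> * (\<bar>C\<bar> + 1)) * m \<le> e"
    proof -
      have "c * (\<epsilon> * (\<bar>C\<bar> + 1)) * m = e * ((c * (\<bar>C\<bar> + 1) * m) / (c * (\<bar>C\<bar> + 1) * m + 1))"
        by (simp add: \<epsilon>_def field_simps)
      also have "\<dots> \<le> e * 1" using pos e by (intro mult_left_mono) auto
      finally show ?thesis by simp
    qed
    obtain d where d: "d > 0" "\<And>z k. z \<in> cball 0 (C * norm y) \<Longrightarrow> norm k < d \<Longrightarrow>
        \<bar>G (z + k) - G z - dir_deriv k G z\<bar> \<le> \<epsilon> * norm k"
      using uniform_differentiability[OF G \<epsilon>] by blast
    show "\<exists>d>0. \<forall>y'. norm (y' - y) < d \<longrightarrow>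
        norm (superpose a G y' - superpose a G y - D (y' - y)) \<le> e * norm (y' - y)"
    proof (intro exI[of _ "d / (\<bar>C\<bar> + 1)"] conjI allI impI)
      show "d / (\<bar>C\<bar> + 1) > 0" using d by simp
      fix y' assume y': "norm (y' - y) < d / (\<bar>C\<bar> + 1)"
      let ?h = "y' - y"
      have small: "norm ?h * (\<bar>C\<bar> + 1) < d" using y' by (simp add: field_simps)
      let ?r = "\<lambda>q. a q * G (A q y') - a q * G (A q y) - a q * dir_deriv (A q ?h) G (A q y)"
      have int_r: "integrable M ?r"
        by (intro Bochner_Integration.integrable_diff superpose_integrable a cont intD)
      have "superpose a G y' - superpose a G y - D ?h = (\<integral>q. ?r q \<partial>M)"
        unfolding superpose_def D_def using superpose_integrable[OF a cont(1)] intD by simp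
      also have "\<bar>\<dots>\<bar> \<le> (\<integral>q. c * (\<epsilon> * (\<bar>C\<bar> + 1)) * norm ?h \<partial>M)"
      proof (rule order_trans[OF integral_abs_bound], rule integral_mono_AE)
        show "integrable M (\<lambda>q. \<bar>?r q\<bar>)" using int_r by (rule integrable_abs)
        show "AE q in M. \<bar>?r q\<bar> \<le> c * (\<epsilon> * (\<bar>C\<bar> + 1)) * norm ?h"
          using c(1) bound
        proof eventually_elim
          case (elim q)
          have k: "norm (A q ?h) \<le> (\<bar>C\<bar> + 1) * norm ?h"
          proof -
            have "C * norm ?h \<le> (\<bar>C\<bar> + 1) * norm ?h" by (intro mult_right_mono) auto
            then show ?thesis using elim(2)[rule_format, of ?h] by linarith
          qed
          have "A q y' = A q y + A q ?h" using linear_diff[OF lin] by simp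
          then have eq: "?r q = a q * (G (A q y + A q ?h) - G (A q y) - dir_deriv (A q ?h) G (A q y))"
            by (simp add: algebra_simps)
          have "\<bar>G (A q y + A q ?h) - G (A q y) - dir_deriv (A q ?h) G (A q y)\<bar> \<le> \<epsilon> * norm (A q ?h)"
            using elim(2) k small by (intro d(2)) (auto simp: mult.commute)
          also have "\<dots> \<le> \<epsilon> * ((\<bar>C\<bar> + 1) * norm ?h)" using k \<epsilon> by (intro mult_left_mono) auto
          finally have "\<bar>?r q\<bar> \<le> c * (\<epsilon> * ((\<bar>C\<bar> + 1) * norm ?h))"
            unfolding eq abs_mult using elim(1) c(2) by (intro mult_mono) auto
          then show ?case by (simp add: mult.assoc)
        qed
      qed auto
      also have "\<dots> = c * (\<epsilon> * (\<bar>C\<bar> + 1)) * m * norm ?h" by (simp add: m_def algebra_simps)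
      also have "\<dots> \<le> e * norm ?h" using \<epsilon>' by (intro mult_right_mono) auto
      finally show "norm (superpose a G y' - superpose a G y - D ?h) \<le> e * norm ?h" by simp
    qed
  qed
  then show ?thesis unfolding D[abs_def] .
qed

lemma dir_deriv_superpose:
  assumes "weight a" "Ck (Suc 0) G"
  shows "dir_deriv v (superpose a G) y =
    (\<Sum>b\<in>Basis. superpose (\<lambda>q. a q * (A q v \<bullet> b)) (dir_deriv b G) y)"
  by (rule dir_deriv_eq[OF superpose_has_derivative[OF assms]])

lemma integrable_dir_deriv:
  assumes a: "weight a" and G: "Ck (Suc 0) G"
  shows "integrable M (\<lambda>q. a q * dir_deriv (A q v) G (A q y))"
proof -
  have "a q * dir_deriv (A q v) G (A q y) = (\<Sum>b\<in>Basis. a q * (A q v \<bullet> b) * dir_deriv b G (A q y))" for q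
    using G by (simp add: dir_deriv_basis[of G "A q y" "A q v"] sum_distrib_left algebra_simps)
  then show ?thesis
    using G by (auto intro!: Bochner_Integration.integrable_sum superpose_integrable weight_mult weight_inner a)
qed

lemma dir_deriv_superpose_integral:
  assumes a: "weight a" and G: "Ck (Suc 0) G"
  shows "dir_deriv v (superpose a G) y = (\<integral>q. a q * dir_deriv (A q v) G (A q y) \<partial>M)"
proof -
  have diff: "G differentiable (at z)" for z using G by simp
  have exp: "a q * dir_deriv (A q v) G (A q y) =
      (\<Sum>b\<in>Basis. a q * (A q v \<bullet> b) * dir_deriv b G (A q y))" for q
    by (simp add: dir_deriv_basis[OF diff, of "A q v"] sum_distrib_left algebra_simps)
  show ?thesis
    unfolding dir_deriv_superpose[OF assms] exp superpose_def
    by (rule Bochner_Integration.integral_sum[symmetric], rule superpose_integrable)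
      (use G in \<open>auto intro!: weight_mult weight_inner a\<close>)
qed

lemma Ck_superpose: "weight a \<Longrightarrow> Ck k G \<Longrightarrow> Ck k (superpose a G)"
proof (induction k arbitrary: a G)
  case 0
  then show ?case by (simp add: superpose_continuous)
next
  case (Suc k)
  show ?case
  proof (rule Ck_SucI)
    show "(superpose a G has_derivative
        (\<lambda>v. \<Sum>b\<in>Basis. superpose (\<lambda>q. a q * (A q v \<bullet> b)) (dir_deriv b G) y)) (at y)" for y
      by (rule superpose_has_derivative) (use Suc.prems Ck_le[of "Suc k" G "Suc 0"] in auto)
    show "Ck k (\<lambda>y. \<Sum>b\<in>Basis. superpose (\<lambda>q. a q * (A q v \<bullet> b)) (dir_deriv b G) y)" for v
      by (intro Ck_sum Suc.IH weight_mult weight_inner Suc.prems Ck_dir_deriv)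
  qed
qed

lemma second_deriv_expand:
  assumes G: "Ck 2 G"
  shows "dir_deriv u (dir_deriv v G) y = (\<Sum>b\<in>Basis. (v \<bullet> b) * dir_deriv u (dir_deriv b G) y)"
proof -
  have d: "G differentiable (at y)" "dir_deriv v G differentiable (at y)" for v y
    using G by (auto simp: numeral_2_eq_2)
  have "dir_deriv v G = (\<lambda>y. \<Sum>b\<in>Basis. (v \<bullet> b) * dir_deriv b G y)"
    by (rule ext) (rule dir_deriv_basis[OF d(1)])
  then show ?thesis
    by (simp only:) (subst dir_deriv_sum, use d(2) in \<open>auto simp: dir_deriv_cmult intro!: differentiable_mult\<close>)
qed

text \<open>The same derivative with the directions \<open>A q u\<close>, \<open>A q v\<close> kept under the integral.
  For spherical means these are the radial direction and the coordinate directions, and the wave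
  equation becomes an identity between integrands.\<close>

lemma second_deriv_superpose:
  assumes a: "weight a" and G: "Ck 2 G"
  shows "integrable M (\<lambda>q. a q * dir_deriv (A q u) (dir_deriv (A q v) G) (A q y))"
    and "dir_deriv u (dir_deriv v (superpose a G)) y =
      (\<integral>q. a q * dir_deriv (A q u) (dir_deriv (A q v) G) (A q y) \<partial>M)"
proof -
  have G2: "Ck (Suc (Suc 0)) G" using G by (simp add: numeral_2_eq_2)
  have G1: "Ck (Suc 0) G" "Ck (Suc 0) (dir_deriv b G)" for b
    by (rule Ck_SucD[OF G2], rule Ck_dir_deriv[OF G2])
  have exp: "a q * dir_deriv (A q u) (dir_deriv (A q v) G) (A q y) =
      (\<Sum>b\<in>Basis. a q * (A q v \<bullet> b) * dir_deriv (A q u) (dir_deriv b G) (A q y))" for q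
    unfolding second_deriv_expand[OF G, of "A q u" "A q v"] by (simp add: sum_distrib_left algebra_simps)
  have w: "weight (\<lambda>q. a q * (A q v \<bullet> b))" for b by (intro weight_mult weight_inner a)
  show "integrable M (\<lambda>q. a q * dir_deriv (A q u) (dir_deriv (A q v) G) (A q y))"
    unfolding exp by (intro Bochner_Integration.integrable_sum integrable_dir_deriv w G1)
  have "dir_deriv v (superpose a G) = (\<lambda>y. \<Sum>b\<in>Basis. superpose (\<lambda>q. a q * (A q v \<bullet> b)) (dir_deriv b G) y)"
    by (rule ext) (rule dir_deriv_superpose[OF a G1(1)])
  moreover have "superpose (\<lambda>q. a q * (A q v \<bullet> b)) (dir_deriv b G) differentiable (at y)" for b
    using Ck_superpose[OF w G1(2)] by simp
  ultimately have "dir_deriv u (dir_deriv v (superpose a G)) y =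
      (\<Sum>b\<in>Basis. dir_deriv u (superpose (\<lambda>q. a q * (A q v \<bullet> b)) (dir_deriv b G)) y)"
    by (simp add: dir_deriv_sum)
  also have "\<dots> = (\<Sum>b\<in>Basis. \<integral>q. a q * (A q v \<bullet> b) * dir_deriv (A q u) (dir_deriv b G) (A q y) \<partial>M)"
    by (simp add: dir_deriv_superpose_integral[OF w G1(2)])
  also have "\<dots> = (\<integral>q. a q * dir_deriv (A q u) (dir_deriv (A q v) G) (A q y) \<partial>M)"
    unfolding exp by (rule Bochner_Integration.integral_sum[symmetric]) (rule integrable_dir_deriv[OF w G1(2)])
  finally show "dir_deriv u (dir_deriv v (superpose a G)) y =
      (\<integral>q. a q * dir_deriv (A q u) (dir_deriv (A q v) G) (A q y) \<partial>M)" .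
qed

end

section \<open>The uniform measure on the sphere\<close>

text \<open>The radial projection of the uniform distribution on the ball: its invariance under rotations is
  inherited from Lebesgue measure, without a parametrization of the sphere.\<close>

definition sphere_measure :: "(real ^ 3) measure"
  where "sphere_measure = distr (uniform_measure lborel (ball 0 1)) borel sgn"

lemma borel_measurable_sgn_vec [measurable]: "(sgn :: real ^ 3 \<Rightarrow> real ^ 3) \<in> borel_measurable borel"
  unfolding sgn_div_norm[abs_def] by measurable

lemma space_sphere_measure [simp]: "space sphere_measure = UNIV"
  and sets_sphere_measure [simp, measurable_cong]: "sets sphere_measure = sets borel"
  by (simp_all add: sphere_measure_def)

lemma prob_space_sphere: "prob_space sphere_measure"
proof -
  have "prob_space (uniform_measure lborel (ball (0 :: real ^ 3) 1))"
    by (rule prob_space_uniform_measure)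
      (use emeasure_lborel_ball_finite[of "0 :: real ^ 3" 1] in \<open>auto simp: emeasure_ball unit_ball_vol_pos less_imp_neq[symmetric]\<close>)
  then show ?thesis unfolding sphere_measure_def by (rule prob_space.prob_space_distr) simp
qed

interpretation sphere: prob_space sphere_measure by (rule prob_space_sphere)

lemma AE_sphere_norm: "AE \<omega> in sphere_measure. norm \<omega> = 1"
proof -
  have "AE y in lborel. y \<noteq> (0 :: real ^ 3)" by (rule AE_lborel_singleton)
  then have "AE y in lborel. y \<in> ball 0 1 \<longrightarrow> norm (sgn (y :: real ^ 3)) = 1"
    by eventually_elim (simp add: norm_sgn)
  then show ?thesis
    unfolding sphere_measure_def by (subst AE_distr_iff) (auto intro!: AE_uniform_measureI)
qed

text \<open>An orthogonal map preserves the ball and its volume, and it commutes with \<open>sgn\<close>.\<close>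

lemma distr_sphere_orthogonal:
  assumes T: "orthogonal_transformation T"
  shows "distr sphere_measure borel T = sphere_measure"
proof (rule measure_eqI)
  have lin: "linear T" using T by (rule orthogonal_transformation_linear)
  have [measurable]: "T \<in> borel_measurable borel"
    using lin by (intro borel_measurable_continuous_onI linear_continuous_on) (simp add: linear_linear)
  have Tsgn: "T (sgn y) = sgn (T y)" for y
    by (simp add: sgn_div_norm linear_scale[OF lin] orthogonal_transformation_norm[OF T])
  fix S assume "S \<in> sets (distr sphere_measure borel T)"
  then have S [measurable]: "S \<in> sets borel" by simp
  let ?A = "{y \<in> ball 0 1. sgn (T y) \<in> S}" and ?B = "{y \<in> ball 0 1. sgn y \<in> S}"
  have mA [measurable]: "?A \<in> sets borel" and mB [measurable]: "?B \<in> sets borel"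
    by measurable
  have lm: "C \<in> lmeasurable" if "C \<in> sets borel" "C \<subseteq> ball 0 1" for C :: "(real ^ 3) set"
    using that by (intro bounded_set_imp_lmeasurable) (auto intro: bounded_subset)
  have A: "?A \<in> lmeasurable" and B: "?B \<in> lmeasurable" by (auto intro!: lm)
  have "T ` ?A = ?B"
  proof (intro equalityI subsetI)
    fix y assume y: "y \<in> ?B"
    obtain x where "y = T x" using orthogonal_transformation_surj[OF T] by (metis surjE)
    then show "y \<in> T ` ?A" using y orthogonal_transformation_norm[OF T] by auto
  qed (use orthogonal_transformation_norm[OF T] in auto)
  then have "measure lebesgue ?A = measure lebesgue ?B"
    using measure_orthogonal_image[OF T A] by simp
  then have "emeasure lebesgue ?A = emeasure lebesgue ?B"
    using A B by (simp add: emeasure_eq_measure2)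
  then have eq: "emeasure lborel ?A = emeasure lborel ?B" by simp
  have AB: "ball 0 1 \<inter> (\<lambda>y. T (sgn y)) -` S = ?A" "ball 0 1 \<inter> sgn -` S = ?B"
    by (auto simp: Tsgn)
  have [measurable]: "(\<lambda>x. T (sgn x)) -` S \<in> sets borel" "sgn -` S \<in> sets borel"
    using measurable_sets_borel[of "\<lambda>x. T (sgn x)" borel S] measurable_sets_borel[of sgn borel S] by measurable
  show "emeasure (distr sphere_measure borel T) S = emeasure sphere_measure S"
    unfolding sphere_measure_def
    using eq by (simp add: distr_distr emeasure_distr AB[unfolded o_def] o_def)
qed simp

lemma sphere_integral_orthogonal:
  assumes T: "orthogonal_transformation T" and k [measurable]: "k \<in> borel_measurable borel"
  shows "(\<integral>\<omega>. k (T \<omega>) \<partial>sphere_measure) = (\<integral>\<omega>. k \<omega> \<partial>sphere_measure :: real)"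
proof -
  have [measurable]: "T \<in> borel_measurable borel"
    using orthogonal_transformation_linear[OF T]
    by (intro borel_measurable_continuous_onI linear_continuous_on) (simp add: linear_linear)
  show ?thesis by (subst (2) distr_sphere_orthogonal[OF T, symmetric]) (simp add: integral_distr)
qed

lemma orthogonal_transformation_uminus: "orthogonal_transformation (\<lambda>x :: real ^ 3. - x)"
  by (simp add: orthogonal_transformation linear_uminus)

lemma rotation_orthogonal:
  fixes i j :: 3
  assumes "i \<noteq> j" and c: "c\<^sup>2 + s\<^sup>2 = (1 :: real)"
  shows "orthogonal_transformation (\<lambda>v. v - v $ i *\<^sub>R axis i 1 - v $ j *\<^sub>R axis j 1 +
    c *\<^sub>R (v $ i *\<^sub>R axis i 1 + v $ j *\<^sub>R axis j 1) + s *\<^sub>R (v $ i *\<^sub>R axis j 1 - v $ j *\<^sub>R axis i (1 :: real)))"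
    (is "orthogonal_transformation ?T")
  unfolding orthogonal_transformation
proof (intro conjI allI)
  show "linear ?T" by (intro linearI) (auto simp: algebra_simps)
  fix v :: "real ^ 3"
  have comp: "?T v $ k = (if k = i then c * v $ i - s * v $ j else if k = j then s * v $ i + c * v $ j else v $ k)" for k
    using assms(1) by (auto simp: axis_def)
  have split: "(\<Sum>k\<in>UNIV. f k) = f i + f j + (\<Sum>k\<in>UNIV - {i} - {j}. f k)" for f :: "3 \<Rightarrow> real"
    using assms(1) by (simp add: sum.remove[of UNIV i] sum.remove[of "UNIV - {i}" j])
  have "(c * v $ i - s * v $ j)\<^sup>2 + (s * v $ i + c * v $ j)\<^sup>2 = (c\<^sup>2 + s\<^sup>2) * ((v $ i)\<^sup>2 + (v $ j)\<^sup>2)"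
    by (simp add: power2_eq_square algebra_simps)
  then have "(\<Sum>k\<in>UNIV. (?T v $ k)\<^sup>2) = (\<Sum>k\<in>UNIV. (v $ k)\<^sup>2)"
    unfolding comp split[of "\<lambda>k. (if k = i then c * v $ i - s * v $ j else if k = j then s * v $ i + c * v $ j else v $ k)\<^sup>2"] split[of "\<lambda>k. (v $ k)\<^sup>2"]
    using assms by simp
  then show "norm (?T v) = norm v" by (simp add: norm_vec_def L2_set_def)
qed

lemma vec_axis_sum: "(v :: real ^ 'n) = (\<Sum>i\<in>UNIV. v $ i *\<^sub>R axis i 1)"
  by (simp add: vec_eq_iff axis_def if_distrib cong: if_cong)

lemma dir_deriv_axis:
  fixes h :: "real ^ 'n \<Rightarrow> real"
  assumes "h differentiable (at x)"
  shows "dir_deriv v h x = (\<Sum>i\<in>UNIV. v $ i * dir_deriv (axis i 1) h x)"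
proof -
  note l = linear_dir_deriv[OF assms]
  have "dir_deriv v h x = dir_deriv (\<Sum>i\<in>UNIV. v $ i *\<^sub>R axis i 1) h x"
    by (subst vec_axis_sum[of v]) simp
  then show ?thesis by (simp add: linear_sum[OF l] linear_scale[OF l])
qed

lemma sphere_integrable_continuous:
  assumes "continuous_on UNIV (k :: real ^ 3 \<Rightarrow> real)"
  shows "integrable sphere_measure k"
proof -
  have "compact (k ` cball 0 1)"
    by (rule compact_continuous_image[OF continuous_on_subset[OF assms]]) auto
  then obtain B where "\<forall>w\<in>cball 0 1. \<bar>k w\<bar> \<le> B"
    using compact_imp_bounded[of "k ` cball 0 1"] by (auto simp: bounded_iff)
  then have B: "\<And>w. norm w \<le> 1 \<Longrightarrow> \<bar>k w\<bar> \<le> B" by simp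
  have "AE w in sphere_measure. norm (k w) \<le> B"
    using AE_sphere_norm by eventually_elim (simp add: B)
  then show ?thesis
    using borel_measurable_continuous_onI[OF assms]
    by (intro sphere.integrable_const_bound) (auto simp: measurable_def sphere_measure_def)
qed

text \<open>Rotating the sphere in the plane of the coordinates \<open>i\<close> and \<open>j\<close> does not change the mean of
  \<open>k\<close>; the derivative of the rotated mean at angle zero is the mean of the rotational derivative.\<close>

lemma sphere_mean_rotation_field:
  fixes k :: "real ^ 3 \<Rightarrow> real"
  assumes k: "Ck (Suc 0) k" and ij: "i \<noteq> j"
  shows "(\<integral>w. w $ i * dir_deriv (axis j 1) k w - w $ j * dir_deriv (axis i 1) k w \<partial>sphere_measure) = 0"
proof -
  \<comment> \<open>\<open>A w (1, cos \<alpha>, sin \<alpha>)\<close> is \<open>w\<close> rotated by the angle \<open>\<alpha>\<close>. The rotation is not linear in \<open>\<alpha>\<close>,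
    but it is linear in the triple, and so the superposition lemmas apply.\<close>
  define A where "A w z = fst z *\<^sub>R (w - w $ i *\<^sub>R axis i 1 - w $ j *\<^sub>R axis j 1) +
    fst (snd z) *\<^sub>R (w $ i *\<^sub>R axis i 1 + w $ j *\<^sub>R axis j 1) +
    snd (snd z) *\<^sub>R (w $ i *\<^sub>R axis j 1 - w $ j *\<^sub>R axis i 1)"
    for w :: "real ^ 3" and z :: "real \<times> real \<times> real"
  interpret rot: linear_superposition sphere_measure A 9
  proof (intro linear_superposition.intro linear_superposition_axioms.intro)
    show "finite_measure sphere_measure" by (rule sphere.finite_measure_axioms)
    show "linear (A w)" for w unfolding A_def by (intro linearI) (auto simp: algebra_simps)
    have "(\<lambda>w. A w z) \<in> borel_measurable borel" for z
      unfolding A_def by (intro borel_measurable_continuous_onI continuous_intros)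
    then show "(\<lambda>w. A w z) \<in> borel_measurable sphere_measure" for z
      by (simp cong: measurable_cong_sets)
    show "AE w in sphere_measure. \<forall>z. norm (A w z) \<le> 9 * norm z"
      using AE_sphere_norm
    proof eventually_elim
      case (elim w)
      show ?case
      proof
        fix z :: "real \<times> real \<times> real"
        have c: "\<bar>w $ i\<bar> \<le> 1" "\<bar>w $ j\<bar> \<le> 1" using component_le_norm_cart[of w] elim by metis+
        have n1: "norm (w - w $ i *\<^sub>R axis i 1 - w $ j *\<^sub>R axis j 1) \<le> 3"
          using norm_triangle_ineq4[of w "w $ i *\<^sub>R axis i 1"]
            norm_triangle_ineq4[of "w - w $ i *\<^sub>R axis i 1" "w $ j *\<^sub>R axis j 1"] c elim
          by (simp add: norm_axis_1)
        have n2: "norm (w $ i *\<^sub>R axis i (1::real) + w $ j *\<^sub>R axis j 1 :: real ^ 3) \<le> 3"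
          using norm_triangle_ineq[of "w $ i *\<^sub>R axis i (1::real) :: real ^ 3" "w $ j *\<^sub>R axis j 1"] c
          by (simp add: norm_axis_1)
        have n3: "norm (w $ i *\<^sub>R axis j (1::real) - w $ j *\<^sub>R axis i 1 :: real ^ 3) \<le> 3"
          using norm_triangle_ineq4[of "w $ i *\<^sub>R axis j (1::real) :: real ^ 3" "w $ j *\<^sub>R axis i 1"] c
          by (simp add: norm_axis_1)
        have z: "\<bar>fst z\<bar> \<le> norm z" "\<bar>fst (snd z)\<bar> \<le> norm z" "\<bar>snd (snd z)\<bar> \<le> norm z"
          using norm_fst_le[of "fst z" "snd z"] norm_snd_le[of "snd z" "fst z"]
            norm_fst_le[of "fst (snd z)" "snd (snd z)"] norm_snd_le[of "snd (snd z)" "fst (snd z)"] by auto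
        have "norm (A w z) \<le> norm z * 3 + norm z * 3 + norm z * 3"
          unfolding A_def using z n1 n2 n3
          by (intro norm_triangle_le add_mono) (auto intro!: mult_mono)
        then show "norm (A w z) \<le> 9 * norm z" by simp
      qed
    qed
  qed
  let ?\<Phi> = "rot.superpose (\<lambda>_. 1) k"
  have ck: "continuous_on UNIV k" using k Ck_continuous by blast
  have const: "?\<Phi> (1, cos \<alpha>, sin \<alpha>) = (\<integral>w. k w \<partial>sphere_measure)" for \<alpha>
    unfolding rot.superpose_def A_def
    using sphere_integral_orthogonal[OF rotation_orthogonal[OF ij, of "cos \<alpha>" "sin \<alpha>"] borel_measurable_continuous_onI[OF ck]]
    by simp
  have "Ck (Suc 0) ?\<Phi>" by (intro rot.Ck_superpose k rot.weight_const)
  then have D: "(?\<Phi> has_derivative (\<lambda>v. dir_deriv v ?\<Phi> (1, cos 0, sin 0))) (at (1, cos 0, sin 0))"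
    by (intro has_derivative_dir_deriv) simp
  have path: "((\<lambda>\<alpha>. (1, cos \<alpha>, sin \<alpha>)) has_derivative (\<lambda>h. (0, 0, h))) (at (0::real))"
    by (auto intro!: derivative_eq_intros)
  have "((\<lambda>\<alpha>. ?\<Phi> (1, cos \<alpha>, sin \<alpha>)) has_derivative (\<lambda>h. dir_deriv (0, 0, h) ?\<Phi> (1, cos 0, sin 0))) (at 0)"
    by (rule has_derivative_compose[OF path D])
  moreover have "((\<lambda>\<alpha>. ?\<Phi> (1, cos \<alpha>, sin \<alpha>)) has_derivative (\<lambda>h. 0)) (at 0)"
    unfolding const by simp
  ultimately have "dir_deriv (0, 0, 1) ?\<Phi> (1, cos 0, sin 0) = 0"
    using has_derivative_unique by (metis (no_types, lifting))
  then have "(\<integral>w. dir_deriv (w $ i *\<^sub>R axis j 1 - w $ j *\<^sub>R axis i 1) k w \<partial>sphere_measure) = 0"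
    by (simp add: rot.dir_deriv_superpose_integral[OF rot.weight_const k] A_def)
  moreover have "dir_deriv (w $ i *\<^sub>R axis j 1 - w $ j *\<^sub>R axis i 1) k w =
      w $ i * dir_deriv (axis j 1) k w - w $ j * dir_deriv (axis i 1) k w" for w
  proof -
    have l: "linear (\<lambda>v. dir_deriv v k w)" using k by (intro linear_dir_deriv) simp
    show ?thesis by (simp add: linear_diff[OF l] linear_scale[OF l])
  qed
  ultimately show ?thesis by simp
qed

section \<open>The Darboux equation\<close>

lemma Ck_nth: "Ck k (\<lambda>w :: real ^ 3. w $ i)"
  by (rule Ck_linear) (auto intro: linearI)

text \<open>On the unit sphere the integrand is the spherical Laplacian of \<open>H\<close>, written in the
  derivatives of the ambient space. The spherical Laplacian is the sum of the squares of the rotation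
  fields of the three coordinate planes, and a rotational derivative has mean zero.\<close>

lemma sphere_mean_Laplacian:
  fixes H :: "real ^ 3 \<Rightarrow> real"
  assumes H: "Ck 2 H"
  defines "D \<equiv> \<lambda>i j. dir_deriv (axis i 1) (dir_deriv (axis j 1) H)"
  shows "(\<integral>w. (\<Sum>i\<in>UNIV. D i i w) - (\<Sum>i\<in>UNIV. \<Sum>j\<in>UNIV. w $ i * w $ j * D i j w)
      - 2 * (\<Sum>i\<in>UNIV. w $ i * dir_deriv (axis i 1) H w) \<partial>sphere_measure) = 0"
proof -
  have H2: "Ck (Suc (Suc 0)) H" using H by (simp add: numeral_2_eq_2)
  define R where "R i j = (\<lambda>w. w $ i * dir_deriv (axis j 1) H w - w $ j * dir_deriv (axis i 1) H w)" for i j :: 3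
  define RR where "RR i j w = w $ i * dir_deriv (axis j 1) (R i j) w - w $ j * dir_deriv (axis i 1) (R i j) w" for i j w
  have CR: "Ck (Suc 0) (R i j)" for i j
    unfolding R_def by (intro Ck_diff Ck_mult Ck_nth Ck_dir_deriv H2)
  have mean: "(\<integral>w. RR i j w \<partial>sphere_measure) = 0" if "i \<noteq> j" for i j
    unfolding RR_def by (rule sphere_mean_rotation_field[OF CR that])
  have DR: "dir_deriv v (R i j) w = w $ i * dir_deriv v (dir_deriv (axis j 1) H) w + v $ i * dir_deriv (axis j 1) H w
      - (w $ j * dir_deriv v (dir_deriv (axis i 1) H) w + v $ j * dir_deriv (axis i 1) H w)" for v i j w
  proof -
    have d: "(dir_deriv (axis i 1) H has_derivative (\<lambda>v. dir_deriv v (dir_deriv (axis i 1) H) w)) (at w)" for i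
      using H2 by (intro has_derivative_dir_deriv) simp
    have n: "((\<lambda>w. w $ i) has_derivative (\<lambda>v. v $ i)) (at w)" for i :: 3
      by (rule bounded_linear_imp_has_derivative) (rule bounded_linear_vec_nth)
    show ?thesis unfolding R_def
      by (rule dir_deriv_eq) (auto intro!: derivative_eq_intros d n)
  qed
  have int: "integrable sphere_measure (RR i j)" for i j
    unfolding RR_def
    by (intro sphere_integrable_continuous continuous_intros)
      (use CR in \<open>auto intro!: continuous_intros\<close>)
  have Df: "dir_deriv (axis i 1) (dir_deriv (axis j 1) H) = D i j" for i j by (simp add: D_def)
  have sym: "D i j w = D j i w" for i j w unfolding D_def by (rule dir_deriv_commute[OF H])
  have "(\<integral>w. RR 1 2 w + RR 1 3 w + RR 2 3 w \<partial>sphere_measure) = 0"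
    using int mean by simp
  moreover have "AE w in sphere_measure. RR 1 2 w + RR 1 3 w + RR 2 3 w = (\<Sum>i\<in>UNIV. D i i w) -
      (\<Sum>i\<in>UNIV. \<Sum>j\<in>UNIV. w $ i * w $ j * D i j w) - 2 * (\<Sum>i\<in>UNIV. w $ i * dir_deriv (axis i 1) H w)"
    using AE_sphere_norm
  proof eventually_elim
    case (elim w)
    then have "(w $ 1)\<^sup>2 + (w $ 2)\<^sup>2 + (w $ 3)\<^sup>2 = 1"
      by (simp add: norm_vec_def L2_set_def sum_3)
    then have 1: "(w $ 1)\<^sup>2 = 1 - (w $ 2)\<^sup>2 - (w $ 3)\<^sup>2" by simp
    have s: "D 2 1 w = D 1 2 w" "D 3 1 w = D 1 3 w" "D 3 2 w = D 2 3 w" by (rule sym)+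
    have a: "axis i (1::real) $ j = (if i = j then 1 else 0)" for i j :: 3 by (simp add: axis_def)
    have "(D 1 1 w + D 2 2 w + D 3 3 w) * ((w $ 1)\<^sup>2 + (w $ 2)\<^sup>2 + (w $ 3)\<^sup>2) = D 1 1 w + D 2 2 w + D 3 3 w"
      using 1 by simp
    then show ?case
      unfolding RR_def DR Df sum_3 a s
      by (simp add: s power2_eq_square algebra_simps)
  qed
  moreover have "continuous_on UNIV (D i j)" "continuous_on UNIV (dir_deriv (axis i 1) H)" for i j
    using H2 Ck_continuous[OF Ck_dir_deriv[OF H2]] by (auto simp: D_def)
  then have "integrable sphere_measure (\<lambda>w. (\<Sum>i\<in>UNIV. D i i w) -
      (\<Sum>i\<in>UNIV. \<Sum>j\<in>UNIV. w $ i * w $ j * D i j w) - 2 * (\<Sum>i\<in>UNIV. w $ i * dir_deriv (axis i 1) H w))"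
    by (intro sphere_integrable_continuous continuous_intros) auto
  ultimately show ?thesis
    using int integral_cong_AE[of "\<lambda>w. RR 1 2 w + RR 1 3 w + RR 2 3 w" sphere_measure] by auto
qed

lemma dir_deriv_affine:
  fixes h :: "'a::euclidean_space \<Rightarrow> real"
  assumes "h differentiable (at (x + r *\<^sub>R w))"
  shows "dir_deriv v (\<lambda>w. h (x + r *\<^sub>R w)) w = r * dir_deriv v h (x + r *\<^sub>R w)"
proof -
  have i: "((\<lambda>w. x + r *\<^sub>R w) has_derivative (\<lambda>v. r *\<^sub>R v)) (at w)"
    by (auto intro!: derivative_eq_intros)
  show ?thesis
    using dir_deriv_eq[OF has_derivative_compose[OF i has_derivative_dir_deriv[OF assms]]]
      linear_scale[OF linear_dir_deriv[OF assms]] by simp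
qed

lemma Ck_affine:
  fixes h :: "'a::euclidean_space \<Rightarrow> real"
  shows "Ck k h \<Longrightarrow> Ck k (\<lambda>w. h (x + r *\<^sub>R w))"
proof (induction k arbitrary: h)
  case 0
  then show ?case by (auto intro!: continuous_intros continuous_on_compose2[of UNIV h])
next
  case (Suc k)
  have d: "(\<lambda>w. h (x + r *\<^sub>R w)) differentiable (at w)" for w
    using differentiable_chain_at[of "\<lambda>w. x + r *\<^sub>R w" w h] Suc.prems by (simp add: o_def)
  show ?case
  proof (rule Ck_SucI)
    show "((\<lambda>w. h (x + r *\<^sub>R w)) has_derivative (\<lambda>v. r * dir_deriv v h (x + r *\<^sub>R w))) (at w)" for w
      using has_derivative_dir_deriv[OF d] Suc.prems by (simp add: dir_deriv_affine)
    show "Ck k (\<lambda>w. r * dir_deriv v h (x + r *\<^sub>R w))" for v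
      by (intro Ck_cmult Suc.IH Ck_dir_deriv Suc.prems)
  qed
qed

text \<open>The Darboux equation for spherical means, stated for the integrands: the previous identity for
  \<open>w \<mapsto> h (x + r w)\<close>, divided by \<open>r\<close>. At \<open>r = 0\<close> the quotient degenerates, and what remains
  is the vanishing of the mean of an odd function.\<close>

lemma Darboux:
  fixes h :: "real ^ 3 \<Rightarrow> real"
  assumes h: "Ck 2 h"
  shows "(\<integral>w. r * (\<Sum>i\<in>UNIV. dir_deriv (axis i 1) (dir_deriv (axis i 1) h) (x + r *\<^sub>R w))
      - r * dir_deriv w (dir_deriv w h) (x + r *\<^sub>R w)
      - 2 * dir_deriv w h (x + r *\<^sub>R w) \<partial>sphere_measure) = 0"
proof (cases "r = 0")
  case True
  have l: "linear (\<lambda>v. dir_deriv v h x)" using h by (intro linear_dir_deriv) (simp add: numeral_2_eq_2)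
  have m: "(\<lambda>v. dir_deriv v h x) \<in> borel_measurable borel"
    using l by (intro borel_measurable_continuous_onI linear_continuous_on) (simp add: linear_linear)
  have "(\<integral>w. dir_deriv (- w) h x \<partial>sphere_measure) = (\<integral>w. dir_deriv w h x \<partial>sphere_measure)"
    by (rule sphere_integral_orthogonal[OF orthogonal_transformation_uminus m])
  then show ?thesis using True by (simp add: linear_neg[OF l])
next
  case False
  have h2: "Ck (Suc (Suc 0)) h" using h by (simp add: numeral_2_eq_2)
  have d: "h differentiable (at y)" "dir_deriv v h differentiable (at y)" for v y using h2 by auto
  define H where "H w = h (x + r *\<^sub>R w)" for w
  have 1: "dir_deriv v H = (\<lambda>w. r * dir_deriv v h (x + r *\<^sub>R w))" for v
    unfolding H_def by (rule ext) (rule dir_deriv_affine[OF d(1)])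
  have 2: "dir_deriv u (dir_deriv v H) w = r\<^sup>2 * dir_deriv u (dir_deriv v h) (x + r *\<^sub>R w)" for u v w
  proof -
    have "(\<lambda>w. dir_deriv v h (x + r *\<^sub>R w)) differentiable (at w)"
      using Ck_affine[of "Suc 0" "dir_deriv v h" x r] h2 by simp
    then show ?thesis
      unfolding 1 by (simp add: dir_deriv_cmult dir_deriv_affine[OF d(2)] power2_eq_square)
  qed
  have W: "dir_deriv w (dir_deriv w h) y = (\<Sum>i\<in>UNIV. \<Sum>j\<in>UNIV. w $ i * w $ j * dir_deriv (axis i 1) (dir_deriv (axis j 1) h) y)"
    for w y
  proof -
    have e: "dir_deriv w h = (\<lambda>y. \<Sum>j\<in>UNIV. w $ j * dir_deriv (axis j 1) h y)"
      by (rule ext) (rule dir_deriv_axis[OF d(1)])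
    have "dir_deriv u (dir_deriv w h) y = (\<Sum>j\<in>UNIV. w $ j * dir_deriv u (dir_deriv (axis j 1) h) y)" for u
      unfolding e by (subst dir_deriv_sum) (use d(2) in \<open>auto simp: dir_deriv_cmult intro!: differentiable_mult\<close>)
    then show ?thesis
      by (subst dir_deriv_axis[OF d(2)]) (simp add: sum_distrib_left algebra_simps)
  qed
  have "Ck 2 H" unfolding H_def by (rule Ck_affine[OF h])
  from sphere_mean_Laplacian[OF this]
  have I: "(\<integral>w. (\<Sum>i\<in>UNIV. r\<^sup>2 * dir_deriv (axis i 1) (dir_deriv (axis i 1) h) (x + r *\<^sub>R w))
      - (\<Sum>i\<in>UNIV. \<Sum>j\<in>UNIV. w $ i * w $ j * (r\<^sup>2 * dir_deriv (axis i 1) (dir_deriv (axis j 1) h) (x + r *\<^sub>R w)))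
      - 2 * (\<Sum>i\<in>UNIV. w $ i * (r * dir_deriv (axis i 1) h (x + r *\<^sub>R w))) \<partial>sphere_measure) = 0"
    unfolding 2 unfolding 1 .
  have "(\<integral>w. r * (r * (\<Sum>i\<in>UNIV. dir_deriv (axis i 1) (dir_deriv (axis i 1) h) (x + r *\<^sub>R w))
      - r * dir_deriv w (dir_deriv w h) (x + r *\<^sub>R w)
      - 2 * dir_deriv w h (x + r *\<^sub>R w)) \<partial>sphere_measure) = 0"
  proof (rule trans[OF Bochner_Integration.integral_cong[OF refl] I])
    fix w
    show "r * (r * (\<Sum>i\<in>UNIV. dir_deriv (axis i 1) (dir_deriv (axis i 1) h) (x + r *\<^sub>R w))
      - r * dir_deriv w (dir_deriv w h) (x + r *\<^sub>R w)
      - 2 * dir_deriv w h (x + r *\<^sub>R w)) =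
      (\<Sum>i\<in>UNIV. r\<^sup>2 * dir_deriv (axis i 1) (dir_deriv (axis i 1) h) (x + r *\<^sub>R w))
      - (\<Sum>i\<in>UNIV. \<Sum>j\<in>UNIV. w $ i * w $ j * (r\<^sup>2 * dir_deriv (axis i 1) (dir_deriv (axis j 1) h) (x + r *\<^sub>R w)))
      - 2 * (\<Sum>i\<in>UNIV. w $ i * (r * dir_deriv (axis i 1) h (x + r *\<^sub>R w)))"
      unfolding W[of w] dir_deriv_axis[OF d(1), of w "x + r *\<^sub>R w"]
      by (simp add: sum_distrib_left algebra_simps power2_eq_square)
  qed
  then show ?thesis using False by simp
qed

section \<open>Radial functions and Archimedes' theorem\<close>

lemma Ck_power: "Ck k (\<lambda>z :: real. z ^ n)"
proof (induction n)
  case (Suc n)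
  have "Ck k (\<lambda>z::real. z)" by (rule Ck_linear) (auto intro: linearI)
  then show ?case using Ck_mult[of k "\<lambda>z. z"] Suc by simp
qed (simp add: Ck_const)

lemma dir_deriv_power: "dir_deriv 1 (\<lambda>z :: real. z ^ n) = (\<lambda>z. real n * z ^ (n - 1))"
proof
  fix z :: real
  have "((\<lambda>z. z ^ n) has_derivative (\<lambda>h. (real n * z ^ (n - 1)) * h)) (at z)"
    by (auto intro!: derivative_eq_intros)
  from dir_deriv_eq[OF this] show "dir_deriv 1 (\<lambda>z. z ^ n) z = real n * z ^ (n - 1)" by simp
qed

lemma zonal_derivative:
  fixes e :: "real ^ 3"
  assumes f: "Ck (Suc 0) f"
  shows "dir_deriv v (\<lambda>y. f (y \<bullet> e)) y = dir_deriv 1 f (y \<bullet> e) * (v \<bullet> e)"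
proof -
  have "((\<lambda>y. y \<bullet> e) has_derivative (\<lambda>v. v \<bullet> e)) (at y)" by (auto intro!: derivative_eq_intros)
  then have "(\<lambda>y. y \<bullet> e) differentiable (at y)" "dir_deriv v (\<lambda>y. y \<bullet> e) y = v \<bullet> e"
    by (auto simp: differentiable_def dir_deriv_eq)
  then show ?thesis using dir_deriv_compose[of "\<lambda>y. y \<bullet> e" y f v] f by simp
qed

text \<open>On functions of \<open>w \<bullet> e\<close> alone the spherical Laplacian is the Legendre operator.\<close>

lemma zonal_Legendre:
  fixes e :: "real ^ 3"
  assumes f: "Ck 2 f" and e: "norm e = 1"
  shows "(\<integral>w. (1 - (w \<bullet> e)\<^sup>2) * dir_deriv 1 (dir_deriv 1 f) (w \<bullet> e)
    - 2 * (w \<bullet> e) * dir_deriv 1 f (w \<bullet> e) \<partial>sphere_measure) = 0"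
proof -
  have f2: "Ck (Suc (Suc 0)) f" using f by (simp add: numeral_2_eq_2)
  have 1: "dir_deriv v (\<lambda>y. f (y \<bullet> e)) = (\<lambda>y. (v \<bullet> e) * dir_deriv 1 f (y \<bullet> e))" for v
    by (rule ext) (simp add: zonal_derivative[OF Ck_SucD[OF f2]])
  have 2: "dir_deriv u (dir_deriv v (\<lambda>y. f (y \<bullet> e))) y = (v \<bullet> e) * (u \<bullet> e) * dir_deriv 1 (dir_deriv 1 f) (y \<bullet> e)" for u v y
  proof -
    have "Ck (Suc 0) (\<lambda>y. dir_deriv 1 f (y \<bullet> e))"
      by (rule Ck_compose[OF Ck_dir_deriv[OF f2] Ck_linear]) (auto intro: linearI simp: inner_add_left)
    then show ?thesis unfolding 1
      by (simp add: dir_deriv_cmult zonal_derivative[OF Ck_dir_deriv[OF f2]] del: One_nat_def)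
  qed
  have "Ck 2 (\<lambda>y. f (y \<bullet> e))"
    by (rule Ck_compose[OF f Ck_linear]) (auto intro: linearI simp: inner_add_left)
  from Darboux[OF this, of 1 0]
  have D: "(\<integral>w. (\<Sum>i\<in>UNIV. (axis i 1 \<bullet> e) * (axis i 1 \<bullet> e) * dir_deriv 1 (dir_deriv 1 f) (w \<bullet> e))
      - (w \<bullet> e) * (w \<bullet> e) * dir_deriv 1 (dir_deriv 1 f) (w \<bullet> e)
      - 2 * ((w \<bullet> e) * dir_deriv 1 f (w \<bullet> e)) \<partial>sphere_measure) = 0"
    unfolding 2 unfolding 1 by simp
  have "(\<Sum>i\<in>UNIV. (axis i 1 \<bullet> e) * (axis i 1 \<bullet> e)) = (norm e)\<^sup>2"
    by (simp add: inner_axis' norm_vec_def L2_set_def power2_eq_square sum_nonneg)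
  then have s: "(\<Sum>i\<in>UNIV. (axis i 1 \<bullet> e) * (axis i 1 \<bullet> e) * c) = c" for c
    using e by (simp add: sum_distrib_right[symmetric])
  show ?thesis
    using D unfolding s by (simp add: power2_eq_square algebra_simps)
qed

lemma zonal_integrable:
  "continuous_on UNIV \<phi> \<Longrightarrow> integrable sphere_measure (\<lambda>w. \<phi> (w \<bullet> e) :: real)"
  by (rule sphere_integrable_continuous, rule continuous_on_compose2[of UNIV \<phi>]) (auto intro!: continuous_intros)

text \<open>Applied to a monomial, the Legendre operator gives the recursion
  \<open>(n + 1) m\<^sub>n = (n - 1) m\<^sub>n\<^sub>-\<^sub>2\<close> for the moments of \<open>w \<bullet> e\<close>.\<close>

lemma zonal_moments:
  fixes e :: "real ^ 3"
  assumes e: "norm e = 1"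
  shows "(\<integral>w. (w \<bullet> e) ^ n \<partial>sphere_measure) = (1 + (- 1) ^ n) / (2 * (real n + 1))"
proof (induction n rule: less_induct)
  case (less n)
  show ?case
  proof (cases "n < 2")
    case True
    then consider "n = 0" | "n = 1" by linarith
    then show ?thesis
    proof cases
      case 1
      then show ?thesis by (simp add: sphere.prob_space[simplified])
    next
      case 2
      have "Ck 2 (\<lambda>z::real. z)" by (rule Ck_linear) (auto intro: linearI)
      from zonal_Legendre[OF this e] have "(\<integral>w. 2 * (w \<bullet> e) \<partial>sphere_measure) = 0"
        using dir_deriv_power[of 1] dir_deriv_power[of 0] by simp
      then show ?thesis using 2 by simp
    qed
  next
    case False
    then obtain m where n: "n = m + 2" by (metis add.commute le_Suc_ex linorder_not_less)
    let ?I = "\<lambda>n. (\<integral>w. (w \<bullet> e) ^ n \<partial>sphere_measure)"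
    have int: "integrable sphere_measure (\<lambda>w. (w \<bullet> e) ^ k)" for k
      using zonal_integrable[of "\<lambda>z. z ^ k" e] by (simp add: continuous_intros)
    have d1: "dir_deriv 1 (\<lambda>z :: real. z ^ n) = (\<lambda>z. real n * z ^ (n - 1))" by (rule dir_deriv_power)
    have d2: "dir_deriv 1 (dir_deriv 1 (\<lambda>z :: real. z ^ n)) z = real n * (real (n - 1) * z ^ (n - 1 - 1))" for z
    proof -
      have "(\<lambda>z :: real. z ^ (n - 1)) differentiable (at z)"
        using Ck_power[of "Suc 0" "n - 1"] by simp
      then show ?thesis unfolding d1 by (simp add: dir_deriv_cmult dir_deriv_power)
    qed
    have "0 = (\<integral>w. (1 - (w \<bullet> e)\<^sup>2) * (real n * (real (n - 1) * (w \<bullet> e) ^ (n - 1 - 1)))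
        - 2 * (w \<bullet> e) * (real n * (w \<bullet> e) ^ (n - 1)) \<partial>sphere_measure)"
      using zonal_Legendre[OF Ck_power[of 2 n] e] unfolding d2 unfolding d1 by simp
    also have "\<dots> = (\<integral>w. real n * ((real m + 1) * (w \<bullet> e) ^ m - (real m + 3) * (w \<bullet> e) ^ n) \<partial>sphere_measure)"
      by (rule Bochner_Integration.integral_cong) (auto simp: n power2_eq_square algebra_simps)
    also have "\<dots> = real n * ((real m + 1) * ?I m - (real m + 3) * ?I n)"
      using int by simp
    finally have "(real m + 3) * ?I n = (real m + 1) * ?I m" using n by simp
    also have "\<dots> = (1 + (- 1) ^ m) / 2"
      using less.IH[of m] n by (simp add: field_simps)
    finally show ?thesis using n by (simp add: field_simps)
  qed
qed

text \<open>Archimedes' hat-box theorem: the projection of the uniform measure on the sphere to a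
  diameter is uniform. Moments determine it, since polynomials are dense on the diameter.\<close>

lemma Archimedes_zonal:
  fixes e :: "real ^ 3"
  assumes e: "norm e = 1" and \<phi>: "continuous_on UNIV (\<phi> :: real \<Rightarrow> real)"
  shows "(\<integral>w. \<phi> (w \<bullet> e) \<partial>sphere_measure) = integral {-1..1} \<phi> / 2"
proof -
  have poly: "(\<integral>w. p (w \<bullet> e) \<partial>sphere_measure) = integral {-1..1} p / 2"
    if p: "real_polynomial_function p" for p
  proof -
    obtain a n where p: "p = (\<lambda>x. \<Sum>i\<le>(n::nat). a i * x ^ i)"
      using real_polynomial_function_imp_sum[OF p] by blast
    have int: "integrable sphere_measure (\<lambda>w. (w \<bullet> e) ^ k)" for k
      using zonal_integrable[of "\<lambda>z. z ^ k" e] by (simp add: continuous_intros)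
    have "(\<integral>w. p (w \<bullet> e) \<partial>sphere_measure) = (\<Sum>i\<le>n. a i * ((1 + (- 1) ^ i) / (2 * (real i + 1))))"
      unfolding p using int by (simp add: zonal_moments[OF e] del: times_divide_eq_right)
    moreover have "((\<lambda>x::real. x ^ k) has_integral (1 + (- 1) ^ k) / (real k + 1)) {-1..1}" for k
    proof -
      have "((\<lambda>x::real. x ^ k) has_integral 1 ^ Suc k / (real k + 1) - (- 1) ^ Suc k / (real k + 1)) {-1..1}"
      proof (rule fundamental_theorem_of_calculus)
        fix x :: real
        have "real k + 1 \<noteq> 0" by linarith
        then show "((\<lambda>x. x ^ Suc k / (real k + 1)) has_vector_derivative x ^ k) (at x within {-1..1})"
          unfolding has_real_derivative_iff_has_vector_derivative[symmetric]
          by (auto intro!: derivative_eq_intros simp: add.commute simp del: power_Suc)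
      qed simp
      then show ?thesis by (simp add: diff_divide_distrib add_divide_distrib)
    qed
    then have "(p has_integral (\<Sum>i\<le>n. a i * ((1 + (- 1) ^ i) / (real i + 1)))) {-1..1}"
      unfolding p by (intro has_integral_sum has_integral_mult_right) auto
    ultimately show ?thesis
      by (simp add: integral_unique sum_divide_distrib mult.commute)
  qed
  have "\<bar>(\<integral>w. \<phi> (w \<bullet> e) \<partial>sphere_measure) - integral {-1..1} \<phi> / 2\<bar> \<le> 0"
  proof (rule field_le_epsilon)
    fix d :: real assume d: "d > 0"
    obtain p where p: "real_polynomial_function p" "\<And>z. z \<in> {-1..1} \<Longrightarrow> \<bar>\<phi> z - p z\<bar> < d / 2"
      using Stone_Weierstrass_real_polynomial_function[of "{-1..1}" \<phi> "d / 2"] \<phi> d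
      by (auto intro: continuous_on_subset)
    have cp: "continuous_on UNIV p" using continuous_real_polymonial_function[OF p(1)]
      by (simp add: continuous_on_eq_continuous_at)
    have "\<bar>(\<integral>w. \<phi> (w \<bullet> e) \<partial>sphere_measure) - (\<integral>w. p (w \<bullet> e) \<partial>sphere_measure)\<bar>
        = \<bar>\<integral>w. \<phi> (w \<bullet> e) - p (w \<bullet> e) \<partial>sphere_measure\<bar>"
      using zonal_integrable[OF \<phi>] zonal_integrable[OF cp] by simp
    also have "\<dots> \<le> (\<integral>w. \<bar>\<phi> (w \<bullet> e) - p (w \<bullet> e)\<bar> \<partial>sphere_measure)" by (rule integral_abs_bound)
    also have "\<dots> \<le> (\<integral>w. d / 2 \<partial>sphere_measure)"
    proof (rule integral_mono_AE)
      show "AE w in sphere_measure. \<bar>\<phi> (w \<bullet> e) - p (w \<bullet> e)\<bar> \<le> d / 2"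
        using AE_sphere_norm
      proof eventually_elim
        case (elim w)
        have "\<bar>w \<bullet> e\<bar> \<le> 1" using Cauchy_Schwarz_ineq2[of w e] e elim by simp
        then have "w \<bullet> e \<in> {-1..1}" by auto
        from p(2)[OF this] show ?case by simp
      qed
    qed (use zonal_integrable[OF \<phi>] zonal_integrable[OF cp] in auto)
    also have "\<dots> = d / 2" by (simp add: sphere.prob_space[simplified])
    finally have 1: "\<bar>(\<integral>w. \<phi> (w \<bullet> e) \<partial>sphere_measure) - (\<integral>w. p (w \<bullet> e) \<partial>sphere_measure)\<bar> \<le> d / 2" .
    have i: "\<phi> integrable_on {-1..1}" "p integrable_on {-1..1}"
      using \<phi> cp by (auto intro!: integrable_continuous_real intro: continuous_on_subset)
    have "norm (integral {-1..1} \<phi> - integral {-1..1} p) \<le> integral {-1..1} (\<lambda>z::real. d / 2)"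
      unfolding Henstock_Kurzweil_Integration.integral_diff[OF i, symmetric]
      by (rule Henstock_Kurzweil_Integration.integral_norm_bound_integral)
        (use i p(2) in \<open>auto intro!: Henstock_Kurzweil_Integration.integrable_diff less_imp_le\<close>)
    then have 2: "\<bar>integral {-1..1} \<phi> - integral {-1..1} p\<bar> \<le> d" by simp
    from 1 2 show "\<bar>(\<integral>w. \<phi> (w \<bullet> e) \<partial>sphere_measure) - integral {-1..1} \<phi> / 2\<bar> \<le> 0 + d"
      unfolding poly[OF p(1)] by linarith
  qed
  then show ?thesis by simp
qed

lemma norm_add_sphere:
  fixes x w :: "real ^ 3"
  assumes "norm w = 1"
  shows "(norm (x + s *\<^sub>R w))\<^sup>2 = (norm x)\<^sup>2 + s\<^sup>2 + 2 * s * (x \<bullet> w)"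
proof -
  have "w \<bullet> w = 1" using assms by (simp add: norm_eq_1)
  then show ?thesis
    unfolding power2_norm_eq_inner
    by (simp add: inner_add_left inner_add_right inner_commute[of w x] power2_eq_square algebra_simps)
qed

text \<open>The antipodal map turns a negative radius into a positive one, so that the estimates below
  hold for both directions of time.\<close>

lemma spherical_mean_reflect:
  fixes x :: "real ^ 3"
  assumes "continuous_on UNIV (h :: real \<Rightarrow> real)"
  shows "(\<integral>w. h (norm (x + s *\<^sub>R w)) \<partial>sphere_measure) = (\<integral>w. h (norm (x + \<bar>s\<bar> *\<^sub>R w)) \<partial>sphere_measure)"
proof (cases "s \<ge> 0")
  case False
  have "continuous_on UNIV (\<lambda>w. h (norm (x + s *\<^sub>R w)))"
    by (intro continuous_on_compose2[OF assms]) (auto intro!: continuous_intros)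
  then show ?thesis
    using sphere_integral_orthogonal[OF orthogonal_transformation_uminus borel_measurable_continuous_onI, of "\<lambda>w. h (norm (x + s *\<^sub>R w))"] False
    by simp
qed simp

text \<open>With \<open>z\<close> the cosine of the angle between \<open>w\<close> and \<open>x\<close>, and \<open>r = norm x\<close>, the distance
  \<open>l = norm (x + s w)\<close> satisfies \<open>l\<^sup>2 = r\<^sup>2 + s\<^sup>2 + 2 r s z\<close>, hence \<open>l dl = r s dz\<close>; and \<open>z\<close> is
  uniformly distributed on \<open>[-1, 1]\<close>.\<close>

lemma spherical_mean_radial:
  fixes x :: "real ^ 3"
  assumes x: "x \<noteq> 0" and s: "s > 0" and h: "continuous_on UNIV (h :: real \<Rightarrow> real)"
  shows "s * (\<integral>w. h (norm (x + s *\<^sub>R w)) \<partial>sphere_measure) =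
    integral {\<bar>norm x - s\<bar>..norm x + s} (\<lambda>l. l * h l) / (2 * norm x)"
proof -
  define r where "r = norm x"
  have r: "r > 0" using x by (simp add: r_def)
  define e where "e = x /\<^sub>R r"
  have e: "norm e = 1" using r by (simp add: e_def r_def)
  define \<phi> where "\<phi> z = h (sqrt (r\<^sup>2 + s\<^sup>2 + 2 * r * s * z))" for z
  have \<phi>: "continuous_on UNIV \<phi>" unfolding \<phi>_def
    by (intro continuous_on_compose2[OF h]) (auto intro!: continuous_intros)
  have "(\<integral>w. h (norm (x + s *\<^sub>R w)) \<partial>sphere_measure) = (\<integral>w. \<phi> (w \<bullet> e) \<partial>sphere_measure)"
  proof (rule integral_cong_AE)
    show "(\<lambda>w. h (norm (x + s *\<^sub>R w))) \<in> borel_measurable sphere_measure"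
      by (rule borel_measurable_integrable[OF sphere_integrable_continuous])
        (intro continuous_on_compose2[OF h], auto intro!: continuous_intros)
    show "AE w in sphere_measure. h (norm (x + s *\<^sub>R w)) = \<phi> (w \<bullet> e)"
      using AE_sphere_norm
    proof eventually_elim
      case (elim w)
      have "r\<^sup>2 + s\<^sup>2 + 2 * r * s * (w \<bullet> e) = (norm (x + s *\<^sub>R w))\<^sup>2"
        unfolding norm_add_sphere[OF elim] using r by (simp add: e_def r_def inner_commute)
      then show ?case by (simp add: \<phi>_def)
    qed
  qed (rule borel_measurable_integrable[OF zonal_integrable[OF \<phi>]])
  also have "\<dots> = integral {-1..1} \<phi> / 2" by (rule Archimedes_zonal[OF e \<phi>])
  finally have 1: "(\<integral>w. h (norm (x + s *\<^sub>R w)) \<partial>sphere_measure) = integral {-1..1} \<phi> / 2" .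
  define g where "g l = (l\<^sup>2 - r\<^sup>2 - s\<^sup>2) / (2 * r * s)" for l
  have ends: "g \<bar>r - s\<bar> = -1" "g (r + s) = 1"
    using r s by (auto simp: g_def field_simps power2_eq_square)
  have "((\<lambda>l. (l / (r * s)) *\<^sub>R \<phi> (g l)) has_integral integral {g \<bar>r - s\<bar>..g (r + s)} \<phi>) {\<bar>r - s\<bar>..r + s}"
  proof (rule has_integral_substitution[where c = "-1" and d = 1])
    show "\<bar>r - s\<bar> \<le> r + s" "g \<bar>r - s\<bar> \<le> g (r + s)" using r s ends by auto
    show "g ` {\<bar>r - s\<bar>..r + s} \<subseteq> {-1..1}"
    proof safe
      fix l assume l: "l \<in> {\<bar>r - s\<bar>..r + s}"
      have "(r - s)\<^sup>2 \<le> l\<^sup>2" "l\<^sup>2 \<le> (r + s)\<^sup>2"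
        using l r s by (auto intro!: power_mono simp: abs_le_square_iff[symmetric])
      then show "g l \<in> {-1..1}"
        using r s by (auto simp: g_def field_simps power2_eq_square)
    qed
    show "(g has_real_derivative l / (r * s)) (at l within {\<bar>r - s\<bar>..r + s})" for l
      unfolding g_def using r s by (auto intro!: derivative_eq_intros simp: field_simps)
  qed (use \<phi> in \<open>auto intro: continuous_on_subset\<close>)
  moreover have "(l / (r * s)) *\<^sub>R \<phi> (g l) = (l * h l) / (r * s)" if "l \<in> {\<bar>r - s\<bar>..r + s}" for l
  proof -
    have "r\<^sup>2 + s\<^sup>2 + 2 * r * s * g l = l\<^sup>2" using r s by (simp add: g_def)
    moreover have "l \<ge> 0" using that by auto
    ultimately show ?thesis by (simp add: \<phi>_def)
  qed
  ultimately have "((\<lambda>l. (l * h l) / (r * s)) has_integral integral {-1..1} \<phi>) {\<bar>r - s\<bar>..r + s}"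
    unfolding ends by (rule has_integral_eq[rotated])
  then have "integral {-1..1} \<phi> = integral {\<bar>r - s\<bar>..r + s} (\<lambda>l. l * h l / (r * s))"
    by (rule integral_unique[symmetric])
  also have "\<dots> = integral {\<bar>r - s\<bar>..r + s} (\<lambda>l. l * h l) / (r * s)" by simp
  finally show ?thesis using 1 r s by (simp add: r_def[symmetric] field_simps)
qed

text \<open>For this majorant of compactly supported data the radial integral is elementary. The result
  decays away from the light cone as well as along it, and so serves as a quantitative form of
  Huygens' principle.\<close>

lemma spherical_mean_decay:
  fixes x :: "real ^ 3"
  shows "(\<integral>w. 1 / (1 + (norm (x + s *\<^sub>R w))\<^sup>2)\<^sup>2 \<partial>sphere_measure) =
    1 / ((1 + (\<bar>s\<bar> - norm x)\<^sup>2) * (1 + (\<bar>s\<bar> + norm x)\<^sup>2))"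
proof -
  define h :: "real \<Rightarrow> real" where "h l = 1 / (1 + l\<^sup>2)\<^sup>2" for l
  have nz: "1 + l\<^sup>2 \<noteq> 0" for l :: real by (metis add_pos_nonneg less_irrefl zero_le_power2 zero_less_one)
  have h: "continuous_on UNIV h" unfolding h_def using nz by (auto intro!: continuous_intros)
  have "(\<integral>w. h (norm (x + \<bar>s\<bar> *\<^sub>R w)) \<partial>sphere_measure) = 1 / ((1 + (\<bar>s\<bar> - norm x)\<^sup>2) * (1 + (\<bar>s\<bar> + norm x)\<^sup>2))"
  proof (cases "x = 0 \<or> s = 0")
    case True
    have "(\<integral>w. h (norm (x + \<bar>s\<bar> *\<^sub>R w)) \<partial>sphere_measure) = (\<integral>w. 1 / ((1 + (\<bar>s\<bar> - norm x)\<^sup>2) * (1 + (\<bar>s\<bar> + norm x)\<^sup>2)) \<partial>sphere_measure)"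
    proof (rule integral_cong_AE)
      show "(\<lambda>w. h (norm (x + \<bar>s\<bar> *\<^sub>R w))) \<in> borel_measurable sphere_measure"
        by (rule borel_measurable_integrable[OF sphere_integrable_continuous])
          (intro continuous_on_compose2[OF h], auto intro!: continuous_intros)
      show "AE w in sphere_measure. h (norm (x + \<bar>s\<bar> *\<^sub>R w)) = 1 / ((1 + (\<bar>s\<bar> - norm x)\<^sup>2) * (1 + (\<bar>s\<bar> + norm x)\<^sup>2))"
        using AE_sphere_norm by eventually_elim (use True in \<open>auto simp: h_def power2_eq_square\<close>)
    qed auto
    then show ?thesis by (simp add: sphere.prob_space[simplified])
  next
    case False
    let ?r = "norm x" and ?s = "\<bar>s\<bar>"
    have rs: "?r > 0" "?s > 0" using False by auto
    have "((\<lambda>l. l * h l) has_integral (- 1 / (2 * (1 + (?r + ?s)\<^sup>2))) - (- 1 / (2 * (1 + \<bar>?r - ?s\<bar>\<^sup>2)))) {\<bar>?r - ?s\<bar>..?r + ?s}"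
    proof (rule fundamental_theorem_of_calculus)
      show "((\<lambda>l. - 1 / (2 * (1 + l\<^sup>2))) has_vector_derivative l * h l) (at l within {\<bar>?r - ?s\<bar>..?r + ?s})" for l
      proof -
        have "((\<lambda>l. - 1 / (2 * (1 + l\<^sup>2))) has_real_derivative 4 * l / (2 * (1 + l\<^sup>2))\<^sup>2) (at l within {\<bar>?r - ?s\<bar>..?r + ?s})"
          using nz[of l] by (auto intro!: derivative_eq_intros simp: power2_eq_square)
        moreover have "4 * l / (2 * (1 + l\<^sup>2))\<^sup>2 = l * h l"
          unfolding power_mult_distrib h_def by simp
        ultimately show ?thesis by (simp add: has_real_derivative_iff_has_vector_derivative)
      qed
    qed (use rs in linarith)
    then have I: "integral {\<bar>?r - ?s\<bar>..?r + ?s} (\<lambda>l. l * h l) = 1 / (2 * (1 + (?r - ?s)\<^sup>2)) - 1 / (2 * (1 + (?r + ?s)\<^sup>2))"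
      by (simp add: integral_unique)
    have c: "1 / (2 * (1 + (?r - ?s)\<^sup>2)) - 1 / (2 * (1 + (?r + ?s)\<^sup>2)) = 2 * ?r * ?s / ((1 + (?s - ?r)\<^sup>2) * (1 + (?s + ?r)\<^sup>2))"
      using nz[of "?r - ?s"] nz[of "?r + ?s"] nz[of "?s - ?r"] nz[of "?s + ?r"]
      by (simp add: divide_simps) (simp add: power2_eq_square algebra_simps)
    have "?s * (\<integral>w. h (norm (x + ?s *\<^sub>R w)) \<partial>sphere_measure) = ?s * (1 / ((1 + (?s - ?r)\<^sup>2) * (1 + (?s + ?r)\<^sup>2)))"
      unfolding spherical_mean_radial[OF _ rs(2) h, of x, simplified, OF conjunct1[OF False[unfolded de_Morgan_disj]]] I c
      using rs by simp
    then show ?thesis using rs by (simp only: mult_left_cancel[OF less_imp_neq[OF rs(2), symmetric]])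
  qed
  then show ?thesis using spherical_mean_reflect[OF h, of x s] by (simp add: h_def)
qed

section \<open>The free wave\<close>

type_synonym spacetime = "real \<times> (real ^ 3)"

interpretation kirchhoff: linear_superposition sphere_measure "\<lambda>w z. snd z + fst z *\<^sub>R w :: real ^ 3" 2
proof (intro linear_superposition.intro linear_superposition_axioms.intro)
  show "finite_measure sphere_measure" by (rule sphere.finite_measure_axioms)
  show "linear (\<lambda>z. snd z + fst z *\<^sub>R w)" for w :: "real ^ 3"
    by (intro linearI) (auto simp: algebra_simps)
  have "(\<lambda>w. snd z + fst z *\<^sub>R w) \<in> borel_measurable borel" for z :: "spacetime"
    by (intro borel_measurable_continuous_onI continuous_intros)
  then show "(\<lambda>w. snd z + fst z *\<^sub>R w) \<in> borel_measurable sphere_measure" for z :: "spacetime"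
    by (simp cong: measurable_cong_sets)
  show "AE w in sphere_measure. \<forall>z. norm (snd z + fst z *\<^sub>R w) \<le> 2 * norm z"
    using AE_sphere_norm
  proof eventually_elim
    case (elim w)
    show ?case
    proof
      fix z :: "spacetime"
      show "norm (snd z + fst z *\<^sub>R w) \<le> 2 * norm z"
        using norm_triangle_ineq[of "snd z" "fst z *\<^sub>R w"] elim norm_fst_le[of "fst z" "snd z"] norm_snd_le[of "snd z" "fst z"]
        by simp
    qed
  qed
qed

definition spherical_mean :: "(real ^ 3 \<Rightarrow> real) \<Rightarrow> spacetime \<Rightarrow> real"
  where "spherical_mean = kirchhoff.superpose (\<lambda>_. 1)"

lemma Ck_spherical_mean: "Ck k h \<Longrightarrow> Ck k (spherical_mean h)"
  unfolding spherical_mean_def by (intro kirchhoff.Ck_superpose kirchhoff.weight_const)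

definition wave_op :: "(spacetime \<Rightarrow> real) \<Rightarrow> spacetime \<Rightarrow> real"
  where "wave_op u z = time_deriv (time_deriv u) z - space_laplacian u z"

lemma fst_deriv: "dir_deriv v fst z = fst v"
  by (rule dir_deriv_eq) (auto intro!: derivative_eq_intros)

lemma Ck_fst: "Ck k (fst :: real \<times> 'a::euclidean_space \<Rightarrow> real)"
  by (rule Ck_linear) (auto intro: linearI)

lemma dir_deriv_time_mult:
  fixes m :: "real \<times> 'a::euclidean_space \<Rightarrow> real"
  assumes "m differentiable (at z)"
  shows "dir_deriv v (\<lambda>z. fst z * m z) z = fst z * dir_deriv v m z + fst v * m z"
proof -
  have "(fst :: real \<times> 'a \<Rightarrow> real) differentiable (at z)"
    by (rule Ck_differentiable[OF Ck_fst])
  from dir_deriv_mult[OF this assms] show ?thesis by (simp add: fst_deriv)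
qed

lemma second_deriv_time_mult:
  fixes m :: "real \<times> 'a::euclidean_space \<Rightarrow> real"
  assumes m: "Ck 2 m"
  shows "dir_deriv u (dir_deriv v (\<lambda>z. fst z * m z)) z =
    fst z * dir_deriv u (dir_deriv v m) z + fst u * dir_deriv v m z + fst v * dir_deriv u m z"
proof -
  have d: "m differentiable (at z)" "dir_deriv v m differentiable (at z)" for v z
    by (rule Ck2_differentiable[OF m])+
  have 1: "dir_deriv v (\<lambda>z. fst z * m z) = (\<lambda>z. fst z * dir_deriv v m z + fst v * m z)"
    by (rule ext) (rule dir_deriv_time_mult[OF d(1)])
  have "Ck (Suc 0) (\<lambda>z. fst z * dir_deriv v m z)"
    using m by (intro Ck_mult Ck_fst Ck_dir_deriv) (simp only: numeral_2_eq_2)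
  then have "(\<lambda>z. fst z * dir_deriv v m z) differentiable (at z)" by (rule Ck_differentiable)
  moreover have "(\<lambda>z. fst v * m z) differentiable (at z)" using d(1) by (intro differentiable_mult) auto
  ultimately show ?thesis
    unfolding 1 by (simp add: dir_deriv_add dir_deriv_time_mult[OF d(2)] dir_deriv_cmult[OF d(1)])
qed

text \<open>Multiplied by the radius, the Darboux equation is the wave equation.\<close>

lemma wave_op_time_mean:
  assumes g: "Ck 2 g"
  shows "wave_op (\<lambda>z. fst z * spherical_mean g z) z = 0"
proof -
  obtain t x where z: "z = (t, x)" by (cases z)
  let ?m = "spherical_mean g"
  have g1: "Ck (Suc 0) g" using g Ck_le[of 2 g "Suc 0"] by simp
  note w1 = kirchhoff.weight_const[of 1]
  have m: "Ck 2 ?m" by (rule Ck_spherical_mean[OF g])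
  note s = second_deriv_time_mult[OF m]
  have T: "dir_deriv (1, 0) ?m z = (\<integral>w. dir_deriv w g (x + t *\<^sub>R w) \<partial>sphere_measure)"
    "integrable sphere_measure (\<lambda>w. dir_deriv w g (x + t *\<^sub>R w))"
    unfolding spherical_mean_def
    using kirchhoff.dir_deriv_superpose_integral[OF w1 g1, of "(1, 0)" z] kirchhoff.integrable_dir_deriv[OF w1 g1, of "(1, 0)" z]
    by (simp_all add: z)
  have TT: "dir_deriv (1, 0) (dir_deriv (1, 0) ?m) z = (\<integral>w. dir_deriv w (dir_deriv w g) (x + t *\<^sub>R w) \<partial>sphere_measure)"
    "integrable sphere_measure (\<lambda>w. dir_deriv w (dir_deriv w g) (x + t *\<^sub>R w))"
    unfolding spherical_mean_def
    using kirchhoff.second_deriv_superpose[OF w1 g, of "(1, 0)" "(1, 0)" z] by (simp_all add: z)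
  have XX: "dir_deriv (0, axis i 1) (dir_deriv (0, axis i 1) ?m) z =
      (\<integral>w. dir_deriv (axis i 1) (dir_deriv (axis i 1) g) (x + t *\<^sub>R w) \<partial>sphere_measure)"
    "integrable sphere_measure (\<lambda>w. dir_deriv (axis i 1) (dir_deriv (axis i 1) g) (x + t *\<^sub>R w))" for i
    unfolding spherical_mean_def
    using kirchhoff.second_deriv_superpose[OF w1 g, of "(0, axis i 1)" "(0, axis i 1)" z] by (simp_all add: z)
  have "0 = t * (\<Sum>i\<in>UNIV. dir_deriv (0, axis i 1) (dir_deriv (0, axis i 1) ?m) z)
      - t * dir_deriv (1, 0) (dir_deriv (1, 0) ?m) z - 2 * dir_deriv (1, 0) ?m z"
    using Darboux[OF g, of t x] T TT XX by simp
  then show ?thesis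
    unfolding wave_op_def time_deriv_def space_laplacian_def s
    by (simp add: z sum_distrib_left)
qed

text \<open>Time differentiation commutes with the wave operator. It converts the solution with a given
  initial velocity into one with that initial position, at the cost of one derivative of the data.\<close>

lemma wave_op_time_deriv:
  assumes v: "Ck 3 v" and 0: "\<And>z. wave_op v z = 0"
  shows "wave_op (time_deriv v) z = 0"
proof -
  let ?T = "(1, 0) :: spacetime" and ?e = "\<lambda>i. (0, axis i 1) :: spacetime"
  have v3: "Ck (Suc (Suc (Suc 0))) v" using v by (simp add: numeral_3_eq_3)
  have v2: "Ck 2 v" "Ck 2 (dir_deriv a v)" for a
    using v3 Ck_SucD[OF v3] Ck_dir_deriv[OF v3] by (simp_all only: numeral_2_eq_2)
  have d: "dir_deriv a (dir_deriv b v) differentiable (at y)" for a b y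
    by (rule Ck_differentiable[OF Ck_dir_deriv[OF Ck_dir_deriv[OF v3]]])
  have c: "dir_deriv (?e i) (dir_deriv (?e i) (dir_deriv ?T v)) z = dir_deriv ?T (dir_deriv (?e i) (dir_deriv (?e i) v)) z" for i
  proof -
    have "dir_deriv (?e i) (dir_deriv ?T v) = dir_deriv ?T (dir_deriv (?e i) v)"
      by (rule ext) (rule dir_deriv_commute[OF v2(1)])
    then show ?thesis by (simp only:) (rule dir_deriv_commute[OF v2(2)])
  qed
  have "(\<lambda>y. dir_deriv ?T (dir_deriv ?T v) y) = (\<lambda>y. \<Sum>i\<in>UNIV. dir_deriv (?e i) (dir_deriv (?e i) v) y)"
    using 0 by (auto simp: wave_op_def time_deriv_def space_laplacian_def)
  then have "dir_deriv ?T (dir_deriv ?T (dir_deriv ?T v)) z =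
      (\<Sum>i\<in>UNIV. dir_deriv ?T (dir_deriv (?e i) (dir_deriv (?e i) v)) z)"
    by (simp add: dir_deriv_sum d)
  then show ?thesis
    unfolding wave_op_def time_deriv_def space_laplacian_def c by simp
qed

text \<open>Kirchhoff's formula.\<close>

definition free_wave :: "(real ^ 3 \<Rightarrow> real) \<Rightarrow> (real ^ 3 \<Rightarrow> real) \<Rightarrow> spacetime \<Rightarrow> real"
  where "free_wave f g z = time_deriv (\<lambda>z. fst z * spherical_mean f z) z + fst z * spherical_mean g z"

lemma wave_op_add:
  assumes u: "Ck 2 u" and v: "Ck 2 v"
  shows "wave_op (\<lambda>z. u z + v z) z = wave_op u z + wave_op v z"
proof -
  have d: "u differentiable (at z)" "v differentiable (at z)"
    "dir_deriv a u differentiable (at z)" "dir_deriv a v differentiable (at z)" for a z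
    by (rule Ck2_differentiable[OF u] Ck2_differentiable[OF v])+
  have 1: "dir_deriv a (\<lambda>z. u z + v z) = (\<lambda>z. dir_deriv a u z + dir_deriv a v z)" for a
    by (rule ext) (simp add: dir_deriv_add d)
  show ?thesis
    unfolding wave_op_def time_deriv_def space_laplacian_def 1
    by (simp add: dir_deriv_add d sum.distrib)
qed

lemma wave_op_cmult:
  assumes u: "Ck 2 u"
  shows "wave_op (\<lambda>z. c * u z) z = c * wave_op u z"
proof -
  have d: "u differentiable (at z)" "dir_deriv a u differentiable (at z)" for a z
    by (rule Ck2_differentiable[OF u])+
  have 1: "dir_deriv a (\<lambda>z. c * u z) = (\<lambda>z. c * dir_deriv a u z)" for a
    by (rule ext) (simp add: dir_deriv_cmult d)
  show ?thesis
    unfolding wave_op_def time_deriv_def space_laplacian_def 1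
    by (simp add: dir_deriv_cmult d sum_distrib_left algebra_simps)
qed

lemma spherical_mean_0: "spherical_mean h (0, x) = h x"
  by (simp add: spherical_mean_def kirchhoff.superpose_def sphere.prob_space[simplified])

lemma free_wave_solution:
  assumes f: "Ck 3 f" and g: "Ck 2 g"
  shows "Ck 2 (free_wave f g)" and "wave_op (free_wave f g) z = 0"
    and "free_wave f g (0, x) = f x" and "time_deriv (free_wave f g) (0, x) = g x"
proof -
  let ?v = "\<lambda>z. fst z * spherical_mean f z" and ?w = "\<lambda>z. fst z * spherical_mean g z"
  have f2: "Ck 2 f" using Ck_le[OF f] by simp
  have v3: "Ck 3 ?v" by (intro Ck_mult Ck_fst Ck_spherical_mean f)
  then have v: "Ck 2 (time_deriv ?v)" unfolding time_deriv_def by (intro Ck_dir_deriv) (simp add: numeral_3_eq_3 numeral_2_eq_2)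
  have w: "Ck 2 ?w" by (intro Ck_mult Ck_fst Ck_spherical_mean g)
  have eq: "free_wave f g = (\<lambda>z. time_deriv ?v z + ?w z)" by (rule ext) (simp add: free_wave_def)
  show "Ck 2 (free_wave f g)" unfolding eq by (rule Ck_add[OF v w])
  have v0: "wave_op ?v z = 0" for z by (rule wave_op_time_mean[OF f2])
  show "wave_op (free_wave f g) z = 0"
    unfolding eq wave_op_add[OF v w] by (simp add: wave_op_time_deriv[OF v3 v0] wave_op_time_mean[OF g])
  have d: "spherical_mean h differentiable (at z)" if "Ck 2 h" for h z
    by (rule Ck2_differentiable[OF Ck_spherical_mean[OF that]])
  show "free_wave f g (0, x) = f x"
    unfolding free_wave_def time_deriv_def by (simp add: dir_deriv_time_mult[OF d[OF f2]] spherical_mean_0)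
  have "time_deriv (time_deriv ?v) (0, x) = 0"
    using v0[of "(0, x)"] unfolding wave_op_def space_laplacian_def
    by (simp add: second_deriv_time_mult[OF Ck_spherical_mean[OF f2]])
  moreover have "time_deriv (free_wave f g) (0, x) = time_deriv (time_deriv ?v) (0, x) + dir_deriv (1, 0) ?w (0, x)"
    unfolding eq time_deriv_def[of "\<lambda>z. time_deriv ?v z + ?w z"] time_deriv_def[of "time_deriv ?v"]
    by (rule dir_deriv_add) (rule Ck2_differentiable[OF v] Ck2_differentiable[OF w])+
  ultimately show "time_deriv (free_wave f g) (0, x) = g x"
    by (simp add: dir_deriv_time_mult[OF d[OF g]] spherical_mean_0)
qed

lemma compact_support_bound:
  fixes h :: "'a::euclidean_space \<Rightarrow> real"
  assumes "continuous_on UNIV h" and supp: "\<And>y. y \<notin> K \<Longrightarrow> h y = 0" and K: "compact K"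
  obtains M where "M \<ge> 0" "\<And>y. \<bar>h y\<bar> \<le> M * (1 / (1 + (norm y)\<^sup>2)\<^sup>2)"
proof -
  define k where "k y = h y * (1 + (norm y)\<^sup>2)\<^sup>2" for y
  have "continuous_on K k" unfolding k_def
    by (intro continuous_intros continuous_on_subset[OF assms(1)]) auto
  then have "compact (k ` K)" using K by (rule compact_continuous_image)
  then obtain B where B: "\<forall>y\<in>K. \<bar>k y\<bar> \<le> B"
    using compact_imp_bounded[of "k ` K"] by (auto simp: bounded_iff)
  have pos: "(1 + (norm y)\<^sup>2)\<^sup>2 > 0" for y :: 'a
    by (meson add_pos_nonneg zero_le_power2 zero_less_one zero_less_power)
  have "\<bar>h y\<bar> \<le> \<bar>B\<bar> * (1 / (1 + (norm y)\<^sup>2)\<^sup>2)" for y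
  proof (cases "y \<in> K")
    case True
    then have "\<bar>h y\<bar> * (1 + (norm y)\<^sup>2)\<^sup>2 \<le> \<bar>B\<bar>" using B pos[of y] by (fastforce simp: k_def abs_mult)
    then show ?thesis using pos[of y] by (simp add: field_simps)
  qed (use supp pos[of y] in auto)
  then show ?thesis by (intro that[of "\<bar>B\<bar>"]) auto
qed

lemma superpose_decay:
  assumes a: "kirchhoff.weight a" "AE w in sphere_measure. \<bar>a w\<bar> \<le> 1" and h: "continuous_on UNIV h"
    and M: "M \<ge> 0" "\<And>y. \<bar>h y\<bar> \<le> M * (1 / (1 + (norm y)\<^sup>2)\<^sup>2)"
  shows "\<bar>kirchhoff.superpose a h (t, x)\<bar> \<le> M / ((1 + (\<bar>t\<bar> - norm x)\<^sup>2) * (1 + (\<bar>t\<bar> + norm x)\<^sup>2))"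
proof -
  have int: "integrable sphere_measure (\<lambda>w. a w * h (x + t *\<^sub>R w))"
    using kirchhoff.superpose_integrable[OF a(1) h, of "(t, x)"] by simp
  have nz: "1 + (norm y)\<^sup>2 \<noteq> 0" for y :: "real ^ 3"
    by (metis add_pos_nonneg less_irrefl zero_le_power2 zero_less_one)
  have int2: "integrable sphere_measure (\<lambda>w. M * (1 / (1 + (norm (x + t *\<^sub>R w))\<^sup>2)\<^sup>2))"
    by (intro sphere_integrable_continuous continuous_intros) (use nz in auto)
  have "\<bar>kirchhoff.superpose a h (t, x)\<bar> \<le> (\<integral>w. \<bar>a w * h (x + t *\<^sub>R w)\<bar> \<partial>sphere_measure)"
    unfolding kirchhoff.superpose_def by simp
  also have "\<dots> \<le> (\<integral>w. M * (1 / (1 + (norm (x + t *\<^sub>R w))\<^sup>2)\<^sup>2) \<partial>sphere_measure)"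
  proof (rule integral_mono_AE)
    show "AE w in sphere_measure. \<bar>a w * h (x + t *\<^sub>R w)\<bar> \<le> M * (1 / (1 + (norm (x + t *\<^sub>R w))\<^sup>2)\<^sup>2)"
      using a(2)
    proof eventually_elim
      case (elim w)
      have "\<bar>a w * h (x + t *\<^sub>R w)\<bar> \<le> 1 * \<bar>h (x + t *\<^sub>R w)\<bar>"
        unfolding abs_mult using elim by (intro mult_right_mono) auto
      then show ?case using M(2)[of "x + t *\<^sub>R w"] by linarith
    qed
  qed (use int int2 in auto)
  also have "\<dots> = M / ((1 + (\<bar>t\<bar> - norm x)\<^sup>2) * (1 + (\<bar>t\<bar> + norm x)\<^sup>2))"
    by (subst integral_mult_right_zero) (simp only: spherical_mean_decay, simp)
  finally show ?thesis .
qed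

lemma kirchhoff_weight_component:
  assumes "b \<in> Basis"
  shows "kirchhoff.weight (\<lambda>w. w \<bullet> b)" "AE w in sphere_measure. \<bar>w \<bullet> b\<bar> \<le> 1"
proof -
  show "AE w in sphere_measure. \<bar>w \<bullet> b\<bar> \<le> 1"
    using AE_sphere_norm by eventually_elim (metis Basis_le_norm assms)
  then show "kirchhoff.weight (\<lambda>w. w \<bullet> b)" unfolding kirchhoff.weight_def by auto
qed

lemma dir_deriv_outside_support:
  assumes "\<And>y. y \<notin> K \<Longrightarrow> h y = 0" and "closed K" and "y \<notin> K"
  shows "dir_deriv v h y = 0"
proof -
  have "((\<lambda>y. 0 :: real) has_derivative (\<lambda>v. 0)) (at y)" by simp
  then have "(h has_derivative (\<lambda>v. 0)) (at y)"
    by (rule has_derivative_transform_within_open[of _ _ _ _ "- K"]) (use assms in auto)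
  from dir_deriv_eq[OF this] show ?thesis .
qed

text \<open>The data and the first derivatives of \<open>f\<close> have compact support, so a multiple of the explicit
  majorant dominates them. Its spherical mean decays like \<open>(\<bar>t\<bar> + norm x)\<^sup>-\<^sup>2\<close> along the light cone,
  and the factor \<open>t\<close> in Kirchhoff's formula costs one power.\<close>

lemma free_wave_decay:
  assumes f: "Ck_c 3 f" and g: "Ck_c 2 g"
  obtains M where "M \<ge> 0"
    "\<And>t x. \<bar>free_wave f g (t, x)\<bar> \<le> M / ((1 + (\<bar>t\<bar> - norm x)\<^sup>2) * (1 + \<bar>t\<bar> + norm x))"
proof -
  define K where "K h = closure {x. h x \<noteq> 0}" for h :: "real ^ 3 \<Rightarrow> real"
  have K: "compact (K f)" "compact (K g)" using f g by (auto simp: Ck_c_def K_def)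
  have out: "h y = 0" if "y \<notin> K h" for h y
    using that closure_subset[of "{x. h x \<noteq> 0}"] by (auto simp: K_def)
  have f3: "Ck 3 f" and g2: "Ck 2 g" using f g by (auto simp: Ck_c_def)
  have f1: "Ck (Suc 0) f" and f2: "Ck 2 f" by (rule Ck_le[OF f3], simp)+
  have cont: "continuous_on UNIV f" "continuous_on UNIV g" "continuous_on UNIV (dir_deriv b f)" for b
    using Ck_continuous[OF f3] Ck_continuous[OF g2] Ck_continuous[OF Ck_dir_deriv[OF f1]] by auto
  obtain M1 where M1: "M1 \<ge> 0" "\<And>y. \<bar>f y\<bar> \<le> M1 * (1 / (1 + (norm y)\<^sup>2)\<^sup>2)"
    using compact_support_bound[OF cont(1) out[where h = f] K(1)] by blast
  obtain M2 where M2: "M2 \<ge> 0" "\<And>y. \<bar>g y\<bar> \<le> M2 * (1 / (1 + (norm y)\<^sup>2)\<^sup>2)"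
    using compact_support_bound[OF cont(2) out[where h = g] K(2)] by blast
  have "\<exists>M\<ge>0. \<forall>y. \<bar>dir_deriv b f y\<bar> \<le> M * (1 / (1 + (norm y)\<^sup>2)\<^sup>2)" for b
    using compact_support_bound[OF cont(3) dir_deriv_outside_support[OF out[where h = f] compact_imp_closed[OF K(1)]] K(1)] by metis
  then obtain M3 where M3: "\<And>b. M3 b \<ge> 0" "\<And>b y. \<bar>dir_deriv b f y\<bar> \<le> M3 b * (1 / (1 + (norm y)\<^sup>2)\<^sup>2)"
    by metis
  define M where "M = 2 * (M1 + M2 + (\<Sum>b\<in>Basis. M3 b))"
  have M: "M \<ge> 0" using M1 M2 M3 by (auto simp: M_def intro!: add_nonneg_nonneg sum_nonneg)
  have "\<bar>free_wave f g (t, x)\<bar> \<le> M / ((1 + (\<bar>t\<bar> - norm x)\<^sup>2) * (1 + \<bar>t\<bar> + norm x))" for t x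
  proof -
    let ?\<alpha> = "\<bar>t\<bar> + norm x" and ?q = "1 + (\<bar>t\<bar> - norm x)\<^sup>2"
    have pos: "?q > 0" "1 + ?\<alpha>\<^sup>2 > 0" "1 + ?\<alpha> > 0" by (auto simp: add_pos_nonneg)
    let ?D = "1 / (?q * (1 + ?\<alpha>\<^sup>2))" and ?E = "1 / (?q * (1 + ?\<alpha>))"
    have D0: "?D \<ge> 0" using pos by simp
    have sq: "2 * ?\<alpha> \<le> ?\<alpha>\<^sup>2 + 1" using zero_le_power2[of "?\<alpha> - 1"] by (simp add: power2_eq_square algebra_simps)
    have "a \<le> 1 + 2 * a\<^sup>2" for a :: real
    proof -
      have "2 * a \<le> a\<^sup>2 + 1" using zero_le_power2[of "a - 1"] by (simp add: power2_diff)
      then show ?thesis using zero_le_power2[of a] by linarith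
    qed
    then have sq': "?\<alpha> \<le> 1 + 2 * ?\<alpha>\<^sup>2" .
    have "1 / (1 + ?\<alpha>\<^sup>2) \<le> 2 / (1 + ?\<alpha>)"
      using pos sq' by (simp add: divide_simps)
    then have DE: "?D \<le> 2 * ?E" using pos by (simp add: divide_simps)
    have "?\<alpha> / (1 + ?\<alpha>\<^sup>2) \<le> 2 / (1 + ?\<alpha>)"
      using pos sq by (simp add: divide_simps power2_eq_square algebra_simps)
    then have "?\<alpha> * ?D \<le> 2 * ?E" using pos by (simp add: divide_simps)
    moreover have "\<bar>t\<bar> * ?D \<le> ?\<alpha> * ?D" using D0 by (intro mult_right_mono) auto
    ultimately have tDE: "\<bar>t\<bar> * ?D \<le> 2 * ?E" by linarith
    have s1: "AE w in sphere_measure. \<bar>1 :: real\<bar> \<le> 1" by simp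
    have b1: "\<bar>spherical_mean f (t, x)\<bar> \<le> M1 * ?D" unfolding spherical_mean_def
      using superpose_decay[OF kirchhoff.weight_const s1 cont(1) M1] by simp
    have b2: "\<bar>spherical_mean g (t, x)\<bar> \<le> M2 * ?D" unfolding spherical_mean_def
      using superpose_decay[OF kirchhoff.weight_const s1 cont(2) M2] by simp
    have "dir_deriv (1, 0) (spherical_mean f) (t, x) = (\<Sum>b\<in>Basis. kirchhoff.superpose (\<lambda>w. w \<bullet> b) (dir_deriv b f) (t, x))"
      unfolding spherical_mean_def by (simp add: kirchhoff.dir_deriv_superpose[OF kirchhoff.weight_const f1])
    also have "\<bar>\<dots>\<bar> \<le> (\<Sum>b\<in>Basis. M3 b * ?D)"
    proof (intro order_trans[OF sum_abs] sum_mono)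
      fix b :: "real ^ 3" assume "b \<in> Basis"
      from superpose_decay[OF kirchhoff_weight_component[OF this] cont(3) M3(1)[of b] M3(2)[of b], of t x]
      show "\<bar>kirchhoff.superpose (\<lambda>w. w \<bullet> b) (dir_deriv b f) (t, x)\<bar> \<le> M3 b * ?D" by simp
    qed
    finally have b3: "\<bar>dir_deriv (1, 0) (spherical_mean f) (t, x)\<bar> \<le> (\<Sum>b\<in>Basis. M3 b) * ?D"
      by (simp only: sum_distrib_right)
    have "free_wave f g (t, x) = t * dir_deriv (1, 0) (spherical_mean f) (t, x) + spherical_mean f (t, x) + t * spherical_mean g (t, x)"
      unfolding free_wave_def time_deriv_def
      by (simp add: dir_deriv_time_mult[OF Ck2_differentiable(1)[OF Ck_spherical_mean[OF f2]]])
    then have "\<bar>free_wave f g (t, x)\<bar> \<le> \<bar>t\<bar> * \<bar>dir_deriv (1, 0) (spherical_mean f) (t, x)\<bar> + \<bar>spherical_mean f (t, x)\<bar> + \<bar>t\<bar> * \<bar>spherical_mean g (t, x)\<bar>"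
      by (simp add: abs_mult[symmetric])
    also have "\<dots> \<le> \<bar>t\<bar> * ((\<Sum>b\<in>Basis. M3 b) * ?D) + M1 * ?D + \<bar>t\<bar> * (M2 * ?D)"
      using b1 b2 b3 by (intro add_mono mult_left_mono) auto
    also have "\<dots> = (\<Sum>b\<in>Basis. M3 b) * (\<bar>t\<bar> * ?D) + M1 * ?D + M2 * (\<bar>t\<bar> * ?D)" by (simp add: algebra_simps)
    also have "\<dots> \<le> (\<Sum>b\<in>Basis. M3 b) * (2 * ?E) + M1 * (2 * ?E) + M2 * (2 * ?E)"
      using M1 M2 M3 DE tDE by (intro add_mono mult_left_mono) (auto intro!: sum_nonneg)
    also have "\<dots> = M * ?E"
    proof -
      have "c * (2 * E) + a * (2 * E) + b * (2 * E) = 2 * (a + b + c) * E" for a b c E :: real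
        by (simp add: algebra_simps)
      then show ?thesis unfolding M_def .
    qed
    finally show ?thesis by (simp add: add.assoc)
  qed
  with M show ?thesis by (rule that)
qed

section \<open>Duhamel's formula\<close>

definition unit_interval_measure :: "real measure"
  where "unit_interval_measure = uniform_measure lborel {0..1}"

lemma sets_unit_interval_measure [simp, measurable_cong]: "sets unit_interval_measure = sets borel"
  and space_unit_interval_measure [simp]: "space unit_interval_measure = UNIV"
  by (simp_all add: unit_interval_measure_def)

interpretation unit_interval: prob_space unit_interval_measure
  unfolding unit_interval_measure_def by (rule prob_space_uniform_measure) auto

lemma unit_interval_density: "unit_interval_measure = density lborel (\<lambda>s. ennreal (indicator {0..1} s))"
  by (simp add: unit_interval_measure_def uniform_measure_def ennreal_indicator divide_ennreal_def)

lemma AE_unit_interval: "AE s in unit_interval_measure. s \<in> {0..1}"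
  unfolding unit_interval_measure_def by (rule AE_uniform_measureI) auto

lemma unit_interval_FTC:
  fixes \<Psi> :: "real \<Rightarrow> real"
  assumes "\<And>s. (\<Psi> has_real_derivative \<psi> s) (at s)" and "continuous_on UNIV \<psi>"
  shows "(\<integral>s. \<psi> s \<partial>unit_interval_measure) = \<Psi> 1 - \<Psi> 0"
proof -
  have "(\<integral>s. \<psi> s \<partial>unit_interval_measure) = (\<integral>s. \<psi> s * indicator {0..1} s \<partial>lborel)"
    unfolding unit_interval_density
    by (subst integral_density) (use borel_measurable_continuous_onI[OF assms(2)] in \<open>auto simp: mult.commute\<close>)
  also have "\<dots> = \<Psi> 1 - \<Psi> 0"
    by (rule integral_FTC_Icc_real) (use assms in \<open>auto simp: continuous_on_eq_continuous_at\<close>)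
  finally show ?thesis .
qed

definition cone_measure :: "spacetime measure"
  where "cone_measure = unit_interval_measure \<Otimes>\<^sub>M sphere_measure"

interpretation cone_pair: pair_prob_space unit_interval_measure sphere_measure ..

interpretation cone_prob: prob_space cone_measure
  unfolding cone_measure_def by (rule cone_pair.prob_space_axioms)

lemma sets_cone_measure [simp, measurable_cong]: "sets cone_measure = sets borel"
  unfolding cone_measure_def by (simp add: borel_prod[symmetric] cong: sets_pair_measure_cong)

lemma space_cone_measure [simp]: "space cone_measure = UNIV"
  by (simp add: cone_measure_def space_pair_measure)

lemma AE_cone_measure: "AE q in cone_measure. fst q \<in> {0..1} \<and> norm (snd q) = 1"
  unfolding cone_measure_def
proof (rule cone_pair.AE_pair_measure)
  show "AE s in unit_interval_measure. AE w in sphere_measure. fst (s, w) \<in> {0..1} \<and> norm (snd (s, w)) = 1"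
    using AE_unit_interval by eventually_elim (use AE_sphere_norm in auto)
qed measurable

text \<open>The point of the backward light cone with vertex \<open>z\<close> that has the fraction \<open>fst q\<close> of the
  time of \<open>z\<close> still to run and lies in direction \<open>snd q\<close>.\<close>

definition cone_point :: "spacetime \<Rightarrow> spacetime \<Rightarrow> spacetime"
  where "cone_point q z = ((1 - fst q) * fst z, snd z + (fst q * fst z) *\<^sub>R snd q)"

interpretation cone: linear_superposition cone_measure cone_point 3
proof (intro linear_superposition.intro linear_superposition_axioms.intro)
  show "finite_measure cone_measure" by (rule cone_prob.finite_measure_axioms)
  show "linear (cone_point q)" for q
    by (intro linearI) (auto simp: cone_point_def algebra_simps)
  have "(\<lambda>q. cone_point q z) \<in> borel_measurable borel" for z
    unfolding cone_point_def by (intro borel_measurable_continuous_onI continuous_intros)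
  then show "(\<lambda>q. cone_point q z) \<in> borel_measurable cone_measure" for z
    by (simp cong: measurable_cong_sets)
  show "AE q in cone_measure. \<forall>z. norm (cone_point q z) \<le> 3 * norm z"
    using AE_cone_measure
  proof eventually_elim
    case (elim q)
    show ?case
    proof
      fix z :: "spacetime"
      have z: "\<bar>fst z\<bar> \<le> norm z" "norm (snd z) \<le> norm z"
        using norm_fst_le[of "fst z" "snd z"] norm_snd_le[of "snd z" "fst z"] by simp_all
      have a: "\<bar>(1 - fst q) * fst z\<bar> \<le> 1 * norm z" "\<bar>fst q * fst z\<bar> \<le> 1 * norm z"
        unfolding abs_mult using elim z by (intro mult_mono; auto)+
      have "norm (cone_point q z) \<le> \<bar>(1 - fst q) * fst z\<bar> + norm (snd z + (fst q * fst z) *\<^sub>R snd q)"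
        unfolding cone_point_def using norm_Pair_le[of "(1 - fst q) * fst z"] by simp
      also have "\<dots> \<le> \<bar>(1 - fst q) * fst z\<bar> + (norm (snd z) + \<bar>fst q * fst z\<bar>)"
        using norm_triangle_ineq[of "snd z" "(fst q * fst z) *\<^sub>R snd q"] elim by simp
      finally show "norm (cone_point q z) \<le> 3 * norm z" using a z by linarith
    qed
  qed
qed

lemma cone_weight_fst: "cone.weight fst"
proof -
  have "AE q in cone_measure. \<bar>fst q\<bar> \<le> 1" using AE_cone_measure by eventually_elim auto
  moreover have "(fst :: spacetime \<Rightarrow> real) \<in> borel_measurable cone_measure"
    unfolding cone_measure_def by measurable
  ultimately show ?thesis unfolding cone.weight_def by blast
qed

text \<open>Duhamel's integral over \<open>[0, t]\<close> of \<open>t - \<tau>\<close> times the mean of \<open>G \<tau>\<close> over the sphere of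
  radius \<open>t - \<tau>\<close>, after the substitution \<open>\<tau> = (1 - s) t\<close>. On the fixed interval \<open>[0, 1]\<close> the integrand
  is \<open>G\<close> composed with linear maps, so smoothness of \<open>G\<close> is inherited in all variables, and negative times
  need no separate formula.\<close>

definition duhamel :: "(spacetime \<Rightarrow> real) \<Rightarrow> spacetime \<Rightarrow> real"
  where "duhamel G z = fst z * (fst z * cone.superpose fst G z)"

lemma Ck_duhamel: "Ck k G \<Longrightarrow> Ck k (duhamel G)"
  unfolding duhamel_def[abs_def] by (intro Ck_mult Ck_fst cone.Ck_superpose cone_weight_fst)

lemma dir_deriv_curve:
  assumes g: "g differentiable (at (z + s *\<^sub>R v))"
  shows "((\<lambda>s. g (z + s *\<^sub>R v)) has_real_derivative dir_deriv v g (z + s *\<^sub>R v)) (at s)"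
proof -
  have i: "((\<lambda>s. z + s *\<^sub>R v) has_derivative (\<lambda>h. h *\<^sub>R v)) (at s)"
    by (auto intro!: derivative_eq_intros)
  have "((\<lambda>s. g (z + s *\<^sub>R v)) has_derivative (\<lambda>h. dir_deriv (h *\<^sub>R v) g (z + s *\<^sub>R v))) (at s)"
    using has_derivative_compose[OF i has_derivative_dir_deriv[OF g]] .
  then show ?thesis
    by (simp add: has_field_derivative_def linear_scale[OF linear_dir_deriv[OF g]] mult.commute[of _ "dir_deriv v g (z + s *\<^sub>R v)"])
qed

lemma dir_deriv_slice:
  fixes G :: "spacetime \<Rightarrow> real"
  assumes G: "Ck 2 G"
  shows "Ck 2 (\<lambda>x. G (t, x))" and "dir_deriv v (\<lambda>x. G (t, x)) x = dir_deriv (0, v) G (t, x)"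
    and "dir_deriv u (dir_deriv v (\<lambda>x. G (t, x))) x = dir_deriv (0, u) (dir_deriv (0, v) G) (t, x)"
proof -
  have slice: "((\<lambda>x. H (t, x)) has_derivative (\<lambda>v. dir_deriv (0, v) H (t, x))) (at x)"
    if "H differentiable (at (t, x))" for H :: "spacetime \<Rightarrow> real" and x
  proof -
    have i: "((\<lambda>x. (t, x)) has_derivative (\<lambda>v. (0, v))) (at x)" by (auto intro!: derivative_eq_intros)
    show ?thesis using has_derivative_compose[OF i has_derivative_dir_deriv[OF that]] .
  qed
  have d1: "dir_deriv v (\<lambda>x. G (t, x)) = (\<lambda>x. dir_deriv (0, v) G (t, x))" for v
    by (rule ext, rule dir_deriv_eq, rule slice, rule Ck2_differentiable[OF G])
  then show "dir_deriv v (\<lambda>x. G (t, x)) x = dir_deriv (0, v) G (t, x)" by simp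
  have d2: "dir_deriv u (\<lambda>x. dir_deriv (0, v) G (t, x)) = (\<lambda>x. dir_deriv (0, u) (dir_deriv (0, v) G) (t, x))" for u v
    by (rule ext, rule dir_deriv_eq, rule slice, rule Ck2_differentiable[OF G])
  then show "dir_deriv u (dir_deriv v (\<lambda>x. G (t, x))) x = dir_deriv (0, u) (dir_deriv (0, v) G) (t, x)"
    by (simp add: d1)
  have "Ck (Suc (Suc 0)) G" using G by (simp add: numeral_2_eq_2)
  then have c: "continuous_on UNIV (dir_deriv (0, u) (dir_deriv (0, v) G))" for u v
    by (meson Ck_continuous Ck_dir_deriv)
  have "Ck (Suc (Suc 0)) (\<lambda>x. G (t, x))"
  proof (rule Ck_SucI, rule slice, rule Ck2_differentiable[OF G], rule Ck_SucI, rule slice, rule Ck2_differentiable[OF G])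
    show "Ck 0 (\<lambda>x. dir_deriv (0, u) (dir_deriv (0, v) G) (t, x))" for u v
      by (auto intro!: continuous_on_compose2[OF c] continuous_intros)
  qed
  then show "Ck 2 (\<lambda>x. G (t, x))" by (simp add: numeral_2_eq_2)
qed

text \<open>The terms of \<open>wave_op (duhamel G)\<close> that the Darboux equation does not remove are the derivative
  of one function along the generator of the light cone, which vanishes at the base of the cone and
  equals \<open>- G\<close> at its vertex.\<close>

lemma wave_op_duhamel:
  assumes G: "Ck 2 G"
  shows "wave_op (duhamel G) z = G z"
proof -
  obtain t x where z: "z = (t, x)" by (cases z)
  let ?T = "(1, 0) :: spacetime"
  have G2: "Ck (Suc (Suc 0)) G" using G by (simp add: numeral_2_eq_2)
  have G1: "Ck (Suc 0) G" by (rule Ck_SucD[OF G2])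
  have cG: "continuous_on UNIV G" by (rule Ck_continuous[OF G])
  have d: "G differentiable (at y)" "dir_deriv v G differentiable (at y)" for v y
    by (rule Ck2_differentiable[OF G])+
  let ?\<Phi> = "cone.superpose fst G"
  have \<Phi>: "Ck 2 ?\<Phi>" by (rule cone.Ck_superpose[OF cone_weight_fst G])
  have t\<Phi>: "Ck 2 (\<lambda>z. fst z * ?\<Phi> z)" by (intro Ck_mult Ck_fst \<Phi>)
  let ?p = "\<lambda>q. cone_point q z"
  define D where "D q = (1 - fst q, fst q *\<^sub>R snd q)" for q :: "spacetime"
  define W where "W q = (0 :: real, snd q)" for q :: "spacetime"
  define e where "e i = (0 :: real, axis i 1 :: real ^ 3)" for i
  have A: "cone_point q ?T = D q" "cone_point q (e i) = e i" for q i
    by (auto simp: cone_point_def D_def e_def)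
  define G0 where "G0 q = G (?p q)" for q
  define GD where "GD q = dir_deriv (D q) G (?p q)" for q
  define GDD where "GDD q = dir_deriv (D q) (dir_deriv (D q) G) (?p q)" for q
  define GL where "GL q = (\<Sum>i\<in>UNIV. dir_deriv (e i) (dir_deriv (e i) G) (?p q))" for q
  define GW where "GW q = dir_deriv (W q) G (?p q)" for q
  define GWW where "GWW q = dir_deriv (W q) (dir_deriv (W q) G) (?p q)" for q
  have i0: "integrable cone_measure (\<lambda>q. fst q * G0 q)"
    unfolding G0_def by (rule cone.superpose_integrable[OF cone_weight_fst cG])
  have iD: "integrable cone_measure (\<lambda>q. fst q * GD q)"
    using cone.integrable_dir_deriv[OF cone_weight_fst G1, of ?T z] by (simp add: GD_def A)
  have iDD: "integrable cone_measure (\<lambda>q. fst q * GDD q)"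
    using cone.second_deriv_superpose(1)[OF cone_weight_fst G, of ?T ?T z] by (simp add: GDD_def A)
  have iee: "integrable cone_measure (\<lambda>q. fst q * dir_deriv (e i) (dir_deriv (e i) G) (?p q))" for i
    using cone.second_deriv_superpose(1)[OF cone_weight_fst G, of "e i" "e i" z] by (simp add: A)
  then have iL: "integrable cone_measure (\<lambda>q. fst q * GL q)"
    unfolding GL_def by (simp add: sum_distrib_left)
  have v0: "?\<Phi> z = (\<integral>q. fst q * G0 q \<partial>cone_measure)"
    by (simp add: cone.superpose_def G0_def)
  have vD: "dir_deriv ?T ?\<Phi> z = (\<integral>q. fst q * GD q \<partial>cone_measure)"
    by (simp add: cone.dir_deriv_superpose_integral[OF cone_weight_fst G1] GD_def A)
  have vDD: "dir_deriv ?T (dir_deriv ?T ?\<Phi>) z = (\<integral>q. fst q * GDD q \<partial>cone_measure)"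
    by (simp add: cone.second_deriv_superpose(2)[OF cone_weight_fst G] GDD_def A)
  have vL: "(\<Sum>i\<in>UNIV. dir_deriv (e i) (dir_deriv (e i) ?\<Phi>) z) = (\<integral>q. fst q * GL q \<partial>cone_measure)"
    by (simp add: cone.second_deriv_superpose(2)[OF cone_weight_fst G] GL_def A sum_distrib_left iee)
  have "wave_op (duhamel G) z = 2 * ?\<Phi> z + 4 * t * dir_deriv ?T ?\<Phi> z + t\<^sup>2 * dir_deriv ?T (dir_deriv ?T ?\<Phi>) z
      - t\<^sup>2 * (\<Sum>i\<in>UNIV. dir_deriv (e i) (dir_deriv (e i) ?\<Phi>) z)"
    unfolding wave_op_def time_deriv_def space_laplacian_def duhamel_def[abs_def] e_def
      second_deriv_time_mult[OF t\<Phi>] second_deriv_time_mult[OF \<Phi>] dir_deriv_time_mult[OF Ck2_differentiable(1)[OF \<Phi>]]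
    by (simp add: z power2_eq_square sum_distrib_left algebra_simps)
  also have "\<dots> = (\<integral>q. 2 * (fst q * G0 q) + 4 * t * (fst q * GD q) + t\<^sup>2 * (fst q * GDD q) - t\<^sup>2 * (fst q * GL q) \<partial>cone_measure)"
    unfolding v0 vD vDD vL using i0 iD iDD iL by simp
  finally have box: "wave_op (duhamel G) z =
      (\<integral>q. 2 * (fst q * G0 q) + 4 * t * (fst q * GD q) + t\<^sup>2 * (fst q * GDD q) - t\<^sup>2 * (fst q * GL q) \<partial>cone_measure)" .
  define J where "J q = t\<^sup>2 * (fst q * GL q) - t\<^sup>2 * (fst q * GWW q) - 2 * t * GW q" for q
  \<comment> \<open>The derivatives in direction \<open>W q\<close> are integrable because they are sums of superpositions with
    the components of \<open>snd q\<close> as weights.\<close>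
  have comp: "dir_deriv (W q) H y = (\<Sum>i\<in>UNIV. snd q $ i * dir_deriv (e i) H y)"
    if "H differentiable (at y)" for H q y
  proof -
    have "W q = (\<Sum>i\<in>UNIV. snd q $ i *\<^sub>R e i)"
      using vec_axis_sum[of "snd q"] by (simp add: W_def e_def sum_prod)
    then show ?thesis by (simp add: linear_sum[OF linear_dir_deriv[OF that]] linear_scale[OF linear_dir_deriv[OF that]])
  qed
  have compc: "cone.weight (\<lambda>q. snd q $ i)" for i
  proof -
    have "AE q in cone_measure. \<bar>snd q $ i\<bar> \<le> 1"
      using AE_cone_measure by eventually_elim (metis component_le_norm_cart)
    moreover have "(\<lambda>q. snd q $ i) \<in> borel_measurable cone_measure"
      by (subst measurable_cong_sets[OF sets_cone_measure refl]) (intro borel_measurable_continuous_onI continuous_intros)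
    ultimately show ?thesis unfolding cone.weight_def by blast
  qed
  have iW: "integrable cone_measure GW"
    unfolding GW_def comp[OF d(1)]
    by (intro Bochner_Integration.integrable_sum cone.superpose_integrable compc Ck_continuous[OF Ck_dir_deriv[OF G1]])
  have WW: "GWW q = (\<Sum>i\<in>UNIV. \<Sum>j\<in>UNIV. (snd q $ i * snd q $ j) * dir_deriv (e i) (dir_deriv (e j) G) (?p q))" for q
  proof -
    have f: "dir_deriv (W q) G = (\<lambda>y. \<Sum>j\<in>UNIV. snd q $ j * dir_deriv (e j) G y)"
      by (rule ext) (rule comp[OF d(1)])
    have "dir_deriv u (dir_deriv (W q) G) y = (\<Sum>j\<in>UNIV. snd q $ j * dir_deriv u (dir_deriv (e j) G) y)" for u y
      unfolding f by (subst dir_deriv_sum) (use d(2) in \<open>auto simp: dir_deriv_cmult intro!: differentiable_mult\<close>)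
    then show ?thesis
      unfolding GWW_def by (subst comp[OF d(2)]) (simp add: sum_distrib_left algebra_simps)
  qed
  have iWW: "integrable cone_measure (\<lambda>q. fst q * GWW q)"
  proof -
    have "(\<lambda>q. fst q * GWW q) = (\<lambda>q. \<Sum>i\<in>UNIV. \<Sum>j\<in>UNIV. (fst q * (snd q $ i * snd q $ j)) * dir_deriv (e i) (dir_deriv (e j) G) (?p q))"
      unfolding WW by (simp add: sum_distrib_left algebra_simps)
    then show ?thesis
      by (simp only:) (intro Bochner_Integration.integrable_sum cone.superpose_integrable cone.weight_mult cone_weight_fst compc
        Ck_continuous[OF Ck_dir_deriv[OF Ck_dir_deriv[OF G2]]])
  qed
  have iJ: "integrable cone_measure J"
    unfolding J_def using iL iWW iW by simp
  have J0: "(\<integral>w. J (s, w) \<partial>sphere_measure) = 0" for s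
  proof -
    let ?h = "\<lambda>x. G ((1 - s) * t, x)"
    note sl = dir_deriv_slice[OF G]
    have "(\<integral>w. J (s, w) \<partial>sphere_measure) = (\<integral>w. t * (s * t * (\<Sum>i\<in>UNIV. dir_deriv (axis i 1) (dir_deriv (axis i 1) ?h) (x + (s * t) *\<^sub>R w))
      - s * t * dir_deriv w (dir_deriv w ?h) (x + (s * t) *\<^sub>R w)
      - 2 * dir_deriv w ?h (x + (s * t) *\<^sub>R w)) \<partial>sphere_measure)"
      unfolding sl J_def GL_def GWW_def GW_def W_def e_def cone_point_def
      by (simp add: z power2_eq_square algebra_simps)
    also have "\<dots> = 0"
      by (subst integral_mult_right_zero) (simp only: Darboux[OF sl(1)] mult_zero_right)
    finally show ?thesis .
  qed
  have J: "(\<integral>q. J q \<partial>cone_measure) = 0"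
    using cone_pair.integral_fst'[of J] iJ J0 unfolding cone_measure_def by simp
  define I where "I q = 2 * (fst q * G0 q) + 4 * t * (fst q * GD q) + t\<^sup>2 * (fst q * GDD q) - t\<^sup>2 * (fst q * GL q) + J q" for q
  have iI: "integrable cone_measure I"
    unfolding I_def using i0 iD iDD iL iJ by simp
  have I0: "(\<integral>s. I (s, w) \<partial>unit_interval_measure) = G z" for w
  proof -
    let ?W = "(0 :: real, w)"
    define V where "V = t *\<^sub>R (?W - ?T)"
    have lin1: "linear (\<lambda>v. dir_deriv v G y)" and lin2: "linear (\<lambda>u. dir_deriv u (dir_deriv v G) y)" for v y
      by (rule linear_dir_deriv[OF d(1)], rule linear_dir_deriv[OF d(2)])
    have lin3: "linear (\<lambda>v. dir_deriv u (dir_deriv v G) y)" for u y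
      unfolding dir_deriv_commute[OF G, of u] by (rule linear_dir_deriv[OF d(2)])
    have gam: "cone_point (s, w) z = z + s *\<^sub>R V" for s
      by (simp add: cone_point_def V_def z algebra_simps)
    \<comment> \<open>The sum of the integrands is the derivative of this function along the cone, where \<open>V\<close> generates
      the translation in \<open>s\<close>; it vanishes for \<open>s = 1\<close> and equals \<open>- G z\<close> for \<open>s = 0\<close>.\<close>
    define \<Psi> where "\<Psi> s = (- 2 * s * (1 - s) * t) * dir_deriv ?W G (z + s *\<^sub>R V)
        + (s * (1 - s)\<^sup>2) * dir_deriv V G (z + s *\<^sub>R V) - (1 - s\<^sup>2) * G (z + s *\<^sub>R V)" for s
    have "(\<Psi> has_real_derivative I (s, w)) (at s)" for s
    proof -
      let ?y = "z + s *\<^sub>R V"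
      have "(\<Psi> has_real_derivative
          (- 2 * (1 - 2 * s) * t) * dir_deriv ?W G ?y + (- 2 * s * (1 - s) * t) * dir_deriv V (dir_deriv ?W G) ?y
          + (1 - 4 * s + 3 * s\<^sup>2) * dir_deriv V G ?y + (s * (1 - s)\<^sup>2) * dir_deriv V (dir_deriv V G) ?y
          + 2 * s * G ?y - (1 - s\<^sup>2) * dir_deriv V G ?y) (at s)"
        unfolding \<Psi>_def
        by (auto intro!: derivative_eq_intros dir_deriv_curve d) (simp add: power2_eq_square algebra_simps)
      moreover have DV: "D (s, w) = (1 - s) *\<^sub>R ?T + s *\<^sub>R ?W" "W (s, w) = ?W"
        by (simp_all add: D_def W_def)
      have TW: "dir_deriv ?T (dir_deriv ?W G) y = dir_deriv ?W (dir_deriv ?T G) y" for y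
        by (rule dir_deriv_commute[OF G])
      have "(- 2 * (1 - 2 * s) * t) * dir_deriv ?W G ?y + (- 2 * s * (1 - s) * t) * dir_deriv V (dir_deriv ?W G) ?y
          + (1 - 4 * s + 3 * s\<^sup>2) * dir_deriv V G ?y + (s * (1 - s)\<^sup>2) * dir_deriv V (dir_deriv V G) ?y
          + 2 * s * G ?y - (1 - s\<^sup>2) * dir_deriv V G ?y = I (s, w)"
        unfolding I_def J_def G0_def GD_def GDD_def GW_def GWW_def gam DV V_def
        unfolding linear_add[OF lin1] linear_diff[OF lin1] linear_scale[OF lin1]
          linear_add[OF lin2] linear_diff[OF lin2] linear_scale[OF lin2]
          linear_add[OF lin3] linear_diff[OF lin3] linear_scale[OF lin3] TW
        by (simp add: power2_eq_square power3_eq_cube algebra_simps)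
      ultimately show ?thesis by simp
    qed
    moreover have "continuous_on UNIV (\<lambda>s. I (s, w))"
    proof -
      have c: "continuous_on UNIV (\<lambda>s. H (z + s *\<^sub>R V))" if "continuous_on UNIV H" for H :: "spacetime \<Rightarrow> real"
        by (rule continuous_on_compose2[OF that]) (auto intro!: continuous_intros)
      have c1: "continuous_on UNIV (\<lambda>s. dir_deriv v G (z + s *\<^sub>R V))" for v
        by (rule c[OF Ck_continuous[OF Ck_dir_deriv[OF G1]]])
      have c2: "continuous_on UNIV (\<lambda>s. dir_deriv u (dir_deriv v G) (z + s *\<^sub>R V))" for u v
        by (rule c[OF Ck_continuous[OF Ck_dir_deriv[OF Ck_dir_deriv[OF G2]]]])
      have DV: "D (s, w) = (1 - s) *\<^sub>R ?T + s *\<^sub>R ?W" "W (s, w) = ?W" for s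
        by (simp_all add: D_def W_def)
      show ?thesis
        unfolding I_def J_def G0_def GD_def GDD_def GW_def GWW_def GL_def gam DV
        unfolding linear_add[OF lin1] linear_diff[OF lin1] linear_scale[OF lin1]
          linear_add[OF lin2] linear_diff[OF lin2] linear_scale[OF lin2]
          linear_add[OF lin3] linear_diff[OF lin3] linear_scale[OF lin3] fst_conv real_scaleR_def
        by (intro continuous_intros c1 c2 c[OF cG])
    qed
    ultimately have "(\<integral>s. I (s, w) \<partial>unit_interval_measure) = \<Psi> 1 - \<Psi> 0"
      by (rule unit_interval_FTC)
    then show ?thesis by (simp add: \<Psi>_def)
  qed
  have "(\<integral>q. I q \<partial>cone_measure) = (\<integral>w. (\<integral>s. I (s, w) \<partial>unit_interval_measure) \<partial>sphere_measure)"
    using cone_pair.integral_snd[of "\<lambda>s w. I (s, w)"] iI unfolding cone_measure_def by simp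
  also have "\<dots> = G z" by (simp add: I0 sphere.prob_space[simplified])
  finally have "(\<integral>q. I q \<partial>cone_measure) = G z" .
  moreover have "(\<integral>q. I q \<partial>cone_measure) = wave_op (duhamel G) z + (\<integral>q. J q \<partial>cone_measure)"
    unfolding box I_def using i0 iD iDD iL iJ by simp
  ultimately show ?thesis using J by simp
qed

lemma duhamel_initial:
  assumes "Ck 2 G"
  shows "duhamel G (0, x) = 0" and "time_deriv (duhamel G) (0, x) = 0"
proof -
  have \<Phi>: "Ck 2 (cone.superpose fst G)" by (rule cone.Ck_superpose[OF cone_weight_fst assms])
  have "Ck 2 (\<lambda>z. fst z * cone.superpose fst G z)" by (intro Ck_mult Ck_fst \<Phi>)
  from dir_deriv_time_mult[OF Ck2_differentiable(1)[OF this]]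
  show "time_deriv (duhamel G) (0, x) = 0"
    unfolding time_deriv_def duhamel_def[abs_def] by simp
qed (simp add: duhamel_def)

section \<open>The decay profile of the critical problem\<close>

text \<open>With \<open>\<sigma> = T (1 - s)\<close>, the coordinates \<open>\<sigma> + l\<close> and \<open>\<sigma> - l\<close> separate the integral. Translation
  in \<open>l\<close> followed by scaling in \<open>s\<close> replaces the two-dimensional change of variables.\<close>

lemma characteristic_coordinates:
  fixes f g :: "real \<Rightarrow> ennreal"
  assumes [measurable]: "f \<in> borel_measurable borel" "g \<in> borel_measurable borel" and T: "T > 0"
  shows "ennreal (2 * T) * (\<integral>\<^sup>+s. \<integral>\<^sup>+l. f (T * (1 - s) + l) * g (T * (1 - s) - l) \<partial>lborel \<partial>lborel) =
    (\<integral>\<^sup>+a. f a \<partial>lborel) * (\<integral>\<^sup>+b. g b \<partial>lborel)"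
proof -
  have inner: "(\<integral>\<^sup>+l. f (T * (1 - s) + l) * g (T * (1 - s) - l) \<partial>lborel) =
      (\<integral>\<^sup>+a. f a * g (2 * T * (1 - s) - a) \<partial>lborel)" for s
    using nn_integral_real_affine[of "\<lambda>a. f a * g (2 * T * (1 - s) - a)" 1 "T * (1 - s)"]
    by (simp add: algebra_simps)
  have outer: "ennreal (2 * T) * (\<integral>\<^sup>+s. g (2 * T * (1 - s) - a) \<partial>lborel) = (\<integral>\<^sup>+b. g b \<partial>lborel)" for a
    using nn_integral_real_affine[of g "- 2 * T" "2 * T - a"] T by (simp add: algebra_simps)
  have "(\<integral>\<^sup>+s. \<integral>\<^sup>+l. f (T * (1 - s) + l) * g (T * (1 - s) - l) \<partial>lborel \<partial>lborel) =
      (\<integral>\<^sup>+a. \<integral>\<^sup>+s. f a * g (2 * T * (1 - s) - a) \<partial>lborel \<partial>lborel)"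
    unfolding inner by (rule lborel_pair.Fubini') measurable
  then have "ennreal (2 * T) * (\<integral>\<^sup>+s. \<integral>\<^sup>+l. f (T * (1 - s) + l) * g (T * (1 - s) - l) \<partial>lborel \<partial>lborel) =
      (\<integral>\<^sup>+a. f a * (ennreal (2 * T) * (\<integral>\<^sup>+s. g (2 * T * (1 - s) - a) \<partial>lborel)) \<partial>lborel)"
    by (simp add: nn_integral_cmult[symmetric] algebra_simps)
  then show ?thesis unfolding outer by (simp add: nn_integral_multc)
qed

text \<open>The exact value is \<open>(1 + a)\<^sup>-\<^sup>d (1 - y\<^sup>d) / d\<close> with \<open>y = (1 + a) / (1 + b) \<le> 1\<close>, and \<open>y \<le> y\<^sup>d\<close> gives
  the bound. The factor \<open>b - a\<close> is what matters: near the axis \<open>x = 0\<close> it is of the order of \<open>norm x\<close>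
  and cancels the factor \<open>1 / norm x\<close> of the radial Duhamel integral.\<close>

lemma powr_integral_bound:
  assumes a: "0 \<le> a" "a \<le> b" and d: "0 < d" "d \<le> (1::real)"
  shows "(\<integral>\<^sup>+x. ennreal ((1 + x) powr (- 1 - d) * indicator {a..b} x) \<partial>lborel)
    \<le> ennreal ((b - a) * (1 + a) powr (- d) / (d * (1 + b)))"
proof -
  have "(\<integral>\<^sup>+x. ennreal ((1 + x) powr (- 1 - d)) * indicator {a..b} x \<partial>lborel) =
      ennreal (- ((1 + b) powr (- d)) / d - (- ((1 + a) powr (- d)) / d))"
  proof (rule nn_integral_FTC_Icc)
    fix x assume "x \<in> {a..b}"
    then have x: "a \<le> x" "x \<le> b" by auto
    have "((\<lambda>x. - ((1 + x) powr (- d)) / d) has_real_derivative - (- d * ((1 + x) powr (- d - 1)) * 1) / d) (at x)"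
      using x a by (auto intro!: derivative_eq_intros)
    then show "((\<lambda>x. - ((1 + x) powr (- d)) / d) has_real_derivative (1 + x) powr (- 1 - d)) (at x)"
      using d by (simp add: minus_diff_commute[of 1])
  qed (use a in auto)
  also have "- ((1 + b) powr (- d)) / d - (- ((1 + a) powr (- d)) / d) \<le> (b - a) * (1 + a) powr (- d) / (d * (1 + b))"
  proof -
    let ?y = "(1 + a) / (1 + b)"
    have y: "0 < ?y" "?y \<le> 1" using a by auto
    have "?y powr 1 \<le> ?y powr d" using y d by (intro powr_mono') auto
    then have y': "?y \<le> ?y powr d" using y a by simp
    have "(1 + b) powr (- d) = (1 + a) powr (- d) * ?y powr d"
      using a by (simp add: powr_divide powr_minus field_simps)
    then have "(1 + a) powr (- d) - (1 + b) powr (- d) = (1 + a) powr (- d) * (1 - ?y powr d)"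
      by (simp add: algebra_simps)
    also have "\<dots> \<le> (1 + a) powr (- d) * (1 - ?y)" using y' by (intro mult_left_mono) auto
    also have "1 - ?y = (b - a) / (1 + b)" using a by (simp add: field_simps)
    finally have "((1 + a) powr (- d) - (1 + b) powr (- d)) / d \<le> (1 + a) powr (- d) * ((b - a) / (1 + b)) / d"
      using d by (intro divide_right_mono) auto
    then show ?thesis by (simp add: diff_divide_distrib algebra_simps)
  qed
  finally show ?thesis by (simp add: ennreal_mult' ennreal_indicator ennreal_leI)
qed

text \<open>For \<open>p = 1 + sqrt 2\<close> this is \<open>p - 2\<close>, the decay rate of \<open>u\<close> away from the light cone in the
  problem with nonlinearity \<open>\<bar>u\<bar>\<^sup>p\<close>. The critical \<open>p\<close> is the positive root of \<open>p (p - 2) = 1\<close>.\<close>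

definition crit_decay :: real
  where "crit_decay = sqrt 2 - 1"

lemma crit_decay: "0 < crit_decay" "crit_decay \<le> 1" "crit_decay * (1 + sqrt 2) = 1" "1 - (1 + sqrt 2) = - 1 - crit_decay"
proof -
  have "1 < sqrt (2::real)" by simp
  moreover have "sqrt (2::real) \<le> sqrt 4" by (rule real_sqrt_le_mono) simp
  moreover have "sqrt (4::real) = 2" by simp
  ultimately show "0 < crit_decay" "crit_decay \<le> 1" by (auto simp: crit_decay_def)
qed (simp_all add: crit_decay_def algebra_simps)

locale critical_nonlinearity =
  fixes \<mu> F :: "real \<Rightarrow> real"
  assumes \<mu>_nonneg: "\<And>s. 0 \<le> s \<Longrightarrow> 0 \<le> \<mu> s"
    and \<mu>_cont: "continuous_on {0..} \<mu>"
    and \<mu>_mono: "mono_on {0..} \<mu>"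
    and F: "F = (\<lambda>u. \<bar>u\<bar> powr (1 + sqrt 2) * \<mu> \<bar>u\<bar>)"
    and F_C2: "Ck 2 F"
    and \<mu>_int: "(\<integral>\<^sup>+ s\<in>{0<..1}. ennreal (\<mu> s powr (1 + sqrt 2) / s) \<partial>lborel) < \<infinity>"
begin

text \<open>The decay rate is improved by the factor \<open>\<mu>\<close>, in the form in which it comes out of one application of
  the Duhamel operator. The second summand keeps the profile from vanishing where \<open>\<mu>\<close> does, so that it can
  dominate the free wave.\<close>

definition profile :: "real \<Rightarrow> real"
  where "profile q = (1 + \<bar>q\<bar>) powr (- crit_decay) * (\<mu> (1 / (1 + \<bar>q\<bar>)) + 1 / (1 + \<bar>q\<bar>))"

lemma \<mu>_le: "0 \<le> a \<Longrightarrow> a \<le> b \<Longrightarrow> \<mu> a \<le> \<mu> b"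
  using \<mu>_mono by (auto simp: mono_on_def)

lemma profile_continuous: "continuous_on UNIV profile"
proof -
  have "continuous_on UNIV (\<lambda>q :: real. \<mu> (1 / (1 + \<bar>q\<bar>)))"
    by (rule continuous_on_compose2[OF \<mu>_cont]) (auto intro!: continuous_intros)
  then show ?thesis unfolding profile_def by (intro continuous_intros) auto
qed

lemma profile_measurable [measurable]: "profile \<in> borel_measurable borel"
  by (rule borel_measurable_continuous_onI[OF profile_continuous])

lemma profile_nonneg: "0 \<le> profile q"
  unfolding profile_def by (intro mult_nonneg_nonneg add_nonneg_nonneg \<mu>_nonneg) auto

lemma profile_le: "profile q \<le> \<mu> 1 + 1"
proof -
  have "(1 + \<bar>q\<bar>) powr (- crit_decay) \<le> (1 + \<bar>q\<bar>) powr 0" using crit_decay by (intro powr_mono) auto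
  moreover have "1 + \<bar>q\<bar> \<noteq> 0" by linarith
  ultimately have "(1 + \<bar>q\<bar>) powr (- crit_decay) \<le> 1" by simp
  then have "profile q \<le> 1 * (\<mu> 1 + 1)" unfolding profile_def
    by (intro mult_mono add_mono \<mu>_le add_nonneg_nonneg \<mu>_nonneg) (auto simp: divide_simps)
  then show ?thesis by simp
qed

lemma profile_lower: "1 / (1 + q\<^sup>2) \<le> 2 * profile q"
proof -
  let ?b = "1 + \<bar>q\<bar>"
  have "?b powr (- 1) \<le> ?b powr (- crit_decay)" using crit_decay by (intro powr_mono) auto
  then have 1: "1 / ?b \<le> ?b powr (- crit_decay)" by (simp add: powr_minus_divide)
  have "1 / ?b * (1 / ?b) \<le> profile q"
    unfolding profile_def by (intro mult_mono 1) (auto intro!: \<mu>_nonneg)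
  moreover have "?b * ?b \<le> 2 * (1 + q\<^sup>2)"
  proof -
    have "\<bar>q\<bar> * 2 \<le> 1 + \<bar>q\<bar>\<^sup>2" using zero_le_power2[of "\<bar>q\<bar> - 1"] by (simp add: power2_eq_square algebra_simps)
    moreover have "?b * ?b = 1 + \<bar>q\<bar> * 2 + \<bar>q\<bar>\<^sup>2" by (simp add: power2_eq_square algebra_simps)
    ultimately show ?thesis by simp
  qed
  then have "1 / (1 + q\<^sup>2) \<le> 2 * (1 / ?b * (1 / ?b))"
  proof -
    assume a: "?b * ?b \<le> 2 * (1 + q\<^sup>2)"
    have p: "0 < 1 + q\<^sup>2" "0 < ?b * ?b" by (auto simp: add_pos_nonneg)
    have "2 / (2 * (1 + q\<^sup>2)) \<le> 2 / (?b * ?b)" by (rule divide_left_mono[OF a]) (use p in auto)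
    moreover have "2 / (2 * (1 + q\<^sup>2)) = 1 / (1 + q\<^sup>2)" using p by (simp add: field_simps)
    ultimately show ?thesis by simp
  qed
  ultimately show ?thesis by linarith
qed

text \<open>Here the critical exponent enters: the power \<open>- crit_decay\<close>, raised to the exponent of the
  nonlinearity, becomes exactly \<open>- 1\<close>.\<close>

lemma profile_powr:
  "profile q powr (1 + sqrt 2) = (\<mu> (1 / (1 + \<bar>q\<bar>)) + 1 / (1 + \<bar>q\<bar>)) powr (1 + sqrt 2) / (1 + \<bar>q\<bar>)"
proof -
  have "(1 + \<bar>q\<bar>) powr (- crit_decay * (1 + sqrt 2)) = 1 / (1 + \<bar>q\<bar>)"
    using crit_decay(3) by (simp add: powr_minus_divide)
  then show ?thesis
    unfolding profile_def by (subst powr_mult) (auto simp: powr_powr intro!: add_nonneg_nonneg \<mu>_nonneg)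
qed

text \<open>The substitution \<open>l = 1 / (1 + \<bar>q\<bar>)\<close> turns the integral over each half-line into the integral of
  \<open>(\<mu> l + l)\<^sup>p / l\<close> over the unit interval, with \<open>p = 1 + sqrt 2\<close>. So the hypothesis on \<open>\<mu>\<close> is exactly the
  integrability that the global estimate needs.\<close>

lemma profile_integral_finite: "(\<integral>\<^sup>+q. ennreal (profile q powr (1 + sqrt 2)) \<partial>lborel) < \<infinity>"
proof -
  let ?p = "1 + sqrt (2::real)"
  define k where "k = (\<lambda>l. (\<mu> l + l) powr ?p / l)"
  have p: "?p > 0" by (simp add: add_pos_pos)
  have \<mu>c: "continuous_on {0<..} \<mu>" by (rule continuous_on_subset[OF \<mu>_cont]) auto
  have kc: "continuous_on {0<..} k"
    unfolding k_def by (intro continuous_intros \<mu>c) (auto simp: \<mu>_nonneg add_nonneg_pos less_imp_neq[symmetric])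
  have km: "set_borel_measurable borel A k" if "A \<subseteq> {0<..}" "A \<in> sets borel" for A
    unfolding set_borel_measurable_def
    by (rule borel_measurable_continuous_on_indicator[OF that(2) continuous_on_subset[OF kc that(1)]])
  define J where "J = (\<integral>\<^sup>+l. ennreal (k l * indicator {0<..1} l) \<partial>lborel)"
  have J: "J < \<infinity>"
  proof -
    have "ennreal (k l * indicator {0<..1} l) \<le>
        ennreal (2 powr ?p) * (ennreal (\<mu> l powr ?p / l) * indicator {0<..1} l + indicator {0<..1} l)" for l
    proof (cases "l \<in> {0<..1}")
      case True
      then have l: "0 < l" "l \<le> 1" "\<mu> l \<ge> 0" using \<mu>_nonneg by auto
      have "(\<mu> l + l) powr ?p \<le> (2 * max (\<mu> l) l) powr ?p" using l p by (intro powr_mono2) auto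
      also have "\<dots> = 2 powr ?p * (max (\<mu> l) l) powr ?p" by (rule powr_mult)
      also have "(max (\<mu> l) l) powr ?p \<le> \<mu> l powr ?p + l powr ?p" by (auto simp: max_def)
      also have "l powr ?p \<le> l powr 1" using l by (intro powr_mono') auto
      finally have "(\<mu> l + l) powr ?p / l \<le> 2 powr ?p * (\<mu> l powr ?p + l) / l"
        using l by (intro divide_right_mono) auto
      also have "\<dots> = 2 powr ?p * (\<mu> l powr ?p / l + 1)" using l by (simp add: field_simps)
      finally have "ennreal (k l) \<le> ennreal (2 powr ?p * (\<mu> l powr ?p / l + 1))" unfolding k_def by (rule ennreal_leI)
      also have "\<dots> = ennreal (2 powr ?p) * (ennreal (\<mu> l powr ?p / l) + 1)"
        using l by (simp add: ennreal_mult' ennreal_plus)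
      finally show ?thesis using True by simp
    qed auto
    then have "J \<le> (\<integral>\<^sup>+l. ennreal (2 powr ?p) * (ennreal (\<mu> l powr ?p / l) * indicator {0<..1} l + indicator {0<..1} l) \<partial>lborel)"
      unfolding J_def by (rule nn_integral_mono)
    also have "\<dots> = ennreal (2 powr ?p) * ((\<integral>\<^sup>+l. ennreal (\<mu> l powr ?p / l) * indicator {0<..1} l \<partial>lborel) + (\<integral>\<^sup>+l. indicator {0<..(1::real)} l \<partial>lborel))"
    proof -
      have "set_borel_measurable borel {0<..1} (\<lambda>l. \<mu> l powr ?p / l)"
        unfolding set_borel_measurable_def
      proof (rule borel_measurable_continuous_on_indicator)
        show "continuous_on {0<..1} (\<lambda>l. \<mu> l powr ?p / l)"
          by (intro continuous_on_divide continuous_on_powr' continuous_on_subset[OF \<mu>c] continuous_on_const continuous_on_id)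
            (use p in \<open>auto simp: \<mu>_nonneg\<close>)
      qed simp
      then have m0: "(\<lambda>l. ennreal (indicator {0<..1} l *\<^sub>R (\<mu> l powr ?p / l))) \<in> borel_measurable borel"
        unfolding set_borel_measurable_def by (rule measurable_compose[OF _ measurable_ennreal])
      then have m1: "(\<lambda>l. ennreal (\<mu> l powr ?p / l) * indicator {0<..1} l) \<in> borel_measurable borel"
      proof -
        have "(\<lambda>l. ennreal (indicator {0<..1} l *\<^sub>R (\<mu> l powr ?p / l))) = (\<lambda>l. ennreal (\<mu> l powr ?p / l) * indicator {0<..1} l)"
          by (rule ext) (simp split: split_indicator)
        from subst[OF this, of "\<lambda>f. f \<in> borel_measurable borel"] m0 show ?thesis by blast
      qed
      let ?f = "\<lambda>l. ennreal (\<mu> l powr ?p / l) * indicator {0<..1} l" and ?i = "indicator {0<..1} :: real \<Rightarrow> ennreal"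
      have m: "?f \<in> borel_measurable lborel" "?i \<in> borel_measurable lborel"
        by (simp_all only: measurable_lborel1 measurable_lborel2 m1) simp
      have "(\<integral>\<^sup>+l. ennreal (2 powr ?p) * (?f l + ?i l) \<partial>lborel) = ennreal (2 powr ?p) * (\<integral>\<^sup>+l. ?f l + ?i l \<partial>lborel)"
        by (rule nn_integral_cmult[OF borel_measurable_add[OF m]])
      also have "(\<integral>\<^sup>+l. ?f l + ?i l \<partial>lborel) = (\<integral>\<^sup>+l. ?f l \<partial>lborel) + (\<integral>\<^sup>+l. ?i l \<partial>lborel)"
        by (rule nn_integral_add[OF m])
      finally show ?thesis .
    qed
    also have "\<dots> < \<infinity>" using \<mu>_int by (simp add: ennreal_mult_less_top)
    finally show ?thesis .
  qed
  have half: "(\<integral>\<^sup>+q. ennreal (profile q powr ?p) * indicator {- real n..0} q \<partial>lborel) \<le> J" for n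
  proof -
    \<comment> \<open>On the negative half-line \<open>1 / (1 + \<bar>q\<bar>)\<close> is an increasing function of \<open>q\<close>.\<close>
    define g where "g q = 1 / (1 - q)" for q :: real
    have ends: "g (- real n) = 1 / (1 + real n)" "g 0 = 1" by (simp_all add: g_def)
    have "(\<integral>\<^sup>+q. ennreal (profile q powr ?p) * indicator {- real n..0} q \<partial>lborel) =
        (\<integral>\<^sup>+q. ennreal (k (g q) * (1 / (1 - q)\<^sup>2) * indicator {- real n..0} q) \<partial>lborel)"
    proof (rule nn_integral_cong)
      fix q :: real
      have "profile q powr ?p = k (g q) * (1 / (1 - q)\<^sup>2)" if "q \<le> 0"
      proof -
        have "(\<mu> (1 / (1 - q)) + 1 / (1 - q)) powr ?p / (1 - q) = k (g q) * (1 / (1 - q)\<^sup>2)"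
          using that by (simp add: k_def g_def power2_eq_square)
        then show ?thesis using that by (simp add: profile_powr)
      qed
      then show "ennreal (profile q powr ?p) * indicator {- real n..0} q = ennreal (k (g q) * (1 / (1 - q)\<^sup>2) * indicator {- real n..0} q)"
        by (auto split: split_indicator)
    qed
    also have "\<dots> = (\<integral>\<^sup>+l. ennreal (k l * indicator {g (- real n)..g 0} l) \<partial>lborel)"
    proof (rule nn_integral_substitution[symmetric])
      show "set_borel_measurable borel {g (- real n)..g 0} k"
      proof (rule km)
        have "0 < 1 / (1 + real n)" by simp
        then show "{g (- real n)..g 0} \<subseteq> {0<..}" unfolding ends by (meson atLeastAtMost_iff greaterThan_iff less_le_trans subsetI)
      qed simp
      show "(g has_real_derivative 1 / (1 - x)\<^sup>2) (at x)" if "x \<in> {- real n..0}" for x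
        unfolding g_def using that by (auto intro!: derivative_eq_intros simp: power2_eq_square)
      show "continuous_on {- real n..0} (\<lambda>x. 1 / (1 - x)\<^sup>2)"
        by (intro continuous_intros) auto
    qed auto
    also have "\<dots> \<le> J"
      unfolding J_def
    proof (rule nn_integral_mono)
      fix l :: real
      have "0 < g (- real n)" unfolding ends by simp
      then show "ennreal (k l * indicator {g (- real n)..g 0} l) \<le> ennreal (k l * indicator {0<..1} l)"
        by (auto split: split_indicator simp: ends(2) k_def)
    qed
    finally show ?thesis .
  qed
  have pm [measurable]: "(\<lambda>q. ennreal (profile q powr ?p)) \<in> borel_measurable borel"
    by measurable
  have left: "(\<integral>\<^sup>+q. ennreal (profile q powr ?p) * indicator {..0} q \<partial>lborel) \<le> J"
  proof -
    have sup: "(SUP n. ennreal (profile q powr ?p) * indicator {- real n..0} q) = ennreal (profile q powr ?p) * indicator {..0} q" for q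
    proof (rule antisym)
      show "(SUP n. ennreal (profile q powr ?p) * indicator {- real n..0} q) \<le> ennreal (profile q powr ?p) * indicator {..0} q"
        by (rule SUP_least) (auto split: split_indicator)
      obtain n :: nat where "- q \<le> real n" using real_arch_simple by blast
      then have "ennreal (profile q powr ?p) * indicator {..0} q \<le> ennreal (profile q powr ?p) * indicator {- real n..0} q"
        by (auto split: split_indicator)
      also have "\<dots> \<le> (SUP n. ennreal (profile q powr ?p) * indicator {- real n..0} q)" by (rule SUP_upper) simp
      finally show "ennreal (profile q powr ?p) * indicator {..0} q \<le> (SUP n. ennreal (profile q powr ?p) * indicator {- real n..0} q)" .
    qed
    have "(\<integral>\<^sup>+q. (SUP n. ennreal (profile q powr ?p) * indicator {- real n..0} q) \<partial>lborel) =
        (SUP n. \<integral>\<^sup>+q. ennreal (profile q powr ?p) * indicator {- real n..0} q \<partial>lborel)"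
      by (rule nn_integral_monotone_convergence_SUP) (auto simp: incseq_def le_fun_def split: split_indicator)
    also have "\<dots> \<le> J" by (rule SUP_least) (rule half)
    finally show ?thesis unfolding sup .
  qed
  have even: "profile (- q) = profile q" for q by (simp add: profile_def)
  have right: "(\<integral>\<^sup>+q. ennreal (profile q powr ?p) * indicator {0..} q \<partial>lborel) \<le> J"
  proof -
    have "(\<integral>\<^sup>+q. ennreal (profile q powr ?p) * indicator {0..} q \<partial>lborel) =
        (\<integral>\<^sup>+q. ennreal (profile q powr ?p) * indicator {..0} q \<partial>lborel)"
      using nn_integral_real_affine[of "\<lambda>q. ennreal (profile q powr ?p) * indicator {0..} q" "- 1" 0]
      by (simp add: even indicator_def)
    with left show ?thesis by simp
  qed
  have "(\<integral>\<^sup>+q. ennreal (profile q powr ?p) \<partial>lborel) \<le>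
      (\<integral>\<^sup>+q. ennreal (profile q powr ?p) * indicator {..0} q + ennreal (profile q powr ?p) * indicator {0..} q \<partial>lborel)"
    by (rule nn_integral_mono) (auto split: split_indicator)
  also have "\<dots> = (\<integral>\<^sup>+q. ennreal (profile q powr ?p) * indicator {..0} q \<partial>lborel) + (\<integral>\<^sup>+q. ennreal (profile q powr ?p) * indicator {0..} q \<partial>lborel)"
    by (rule nn_integral_add) measurable
  also have "\<dots> \<le> J + J" by (intro add_mono left right)
  also have "\<dots> < \<infinity>" using J by simp
  finally show ?thesis .
qed

end

section \<open>The Duhamel operator below the envelope\<close>

lemma nn_integral_Icc_continuous:
  fixes k :: "real \<Rightarrow> real"
  assumes k: "continuous_on {a..b} k" and pos: "\<And>l. l \<in> {a..b} \<Longrightarrow> 0 \<le> k l"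
  shows "ennreal (integral {a..b} k) = (\<integral>\<^sup>+l. ennreal (k l) * indicator {a..b} l \<partial>lborel)"
proof -
  have int: "integrable lborel (\<lambda>l. indicator {a..b} l *\<^sub>R k l)"
    by (rule borel_integrable_compact[OF compact_Icc k])
  then have "set_integrable lborel {a..b} k" by (simp add: set_integrable_def)
  from set_borel_integral_eq_integral(2)[OF this]
  have "integral {a..b} k = (\<integral>l. indicator {a..b} l *\<^sub>R k l \<partial>lborel)"
    by (simp add: set_lebesgue_integral_def)
  also have "ennreal \<dots> = (\<integral>\<^sup>+l. ennreal (indicator {a..b} l *\<^sub>R k l) \<partial>lborel)"
    by (rule nn_integral_eq_integral[symmetric, OF int]) (auto simp: pos split: split_indicator)
  also have "\<dots> = (\<integral>\<^sup>+l. ennreal (k l) * indicator {a..b} l \<partial>lborel)"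
    by (rule nn_integral_cong) (auto split: split_indicator)
  finally show ?thesis .
qed

context critical_nonlinearity
begin

definition envelope :: "real \<Rightarrow> real \<Rightarrow> real"
  where "envelope t r = profile (\<bar>t\<bar> - \<bar>r\<bar>) / (1 + \<bar>t\<bar> + \<bar>r\<bar>)"

lemma envelope_nonneg: "0 \<le> envelope t r"
  by (simp add: envelope_def profile_nonneg)

lemma envelope_abs: "envelope \<bar>t\<bar> r = envelope t r"
  by (simp add: envelope_def)

lemma envelope_continuous:
  assumes "continuous_on S f" "continuous_on S g"
  shows "continuous_on S (\<lambda>x. envelope (f x) (g x))"
  unfolding envelope_def
  by (intro continuous_intros continuous_on_compose2[OF profile_continuous] assms) (auto simp: add_nonneg_eq_0_iff add.assoc)

lemma F_continuous: "continuous_on UNIV F"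
  using F_C2 Ck_continuous by blast

lemma F_nonneg: "0 \<le> F u"
  by (simp add: F \<mu>_nonneg)

lemma F_mono: "\<bar>u\<bar> \<le> v \<Longrightarrow> F u \<le> F v"
  unfolding F by (intro mult_mono powr_mono2 \<mu>_le) (auto simp: \<mu>_nonneg add_nonneg_nonneg)

text \<open>In characteristic coordinates the envelope is a function of \<open>s - l\<close> divided by \<open>1 + (s + l)\<close>. In the
  domain of integration \<open>s + l \<ge> \<bar>q\<bar>\<close>, so the slowly varying factor of \<open>F\<close> may be replaced by
  \<open>\<mu> (1 / (1 + \<bar>q\<bar>))\<close>, which does not depend on the integration variables; it becomes the factor
  \<open>\<mu>\<close> in the profile of the result.\<close>

lemma F_envelope_bound:
  assumes c: "0 \<le> c" "c * (\<mu> 1 + 1) \<le> 1" and sl: "0 \<le> s" "0 \<le> l" and q: "\<bar>q\<bar> \<le> s + l"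
  shows "l * F (c * envelope s l) \<le> (c powr (1 + sqrt 2) * \<mu> (1 / (1 + \<bar>q\<bar>))) *
    ((1 + (s + l)) powr (- 1 - crit_decay) * profile (s - l) powr (1 + sqrt 2))"
proof -
  let ?p = "1 + sqrt (2::real)" and ?a = "1 + (s + l)"
  have a: "?a > 0" using sl by simp
  have v: "envelope s l = profile (s - l) / ?a" using sl by (simp add: envelope_def add.assoc)
  have V0: "0 \<le> c * envelope s l" using c by (simp add: envelope_nonneg)
  have "c * profile (s - l) \<le> c * (\<mu> 1 + 1)" using c profile_le by (intro mult_left_mono)
  then have "c * envelope s l \<le> 1 / ?a"
    using c a by (simp add: v divide_simps)
  also have "\<dots> \<le> 1 / (1 + \<bar>q\<bar>)" using q by (simp add: frac_le)
  finally have m: "\<mu> (c * envelope s l) \<le> \<mu> (1 / (1 + \<bar>q\<bar>))" using V0 by (rule \<mu>_le[rotated])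
  have "(c * envelope s l) powr ?p = c powr ?p * (profile (s - l) powr ?p * ?a powr (- ?p))"
    unfolding v powr_mult powr_divide powr_minus_divide[of _ ?p] by simp
  then have "l * F (c * envelope s l) = l * ?a powr (- ?p) * (c powr ?p * profile (s - l) powr ?p) * \<mu> (c * envelope s l)"
    using V0 by (simp add: F)
  also have "\<dots> \<le> ?a powr (- 1 - crit_decay) * (c powr ?p * profile (s - l) powr ?p) * \<mu> (1 / (1 + \<bar>q\<bar>))"
  proof (intro mult_mono m mult_right_mono)
    have "l * ?a powr (- ?p) \<le> ?a * ?a powr (- ?p)" using sl by (intro mult_right_mono) auto
    also have "\<dots> = ?a powr (1 + - ?p)" unfolding powr_add using a by simp
    also have "1 + - ?p = - 1 - crit_decay" using crit_decay(4) by simp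
    finally show "l * ?a powr (- ?p) \<le> ?a powr (- 1 - crit_decay)" .
  qed (auto simp: \<mu>_nonneg V0)
  also have "\<dots> = (c powr ?p * \<mu> (1 / (1 + \<bar>q\<bar>))) * (?a powr (- 1 - crit_decay) * profile (s - l) powr ?p)"
    by (simp add: mult_ac)
  finally show ?thesis .
qed

definition profile_mass :: real
  where "profile_mass = enn2real (\<integral>\<^sup>+q. ennreal (profile q powr (1 + sqrt 2)) \<partial>lborel)"

lemma profile_mass: "(\<integral>\<^sup>+q. ennreal (profile q powr (1 + sqrt 2)) \<partial>lborel) = ennreal profile_mass" "0 \<le> profile_mass"
  using profile_integral_finite by (simp_all add: profile_mass_def)

text \<open>After \<open>spherical_mean_radial\<close> the Duhamel integral runs over pairs of a fraction \<open>s\<close> and a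
  radius \<open>l\<close>. There the integrand is at most a product of a function of \<open>\<sigma> + l\<close>, supported in
  \<open>[\<bar>q\<bar>, T + r]\<close>, and a function of \<open>\<sigma> - l\<close>, with \<open>\<sigma> = T (1 - s)\<close>. The integral of the first factor is at most
  \<open>2 r (1 + \<bar>q\<bar>)\<^sup>-\<^sup>d / (d (1 + T + r))\<close> with \<open>d = crit_decay\<close>, and that of the second is \<open>profile_mass\<close>.\<close>

lemma duhamel_bound_off_axes:
  assumes G: "continuous_on UNIV G" and c: "0 \<le> c" "c * (\<mu> 1 + 1) \<le> 1"
    and bound: "\<And>s y. \<bar>G (s, y)\<bar> \<le> F (c * envelope s (norm y))"
    and t: "t \<noteq> 0" and x: "x \<noteq> 0"
  shows "\<bar>duhamel G (t, x)\<bar> \<le> c powr (1 + sqrt 2) * (profile_mass / (2 * crit_decay)) * envelope t (norm x)"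
proof -
  let ?p = "1 + sqrt (2::real)"
  define T r q where "T = \<bar>t\<bar>" and "r = norm x" and "q = T - r"
  have T: "T > 0" and r: "r > 0" using t x by (simp_all add: T_def r_def)
  define \<Gamma> where "\<Gamma> y = F (c * envelope (fst y) (norm (snd y)))" for y :: "spacetime"
  have \<Gamma>: "continuous_on UNIV \<Gamma>" unfolding \<Gamma>_def
    by (intro continuous_on_compose2[OF F_continuous] continuous_intros envelope_continuous) auto
  define h where "h s l = F (c * envelope (T * (1 - s)) l)" for s l
  have h: "continuous_on UNIV (h s)" for s unfolding h_def
    by (intro continuous_on_compose2[OF F_continuous] continuous_intros envelope_continuous) auto
  have h0: "0 \<le> h s l" for s l by (simp add: h_def F_nonneg)
  define b where "b s = t\<^sup>2 * (s * (\<integral>w. \<Gamma> (cone_point (s, w) (t, x)) \<partial>sphere_measure))" for s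
  have int\<Gamma>: "integrable cone_measure (\<lambda>q. fst q * \<Gamma> (cone_point q (t, x)))"
    by (rule cone.superpose_integrable[OF cone_weight_fst \<Gamma>])
  have intG: "integrable cone_measure (\<lambda>q. fst q * G (cone_point q (t, x)))"
    by (rule cone.superpose_integrable[OF cone_weight_fst G])
  have int_b: "integrable unit_interval_measure b"
    using cone_pair.integrable_fst'[of "\<lambda>q. fst q * \<Gamma> (cone_point q (t, x))"] int\<Gamma>
    unfolding cone_measure_def b_def by simp
  have "\<bar>duhamel G (t, x)\<bar> = t\<^sup>2 * \<bar>\<integral>q. fst q * G (cone_point q (t, x)) \<partial>cone_measure\<bar>"
    by (simp add: duhamel_def cone.superpose_def abs_mult power2_eq_square)
  also have "\<dots> \<le> t\<^sup>2 * (\<integral>q. \<bar>fst q * G (cone_point q (t, x))\<bar> \<partial>cone_measure)"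
    by (intro mult_left_mono integral_abs_bound) auto
  also have "\<dots> \<le> t\<^sup>2 * (\<integral>q. fst q * \<Gamma> (cone_point q (t, x)) \<partial>cone_measure)"
  proof (intro mult_left_mono integral_mono_AE)
    show "AE q in cone_measure. \<bar>fst q * G (cone_point q (t, x))\<bar> \<le> fst q * \<Gamma> (cone_point q (t, x))"
      using AE_cone_measure
    proof eventually_elim
      case (elim q)
      then show ?case
        using bound[of "fst (cone_point q (t, x))" "snd (cone_point q (t, x))"]
        by (auto simp: abs_mult \<Gamma>_def intro!: mult_left_mono)
    qed
  qed (use intG int\<Gamma> in auto)
  also have "\<dots> = t\<^sup>2 * (\<integral>s. s * (\<integral>w. \<Gamma> (cone_point (s, w) (t, x)) \<partial>sphere_measure) \<partial>unit_interval_measure)"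
    using cone_pair.integral_fst'[of "\<lambda>q. fst q * \<Gamma> (cone_point q (t, x))"] int\<Gamma>
    unfolding cone_measure_def by simp
  also have "\<dots> = (\<integral>s. b s \<partial>unit_interval_measure)" unfolding b_def by simp
  finally have 1: "\<bar>duhamel G (t, x)\<bar> \<le> (\<integral>s. b s \<partial>unit_interval_measure)" .
  have bm: "b \<in> borel_measurable borel"
    using borel_measurable_integrable[OF int_b] by (simp cong: measurable_cong_sets)
  have b0: "0 \<le> b s" if "s \<in> {0..1}" for s
    unfolding b_def \<Gamma>_def using that by (intro mult_nonneg_nonneg Bochner_Integration.integral_nonneg F_nonneg) auto
  define E where "E = c powr ?p * \<mu> (1 / (1 + \<bar>q\<bar>))"
  have E: "0 \<le> E" unfolding E_def by (intro mult_nonneg_nonneg \<mu>_nonneg) auto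
  define f where "f a = ennreal ((1 + a) powr (- 1 - crit_decay) * indicator {\<bar>q\<bar>..T + r} a)" for a
  define g where "g q = ennreal (profile q powr ?p)" for q
  have fm [measurable]: "f \<in> borel_measurable borel" unfolding f_def by measurable
  have gm [measurable]: "g \<in> borel_measurable borel" unfolding g_def by measurable
  have inner: "ennreal (b s) \<le> ennreal (T / (2 * r) * E) * (\<integral>\<^sup>+l. f (T * (1 - s) + l) * g (T * (1 - s) - l) \<partial>lborel)"
    if s: "s \<in> {0..1}" for s
  proof (cases "s = 0")
    case False
    then have s0: "s > 0" "s \<le> 1" using s by auto
    have "(\<integral>w. \<Gamma> (cone_point (s, w) (t, x)) \<partial>sphere_measure) = (\<integral>w. h s (norm (x + (s * t) *\<^sub>R w)) \<partial>sphere_measure)"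
    proof (rule Bochner_Integration.integral_cong[OF refl])
      fix w
      have "envelope ((1 - s) * t) l = envelope (T * (1 - s)) l" for l
        using s0 envelope_abs[of "(1 - s) * t"] by (simp add: abs_mult T_def mult.commute)
      then show "\<Gamma> (cone_point (s, w) (t, x)) = h s (norm (x + (s * t) *\<^sub>R w))"
        by (simp add: \<Gamma>_def h_def cone_point_def)
    qed
    also have "\<dots> = (\<integral>w. h s (norm (x + (s * T) *\<^sub>R w)) \<partial>sphere_measure)"
      using spherical_mean_reflect[OF h, of s x "s * t"] s0 by (simp add: abs_mult T_def)
    finally have "b s = T * ((s * T) * (\<integral>w. h s (norm (x + (s * T) *\<^sub>R w)) \<partial>sphere_measure))"
      by (simp add: b_def T_def power2_eq_square abs_mult_self_eq)
    also have "(s * T) * (\<integral>w. h s (norm (x + (s * T) *\<^sub>R w)) \<partial>sphere_measure) =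
        integral {\<bar>r - s * T\<bar>..r + s * T} (\<lambda>l. l * h s l) / (2 * r)"
      unfolding r_def by (rule spherical_mean_radial[OF x _ h]) (use s0 T in simp)
    finally have bs: "b s = T / (2 * r) * integral {\<bar>r - s * T\<bar>..r + s * T} (\<lambda>l. l * h s l)" by simp
    have bs': "ennreal (b s) = ennreal (T / (2 * r)) * ennreal (integral {\<bar>r - s * T\<bar>..r + s * T} (\<lambda>l. l * h s l))"
      unfolding bs using T r by (intro ennreal_mult') auto
    have "ennreal (integral {\<bar>r - s * T\<bar>..r + s * T} (\<lambda>l. l * h s l)) =
        (\<integral>\<^sup>+l. ennreal (l * h s l) * indicator {\<bar>r - s * T\<bar>..r + s * T} l \<partial>lborel)"
      by (rule nn_integral_Icc_continuous)
        (auto intro!: continuous_intros continuous_on_subset[OF h] mult_nonneg_nonneg h0)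
    also have "\<dots> \<le> (\<integral>\<^sup>+l. ennreal E * (f (T * (1 - s) + l) * g (T * (1 - s) - l)) \<partial>lborel)"
    proof (rule nn_integral_mono)
      fix l
      show "ennreal (l * h s l) * indicator {\<bar>r - s * T\<bar>..r + s * T} l \<le> ennreal E * (f (T * (1 - s) + l) * g (T * (1 - s) - l))"
      proof (cases "l \<in> {\<bar>r - s * T\<bar>..r + s * T}")
        case True
        let ?\<sigma> = "T * (1 - s)"
        have \<sigma>: "?\<sigma> \<ge> 0" "l \<ge> 0" "s * T \<le> T" using T s0 True by (auto simp: mult_left_le_one_le)
        have \<sigma>': "?\<sigma> = T - s * T" by (simp add: algebra_simps)
        have lo: "\<bar>q\<bar> \<le> ?\<sigma> + l" and hi: "?\<sigma> + l \<le> T + r"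
          using True \<sigma>(3) unfolding \<sigma>' q_def by auto
        have "l * h s l \<le> E * ((1 + (?\<sigma> + l)) powr (- 1 - crit_decay) * profile (?\<sigma> - l) powr ?p)"
          unfolding h_def E_def by (rule F_envelope_bound[OF c \<sigma>(1,2) lo])
        then have "ennreal (l * h s l) \<le> ennreal (E * ((1 + (?\<sigma> + l)) powr (- 1 - crit_decay) * profile (?\<sigma> - l) powr ?p))"
          by (rule ennreal_leI)
        also have "\<dots> = ennreal E * (f (?\<sigma> + l) * g (?\<sigma> - l))"
          unfolding f_def g_def using lo hi E by (simp add: ennreal_mult' ennreal_mult'')
        finally show ?thesis using True by simp
      qed auto
    qed
    also have "\<dots> = ennreal E * (\<integral>\<^sup>+l. f (T * (1 - s) + l) * g (T * (1 - s) - l) \<partial>lborel)"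
      by (rule nn_integral_cmult) measurable
    finally have "ennreal (b s) \<le> ennreal (T / (2 * r)) * (ennreal E * (\<integral>\<^sup>+l. f (T * (1 - s) + l) * g (T * (1 - s) - l) \<partial>lborel))"
      unfolding bs' by (rule mult_left_mono) simp
    moreover have "ennreal (T / (2 * r) * E) = ennreal (T / (2 * r)) * ennreal E"
      using T r E by (intro ennreal_mult) auto
    ultimately show ?thesis by (simp only: mult.assoc)
  qed (simp add: b_def)
  have "ennreal \<bar>duhamel G (t, x)\<bar> \<le> ennreal (\<integral>s. b s \<partial>unit_interval_measure)"
    using 1 by (rule ennreal_leI)
  also have "\<dots> = (\<integral>\<^sup>+s. ennreal (b s) \<partial>unit_interval_measure)"
  proof (rule nn_integral_eq_integral[symmetric, OF int_b])
    show "AE s in unit_interval_measure. 0 \<le> b s" using AE_unit_interval by eventually_elim (rule b0)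
  qed
  also have "\<dots> = (\<integral>\<^sup>+s. ennreal (indicator {0..1} s) * ennreal (b s) \<partial>lborel)"
    unfolding unit_interval_density
    by (rule nn_integral_density) (use bm in auto)
  also have "\<dots> \<le> (\<integral>\<^sup>+s. ennreal (T / (2 * r) * E) * (\<integral>\<^sup>+l. f (T * (1 - s) + l) * g (T * (1 - s) - l) \<partial>lborel) \<partial>lborel)"
    by (rule nn_integral_mono) (use inner in \<open>auto split: split_indicator\<close>)
  also have "\<dots> = ennreal (T / (2 * r) * E) * (\<integral>\<^sup>+s. \<integral>\<^sup>+l. f (T * (1 - s) + l) * g (T * (1 - s) - l) \<partial>lborel \<partial>lborel)"
    by (rule nn_integral_cmult) measurable
  finally have 2: "ennreal \<bar>duhamel G (t, x)\<bar> \<le>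
      ennreal (T / (2 * r) * E) * (\<integral>\<^sup>+s. \<integral>\<^sup>+l. f (T * (1 - s) + l) * g (T * (1 - s) - l) \<partial>lborel \<partial>lborel)" .
  have coef: "ennreal (T / (2 * r) * E) = ennreal (E / (4 * r)) * ennreal (2 * T)"
    using T r E by (subst ennreal_mult[symmetric]) auto
  have 3: "ennreal \<bar>duhamel G (t, x)\<bar> \<le> ennreal (E / (4 * r)) * ((\<integral>\<^sup>+a. f a \<partial>lborel) * ennreal profile_mass)"
    using 2 characteristic_coordinates[OF fm gm T] unfolding coef mult.assoc
    by (simp only: g_def profile_mass)
  have "(\<integral>\<^sup>+a. f a \<partial>lborel) \<le> ennreal ((T + r - \<bar>q\<bar>) * (1 + \<bar>q\<bar>) powr (- crit_decay) / (crit_decay * (1 + (T + r))))"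
    unfolding f_def by (rule powr_integral_bound) (use crit_decay T r in \<open>auto simp: q_def\<close>)
  also have "\<dots> \<le> ennreal (2 * r * (1 + \<bar>q\<bar>) powr (- crit_decay) / (crit_decay * (1 + (T + r))))"
    using crit_decay T r by (intro ennreal_leI divide_right_mono mult_right_mono) (auto simp: q_def)
  finally have 4: "(\<integral>\<^sup>+a. f a \<partial>lborel) \<le> ennreal (2 * r * (1 + \<bar>q\<bar>) powr (- crit_decay) / (crit_decay * (1 + (T + r))))" .
  have "ennreal \<bar>duhamel G (t, x)\<bar> \<le> ennreal (E / (4 * r)) *
      (ennreal (2 * r * (1 + \<bar>q\<bar>) powr (- crit_decay) / (crit_decay * (1 + (T + r)))) * ennreal profile_mass)"
    by (rule order_trans[OF 3]) (intro mult_left_mono mult_right_mono 4; simp)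
  also have "\<dots> = ennreal (E / (4 * r) * (2 * r * (1 + \<bar>q\<bar>) powr (- crit_decay) / (crit_decay * (1 + (T + r))) * profile_mass))"
  proof -
    have "ennreal A * (ennreal B * ennreal C) = ennreal (A * (B * C))" if "0 \<le> A" "0 \<le> B" "0 \<le> C" for A B C
      using that by (simp add: ennreal_mult)
    then show ?thesis by this (use E r T crit_decay profile_mass(2) in auto)
  qed
  finally have "\<bar>duhamel G (t, x)\<bar> \<le> E / (4 * r) * (2 * r * (1 + \<bar>q\<bar>) powr (- crit_decay) / (crit_decay * (1 + (T + r))) * profile_mass)"
    using E r T crit_decay profile_mass(2) by (subst (asm) ennreal_le_iff) auto
  also have "\<dots> = c powr ?p * (profile_mass / (2 * crit_decay)) * ((1 + \<bar>q\<bar>) powr (- crit_decay) * \<mu> (1 / (1 + \<bar>q\<bar>)) / (1 + (T + r)))"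
    using r by (simp add: E_def field_simps)
  also have "\<dots> \<le> c powr ?p * (profile_mass / (2 * crit_decay)) * (profile q / (1 + (T + r)))"
    unfolding profile_def using T r crit_decay profile_mass(2)
    by (intro mult_left_mono divide_right_mono) auto
  also have "profile q / (1 + (T + r)) = envelope t (norm x)"
    by (simp add: envelope_def q_def T_def r_def add.assoc)
  finally show ?thesis .
qed

text \<open>The radial formula divides by \<open>norm x\<close>, so the axis \<open>x = 0\<close> is reached by continuity.\<close>

lemma duhamel_bound:
  assumes G: "continuous_on UNIV G" and c: "0 \<le> c" "c * (\<mu> 1 + 1) \<le> 1"
    and bound: "\<And>s y. \<bar>G (s, y)\<bar> \<le> F (c * envelope s (norm y))"
  shows "\<bar>duhamel G (t, x)\<bar> \<le> c powr (1 + sqrt 2) * (profile_mass / (2 * crit_decay)) * envelope t (norm x)"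
    (is "_ \<le> ?C * _")
proof (cases "t = 0")
  case True
  then show ?thesis using crit_decay profile_mass(2) by (simp add: duhamel_def envelope_nonneg)
next
  case False
  note off = duhamel_bound_off_axes[OF G c bound False]
  show ?thesis
  proof (cases "x = 0")
    case True
    have dc: "continuous_on UNIV (duhamel G)" using Ck_duhamel[of 0 G] G by simp
    define X where "X n = (inverse (real (Suc n)) *\<^sub>R axis 1 1 :: real ^ 3)" for n
    have X0: "X n \<noteq> 0" for n by (simp add: X_def axis_eq_0_iff)
    have X: "X \<longlonglongrightarrow> x"
      using tendsto_scaleR[OF LIMSEQ_inverse_real_of_nat tendsto_const[of "axis 1 1 :: real ^ 3"]] True
      by (simp add: X_def[abs_def])
    have c1: "continuous_on UNIV (\<lambda>x. \<bar>duhamel G (t, x)\<bar>)"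
      by (intro continuous_intros continuous_on_compose2[OF dc]) auto
    have c2: "continuous_on UNIV (\<lambda>x :: real ^ 3. ?C * envelope t (norm x))"
      by (intro continuous_intros envelope_continuous)
    have l: "(\<lambda>n. k (X n)) \<longlonglongrightarrow> k x" if "continuous_on UNIV k" for k :: "real ^ 3 \<Rightarrow> real"
      using that X by (auto intro: isCont_tendsto_compose simp: continuous_on_eq_continuous_at)
    show ?thesis
      by (rule LIMSEQ_le[OF l[OF c1] l[OF c2]]) (use off[OF X0] in blast)
  qed (rule off)
qed

end

section \<open>Locally uniform convergence with derivatives\<close>

definition locally_convergent :: "(nat \<Rightarrow> 'a::euclidean_space \<Rightarrow> real) \<Rightarrow> bool"
  where "locally_convergent u \<longleftrightarrow> (\<forall>n. continuous_on UNIV (u n)) \<and>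
    (\<exists>l. \<forall>K. compact K \<longrightarrow> uniform_limit K u l sequentially)"

lemma continuous_on_locally:
  fixes l :: "'a::euclidean_space \<Rightarrow> real"
  assumes "\<And>x. continuous_on (cball x 1) l" shows "continuous_on UNIV l"
  unfolding continuous_on_eq_continuous_at[OF open_UNIV]
proof
  fix x :: 'a
  have "x \<in> interior (cball x 1)" by (simp add: interior_cball)
  then show "isCont l x" using assms[of x] by (meson continuous_on_interior)
qed

lemma locally_convergentE:
  assumes "locally_convergent u"
  obtains l where "continuous_on UNIV l" "\<And>K. compact K \<Longrightarrow> uniform_limit K u l sequentially"
proof -
  obtain l where l: "\<And>K. compact K \<Longrightarrow> uniform_limit K u l sequentially"
    using assms by (auto simp: locally_convergent_def)
  have "continuous_on (cball x 1) l" for x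
    by (rule uniform_limit_theorem[OF _ l])
      (use assms in \<open>auto simp: locally_convergent_def intro!: eventuallyI intro: continuous_on_subset\<close>)
  then show ?thesis using l by (intro that[of l] continuous_on_locally)
qed

lemma locally_convergent_continuous: "locally_convergent u \<Longrightarrow> continuous_on UNIV (u n)"
  by (simp add: locally_convergent_def)

lemma locally_convergentI:
  assumes "\<And>n. continuous_on UNIV (u n)" "\<And>K. compact K \<Longrightarrow> uniform_limit K u l sequentially"
  shows "locally_convergent u"
  using assms unfolding locally_convergent_def by blast

lemma bounded_image_continuous:
  "continuous_on UNIV (l :: 'a::euclidean_space \<Rightarrow> real) \<Longrightarrow> compact K \<Longrightarrow> bounded (l ` K)"
  by (rule compact_imp_bounded[OF compact_continuous_image[OF continuous_on_subset]]) auto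

lemma locally_convergent_bounded:
  assumes u: "locally_convergent u" and K: "compact K"
  obtains B where "B \<ge> 0" "\<And>n z. z \<in> K \<Longrightarrow> \<bar>u n z\<bar> \<le> B"
proof -
  obtain l where l: "continuous_on UNIV l" "\<And>K. compact K \<Longrightarrow> uniform_limit K u l sequentially"
    using locally_convergentE[OF u] by blast
  obtain B0 where B0: "\<And>z. z \<in> K \<Longrightarrow> \<bar>l z\<bar> \<le> B0"
    using bounded_image_continuous[OF l(1) K] by (auto simp: bounded_iff)
  have "\<forall>\<^sub>F n in sequentially. \<forall>z\<in>K. dist (u n z) (l z) < 1"
    using l(2)[OF K] by (simp add: uniform_limit_iff)
  then obtain N where N: "\<And>n z. n \<ge> N \<Longrightarrow> z \<in> K \<Longrightarrow> dist (u n z) (l z) < 1"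
    by (auto simp: eventually_sequentially)
  have "\<exists>B. \<forall>z\<in>K. \<bar>u n z\<bar> \<le> B" for n
    using bounded_image_continuous[OF locally_convergent_continuous[OF u] K, of n] by (auto simp: bounded_iff)
  then obtain b where b: "\<And>n z. z \<in> K \<Longrightarrow> \<bar>u n z\<bar> \<le> b n" by metis
  define B where "B = \<bar>B0\<bar> + 1 + (\<Sum>n<N. \<bar>b n\<bar>)"
  show ?thesis
  proof (rule that[of B])
    show "B \<ge> 0" by (auto simp: B_def intro!: add_nonneg_nonneg sum_nonneg)
    fix n z assume z: "z \<in> K"
    show "\<bar>u n z\<bar> \<le> B"
    proof (cases "n < N")
      case True
      have "\<bar>b n\<bar> \<le> (\<Sum>n<N. \<bar>b n\<bar>)" using True by (intro member_le_sum) auto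
      then show ?thesis using b[OF z, of n] by (auto simp: B_def)
    next
      case False
      then have "\<bar>u n z - l z\<bar> < 1" using N[of n z] z by (simp add: dist_real_def)
      moreover have "0 \<le> (\<Sum>n<N. \<bar>b n\<bar>)" by (auto intro: sum_nonneg)
      ultimately show ?thesis unfolding B_def using B0[OF z] by linarith
    qed
  qed
qed

lemma locally_convergent_const: "continuous_on UNIV f \<Longrightarrow> locally_convergent (\<lambda>n. f)"
  by (rule locally_convergentI[of _ f]) (auto simp: uniform_limit_const)

lemma locally_convergent_add:
  assumes u: "locally_convergent u" and v: "locally_convergent v"
  shows "locally_convergent (\<lambda>n z. u n z + v n z)"
proof -
  obtain l m where "\<And>K. compact K \<Longrightarrow> uniform_limit K u l sequentially"
    "\<And>K. compact K \<Longrightarrow> uniform_limit K v m sequentially"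
    using u v by (auto simp: locally_convergent_def)
  then show ?thesis
    using locally_convergent_continuous[OF u] locally_convergent_continuous[OF v]
    by (intro locally_convergentI[of _ "\<lambda>z. l z + m z"] continuous_on_add uniform_limit_add) auto
qed

lemma locally_convergent_mult:
  assumes u: "locally_convergent u" and v: "locally_convergent v"
  shows "locally_convergent (\<lambda>n z. u n z * v n z)"
proof -
  obtain l where l: "continuous_on UNIV l" "\<And>K. compact K \<Longrightarrow> uniform_limit K u l sequentially"
    using locally_convergentE[OF u] by blast
  obtain m where m: "continuous_on UNIV m" "\<And>K. compact K \<Longrightarrow> uniform_limit K v m sequentially"
    using locally_convergentE[OF v] by blast
  show ?thesis
    using locally_convergent_continuous[OF u] locally_convergent_continuous[OF v] l m
    by (intro locally_convergentI[of _ "\<lambda>z. l z * m z"] continuous_on_mult uniform_lim_mult bounded_image_continuous) auto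
qed

lemma locally_convergent_compose:
  fixes F :: "real \<Rightarrow> real"
  assumes u: "locally_convergent u" and F: "continuous_on UNIV F"
  shows "locally_convergent (\<lambda>n z. F (u n z))"
proof -
  obtain l where l: "continuous_on UNIV l" "\<And>K. compact K \<Longrightarrow> uniform_limit K u l sequentially"
    using locally_convergentE[OF u] by blast
  show ?thesis
  proof (rule locally_convergentI)
    show "continuous_on UNIV (\<lambda>z. F (u n z))" for n
      using continuous_on_compose2[OF F locally_convergent_continuous[OF u]] by auto
    fix K :: "'a set" assume K: "compact K"
    obtain B where "B \<ge> 0" and B: "\<And>n z. z \<in> K \<Longrightarrow> \<bar>u n z\<bar> \<le> B" using locally_convergent_bounded[OF u K] by metis
    obtain C where C: "\<And>z. z \<in> K \<Longrightarrow> \<bar>l z\<bar> \<le> C" using bounded_image_continuous[OF l(1) K] by (auto simp: bounded_iff)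
    let ?S = "{- max B C..max B C}"
    have "uniformly_continuous_on ?S F"
      by (rule compact_uniformly_continuous[OF continuous_on_subset[OF F]]) auto
    then have uc: "\<exists>d>0. \<forall>x\<in>?S. \<forall>y\<in>?S. dist y x < d \<longrightarrow> dist (F y) (F x) < e" if "e > 0" for e
      using that by (auto simp: uniformly_continuous_on_def)
    show "uniform_limit K (\<lambda>n z. F (u n z)) (\<lambda>z. F (l z)) sequentially"
      unfolding uniform_limit_iff
    proof (intro allI impI)
      fix e :: real assume "e > 0"
      then obtain d where d: "d > 0" "\<And>x y. x \<in> ?S \<Longrightarrow> y \<in> ?S \<Longrightarrow> dist y x < d \<Longrightarrow> dist (F y) (F x) < e"
        using uc by blast
      have "\<forall>\<^sub>F n in sequentially. \<forall>z\<in>K. dist (u n z) (l z) < d"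
        using l(2)[OF K] d(1) by (simp add: uniform_limit_iff)
      then show "\<forall>\<^sub>F n in sequentially. \<forall>z\<in>K. dist (F (u n z)) (F (l z)) < e"
      proof eventually_elim
        case (elim n)
        show ?case
        proof
          fix z assume z: "z \<in> K"
          have "u n z \<in> ?S" "l z \<in> ?S" using B[OF z, of n] C[OF z] by auto
          then show "dist (F (u n z)) (F (l z)) < e" using elim z by (intro d(2)) auto
        qed
      qed
    qed
  qed
qed

lemma locally_convergent_sum:
  "(\<And>i. i \<in> I \<Longrightarrow> locally_convergent (u i)) \<Longrightarrow> locally_convergent (\<lambda>n z. \<Sum>i\<in>I. u i n z)"
  by (induction I rule: infinite_finite_induct) (auto intro: locally_convergent_add locally_convergent_const)

lemma (in linear_superposition) locally_convergent_superpose: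
  assumes a: "weight a" and u: "locally_convergent u"
  shows "locally_convergent (\<lambda>n. superpose a (u n))"
proof -
  obtain l where l: "continuous_on UNIV l" "\<And>K. compact K \<Longrightarrow> uniform_limit K u l sequentially"
    using locally_convergentE[OF u] by blast
  note uc = locally_convergent_continuous[OF u]
  obtain c where c: "AE q in M. \<bar>a q\<bar> \<le> c" using a by (auto simp: weight_def)
  show ?thesis
  proof (rule locally_convergentI)
    show "continuous_on UNIV (superpose a (u n))" for n by (rule superpose_continuous[OF a uc])
    fix K :: "'a set" assume "compact K"
    then obtain R where R: "\<And>y. y \<in> K \<Longrightarrow> norm y \<le> R" using compact_imp_bounded[of K] by (auto simp: bounded_iff)
    let ?m = "\<bar>c\<bar> * measure M (space M) + 1"
    have m: "?m > 0" by (intro add_nonneg_pos mult_nonneg_nonneg) auto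
    show "uniform_limit K (\<lambda>n. superpose a (u n)) (superpose a l) sequentially"
      unfolding uniform_limit_iff
    proof (intro allI impI)
      fix e :: real assume e: "e > 0"
      have "\<forall>\<^sub>F n in sequentially. \<forall>z\<in>cball 0 (\<bar>C\<bar> * \<bar>R\<bar>). dist (u n z) (l z) < e / ?m"
        using l(2)[of "cball 0 (\<bar>C\<bar> * \<bar>R\<bar>)"] divide_pos_pos[OF e m] by (simp add: uniform_limit_iff)
      then show "\<forall>\<^sub>F n in sequentially. \<forall>y\<in>K. dist (superpose a (u n) y) (superpose a l y) < e"
      proof eventually_elim
        case (elim n)
        show ?case
        proof
          fix y assume y: "y \<in> K"
          let ?r = "\<lambda>q. a q * (u n (A q y) - l (A q y))"
          have int: "integrable M ?r" by (intro superpose_integrable a continuous_on_diff uc l)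
          have "superpose a (u n) y - superpose a l y = superpose a (\<lambda>z. u n z - l z) y"
            by (rule superpose_diff[symmetric, OF a uc l(1)])
          then have "\<bar>superpose a (u n) y - superpose a l y\<bar> \<le> (\<integral>q. \<bar>?r q\<bar> \<partial>M)"
            by (simp add: superpose_def)
          also have "\<dots> \<le> (\<integral>q. \<bar>c\<bar> * (e / ?m) \<partial>M)"
          proof (rule integral_mono_AE)
            show "AE q in M. \<bar>?r q\<bar> \<le> \<bar>c\<bar> * (e / ?m)"
              using c bound
            proof eventually_elim
              case q: (elim q)
              have "norm (A q y) \<le> C * norm y" using q(2) by blast
              also have "\<dots> \<le> \<bar>C\<bar> * \<bar>R\<bar>" using R[OF y] by (intro mult_mono) auto
              finally have "\<bar>u n (A q y) - l (A q y)\<bar> \<le> e / ?m"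
                using elim by (auto simp: dist_real_def intro!: less_imp_le)
              then show ?case using q(1) unfolding abs_mult by (intro mult_mono) auto
            qed
          qed (use int in auto)
          also have "\<dots> = e * ((\<bar>c\<bar> * measure M (space M)) / ?m)" by simp
          also have "\<dots> < e * 1" using e m by (intro mult_strict_left_mono) auto
          finally show "dist (superpose a (u n) y) (superpose a l y) < e" by (simp add: dist_real_def)
        qed
      qed
    qed
  qed
qed

primrec Ck_convergent :: "nat \<Rightarrow> (nat \<Rightarrow> 'a::euclidean_space \<Rightarrow> real) \<Rightarrow> bool" where
  "Ck_convergent 0 u \<longleftrightarrow> locally_convergent u"
| "Ck_convergent (Suc k) u \<longleftrightarrow> locally_convergent u \<and> (\<forall>n x. u n differentiable (at x)) \<and>
    (\<forall>v. Ck_convergent k (\<lambda>n. dir_deriv v (u n)))"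

text \<open>If the derivatives converge locally uniformly, then limit and derivative may be interchanged on
  every ball.\<close>

lemma Ck_convergent_limit:
  assumes "Ck_convergent k u" and "\<And>K. compact K \<Longrightarrow> uniform_limit K u l sequentially"
  shows "Ck k l"
  using assms
proof (induction k arbitrary: u l)
  case 0
  then have "locally_convergent u" by simp
  then obtain m where m: "continuous_on UNIV m" "\<And>K. compact K \<Longrightarrow> uniform_limit K u m sequentially"
    by (rule locally_convergentE) blast
  have "l x = m x" for x
  proof (rule tendsto_unique)
    show "(\<lambda>n. u n x) \<longlonglongrightarrow> l x" by (rule tendsto_uniform_limitI[OF 0(2)[of "{x}"]]) auto
    show "(\<lambda>n. u n x) \<longlonglongrightarrow> m x" by (rule tendsto_uniform_limitI[OF m(2)[of "{x}"]]) auto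
  qed simp
  then have "l = m" by blast
  then show ?case using m by simp
next
  case (Suc k)
  have "locally_convergent (\<lambda>n. dir_deriv v (u n))" for v
    using Suc.prems(1) by (cases k) auto
  then have "\<exists>m. \<forall>K. compact K \<longrightarrow> uniform_limit K (\<lambda>n. dir_deriv v (u n)) m sequentially" for v
    by (simp add: locally_convergent_def)
  then obtain L where L: "\<And>v K. compact K \<Longrightarrow> uniform_limit K (\<lambda>n. dir_deriv v (u n)) (L v) sequentially"
    by metis
  have CL: "Ck k (L v)" for v
    by (rule Suc.IH[OF _ L]) (use Suc.prems(1) in simp)
  show ?case
  proof (rule Ck_SucI)
    show "Ck k (\<lambda>x. \<Sum>b\<in>Basis. (v \<bullet> b) * L b x)" for v by (intro Ck_sum Ck_cmult CL)
    fix x :: 'a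
    let ?S = "cball x 1"
    have d: "u n differentiable (at y)" for n y using Suc.prems(1) by simp
    have "\<exists>g. \<forall>y\<in>?S. (\<lambda>n. u n y) \<longlonglongrightarrow> g y \<and> (g has_derivative (\<lambda>h. \<Sum>b\<in>Basis. (h \<bullet> b) * L b y)) (at y within ?S)"
    proof (rule has_derivative_sequence[where f = u and f' = "\<lambda>n y h. dir_deriv h (u n) y"])
      show "x \<in> ?S" by simp
      show "(u n has_derivative (\<lambda>h. dir_deriv h (u n) y)) (at y within ?S)" for n y
        by (rule has_derivative_at_withinI[OF has_derivative_dir_deriv[OF d]])
      show "(\<lambda>n. u n x) \<longlonglongrightarrow> l x"
        by (rule tendsto_uniform_limitI[OF Suc.prems(2)[of "{x}"]]) auto
      fix e :: real assume e: "e > 0"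
      let ?n = "real (card (Basis :: 'a set))"
      have n: "?n > 0" by simp
      have "\<forall>\<^sub>F n in sequentially. \<forall>b\<in>Basis. \<forall>y\<in>?S. dist (dir_deriv b (u n) y) (L b y) < e / ?n"
        using L[of ?S] divide_pos_pos[OF e n] by (intro eventually_ball_finite) (auto simp: uniform_limit_iff)
      then show "\<forall>\<^sub>F n in sequentially. \<forall>y\<in>?S. \<forall>h. norm (dir_deriv h (u n) y - (\<Sum>b\<in>Basis. (h \<bullet> b) * L b y)) \<le> e * norm h"
      proof eventually_elim
        case (elim n)
        show ?case
        proof (intro ballI allI)
          fix y h assume y: "y \<in> ?S"
          have "\<bar>dir_deriv h (u n) y - (\<Sum>b\<in>Basis. (h \<bullet> b) * L b y)\<bar> = \<bar>\<Sum>b\<in>Basis. (h \<bullet> b) * (dir_deriv b (u n) y - L b y)\<bar>"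
            by (simp add: dir_deriv_basis[OF d, of h] sum_subtractf algebra_simps)
          also have "\<dots> \<le> (\<Sum>b\<in>(Basis :: 'a set). norm h * (e / ?n))"
          proof (intro order_trans[OF sum_abs] sum_mono)
            fix b :: 'a assume b: "b \<in> Basis"
            have "\<bar>dir_deriv b (u n) y - L b y\<bar> \<le> e / ?n" using elim b y by (auto simp: dist_real_def intro: less_imp_le)
            then show "\<bar>(h \<bullet> b) * (dir_deriv b (u n) y - L b y)\<bar> \<le> norm h * (e / ?n)"
              unfolding abs_mult using Basis_le_norm[OF b, of h] e by (intro mult_mono) auto
          qed
          also have "\<dots> = e * norm h" using n by simp
          finally show "norm (dir_deriv h (u n) y - (\<Sum>b\<in>Basis. (h \<bullet> b) * L b y)) \<le> e * norm h" by simp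
        qed
      qed
    qed auto
    then obtain g where g: "\<And>y. y \<in> ?S \<Longrightarrow> (\<lambda>n. u n y) \<longlonglongrightarrow> g y"
      "\<And>y. y \<in> ?S \<Longrightarrow> (g has_derivative (\<lambda>h. \<Sum>b\<in>Basis. (h \<bullet> b) * L b y)) (at y within ?S)"
      by blast
    have "l y = g y" if "y \<in> ?S" for y
    proof (rule tendsto_unique[OF _ _ g(1)[OF that]])
      show "(\<lambda>n. u n y) \<longlonglongrightarrow> l y" by (rule tendsto_uniform_limitI[OF Suc.prems(2)[of "{y}"]]) auto
    qed simp
    then have "(l has_derivative (\<lambda>h. \<Sum>b\<in>Basis. (h \<bullet> b) * L b x)) (at x within ?S)"
      using has_derivative_transform[of x ?S l g] g(2)[of x] by simp
    moreover have "at x within ?S = at x" by (rule at_within_interior) (simp add: interior_cball)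
    ultimately show "(l has_derivative (\<lambda>v. \<Sum>b\<in>Basis. (v \<bullet> b) * L b x)) (at x)" by simp
  qed
qed

section \<open>Contraction in a weighted norm\<close>

text \<open>Compact sets that absorb backward light cones.\<close>

definition diamond :: "real \<Rightarrow> spacetime set"
  where "diamond T = {z. \<bar>fst z\<bar> + norm (snd z) \<le> T}"

lemma compact_diamond: "compact (diamond T)"
proof (rule compact_eq_bounded_closed[THEN iffD2], intro conjI)
  have "norm z \<le> T" if "z \<in> diamond T" for z
    using that norm_Pair_le[of "fst z" "snd z"] by (simp add: diamond_def)
  then have "\<forall>z\<in>diamond T. norm z \<le> T" by blast
  then show "bounded (diamond T)" unfolding bounded_iff by blast
  show "closed (diamond T)" unfolding diamond_def by (intro closed_Collect_le continuous_intros)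
qed

lemma diamond_time: "z \<in> diamond T \<Longrightarrow> \<bar>fst z\<bar> \<le> T"
  unfolding diamond_def mem_Collect_eq using norm_ge_zero[of "snd z"] by linarith

lemma compact_subset_diamond:
  assumes "compact K" obtains T where "T > 0" "K \<subseteq> diamond T"
proof -
  obtain R where R: "\<And>z. z \<in> K \<Longrightarrow> norm z \<le> R"
    using compact_imp_bounded[OF assms] by (auto simp: bounded_iff)
  show ?thesis
  proof (rule that[of "2 * \<bar>R\<bar> + 1"])
    show "K \<subseteq> diamond (2 * \<bar>R\<bar> + 1)"
    proof
      fix z assume "z \<in> K"
      then show "z \<in> diamond (2 * \<bar>R\<bar> + 1)"
        using R[of z] norm_fst_le[of "fst z" "snd z"] norm_snd_le[of "snd z" "fst z"] by (simp add: diamond_def)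
    qed
  qed simp
qed

text \<open>The backward light cone of a point of a diamond stays in the diamond, so there the Duhamel
  operator involves no values from outside.\<close>

lemma AE_cone_point_diamond:
  assumes "z \<in> diamond T"
  shows "AE q in cone_measure. cone_point q z \<in> diamond T"
  using AE_cone_measure
proof eventually_elim
  case (elim q)
  have "norm (snd z + (fst q * fst z) *\<^sub>R snd q) \<le> norm (snd z) + fst q * \<bar>fst z\<bar>"
    using norm_triangle_ineq[of "snd z" "(fst q * fst z) *\<^sub>R snd q"] elim by (simp add: abs_mult)
  moreover have "\<bar>(1 - fst q) * fst z\<bar> = (1 - fst q) * \<bar>fst z\<bar>" using elim by (simp add: abs_mult)
  ultimately show ?case using assms by (simp add: diamond_def cone_point_def algebra_simps)
qed

text \<open>An exponential weight in time makes the Duhamel integral a small operator: the factor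
  \<open>fst q\<close> of the integrand is compensated by the decay of the weight along the cone.\<close>

lemma weighted_cone_bound:
  assumes a: "cone.weight a" and aA: "AE q in cone_measure. \<bar>a q\<bar> \<le> A * fst q" and A: "A \<ge> 0"
    and w: "continuous_on UNIV w" and D: "D \<ge> 0" and \<kappa>: "\<kappa> > 0"
    and bound: "\<And>z. z \<in> diamond T \<Longrightarrow> \<bar>w z\<bar> \<le> D * exp (\<kappa> * \<bar>fst z\<bar>)" and z: "z \<in> diamond T"
  shows "\<bar>(fst z)\<^sup>2 * cone.superpose a w z\<bar> \<le> A * (T / \<kappa>) * D * exp (\<kappa> * \<bar>fst z\<bar>)"
proof -
  let ?t = "\<bar>fst z\<bar>"
  have tT: "?t \<le> T" by (rule diamond_time[OF z])
  have int: "integrable cone_measure (\<lambda>q. a q * w (cone_point q z))" by (rule cone.superpose_integrable[OF a w])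
  have "\<bar>(fst z)\<^sup>2 * cone.superpose a w z\<bar> = \<bar>\<integral>q. ?t\<^sup>2 * (a q * w (cone_point q z)) \<partial>cone_measure\<bar>"
    by (simp add: cone.superpose_def)
  also have "\<dots> \<le> (\<integral>q. \<bar>?t\<^sup>2 * (a q * w (cone_point q z))\<bar> \<partial>cone_measure)" by (rule integral_abs_bound)
  also have "\<dots> \<le> (\<integral>q. A * (T / \<kappa>) * D * exp (\<kappa> * ?t) \<partial>cone_measure)"
  proof (rule integral_mono_AE)
    show "AE q in cone_measure. \<bar>?t\<^sup>2 * (a q * w (cone_point q z))\<bar> \<le> A * (T / \<kappa>) * D * exp (\<kappa> * ?t)"
      using AE_cone_measure AE_cone_point_diamond[OF z] aA
    proof eventually_elim
      case (elim q)
      let ?s = "fst q"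
      have s: "0 \<le> ?s" "?s \<le> 1" using elim by auto
      have "\<bar>w (cone_point q z)\<bar> \<le> D * exp (\<kappa> * \<bar>fst (cone_point q z)\<bar>)" by (rule bound) (use elim in simp)
      also have "\<bar>fst (cone_point q z)\<bar> = (1 - ?s) * ?t" using s by (simp add: cone_point_def abs_mult)
      also have "\<kappa> * ((1 - ?s) * ?t) = \<kappa> * ?t + - (\<kappa> * (?s * ?t))" by (simp add: algebra_simps)
      finally have w': "\<bar>w (cone_point q z)\<bar> \<le> D * exp (\<kappa> * ?t) * exp (- (\<kappa> * (?s * ?t)))"
        by (simp only: exp_add mult.assoc)
      have "\<kappa> * (?s * ?t) \<le> exp (\<kappa> * (?s * ?t))"
        using exp_ge_add_one_self[of "\<kappa> * (?s * ?t)"] by linarith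
      then have "\<kappa> * (?s * ?t) * exp (- (\<kappa> * (?s * ?t))) \<le> 1"
        by (simp add: exp_minus divide_simps)
      then have "?s * ?t * exp (- (\<kappa> * (?s * ?t))) \<le> 1 / \<kappa>" using \<kappa> by (simp add: field_simps)
      then have "?t * (?s * ?t * exp (- (\<kappa> * (?s * ?t)))) \<le> T * (1 / \<kappa>)"
        using tT s \<kappa> by (intro mult_mono) auto
      then have e: "?t\<^sup>2 * ?s * exp (- (\<kappa> * (?s * ?t))) \<le> T / \<kappa>" by (simp add: power2_eq_square mult_ac)
      have "\<bar>?t\<^sup>2 * (a q * w (cone_point q z))\<bar> = ?t\<^sup>2 * (\<bar>a q\<bar> * \<bar>w (cone_point q z)\<bar>)" by (simp add: abs_mult)
      also have "\<dots> \<le> ?t\<^sup>2 * ((A * ?s) * (D * exp (\<kappa> * ?t) * exp (- (\<kappa> * (?s * ?t)))))"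
        using elim w' A s by (intro mult_left_mono mult_mono) auto
      also have "\<dots> = (?t\<^sup>2 * ?s * exp (- (\<kappa> * (?s * ?t)))) * (A * D * exp (\<kappa> * ?t))" by (simp only: mult_ac)
      also have "\<dots> \<le> (T / \<kappa>) * (A * D * exp (\<kappa> * ?t))" using e A D by (intro mult_right_mono) auto
      finally show ?case by (simp only: mult_ac)
    qed
  qed (use int in auto)
  also have "\<dots> = A * (T / \<kappa>) * D * exp (\<kappa> * ?t)" by (simp add: cone_prob.prob_space[simplified])
  finally show ?thesis .
qed

text \<open>The error \<open>e\<close> becomes arbitrarily small for late iterates, so \<open>k\<close> further steps bound their
  differences by \<open>2 e + B / 2\<^sup>k\<close>. Allowing such an error, which need not be summable, is what lets
  sources and coefficients converge without a rate.\<close>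

lemma contraction_locally_convergent:
  fixes X :: "nat \<Rightarrow> 'i \<Rightarrow> spacetime \<Rightarrow> real"
  assumes cont: "\<And>n i. i \<in> I \<Longrightarrow> continuous_on UNIV (X n i)"
    and bounded: "\<And>T. T > 0 \<Longrightarrow> \<exists>B. \<forall>n. \<forall>i\<in>I. \<forall>z\<in>diamond T. \<bar>X n i z\<bar> \<le> B"
    and contr: "\<And>T. T > 0 \<Longrightarrow> \<exists>\<kappa>>0. \<forall>e>0. \<exists>N. \<forall>n\<ge>N. \<forall>m\<ge>N. \<forall>D\<ge>0.
      (\<forall>i\<in>I. \<forall>z\<in>diamond T. \<bar>X n i z - X m i z\<bar> \<le> D * exp (\<kappa> * \<bar>fst z\<bar>)) \<longrightarrow>
      (\<forall>i\<in>I. \<forall>z\<in>diamond T. \<bar>X (Suc n) i z - X (Suc m) i z\<bar> \<le> (e + D / 2) * exp (\<kappa> * \<bar>fst z\<bar>))"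
    and i: "i \<in> I"
  shows "locally_convergent (\<lambda>n. X n i)"
proof -
  have conv: "uniformly_convergent_on (diamond T) (\<lambda>n. X n i)" if T: "T > 0" for T
  proof (rule Cauchy_uniformly_convergent, rule uniformly_Cauchy_onI)
    fix \<epsilon> :: real assume \<epsilon>: "\<epsilon> > 0"
    obtain B where B: "\<And>n i z. i \<in> I \<Longrightarrow> z \<in> diamond T \<Longrightarrow> \<bar>X n i z\<bar> \<le> B" using bounded[OF T] by blast
    obtain \<kappa> where \<kappa>: "\<kappa> > 0" "\<forall>e>0. \<exists>N. \<forall>n\<ge>N. \<forall>m\<ge>N. \<forall>D\<ge>0.
      (\<forall>i\<in>I. \<forall>z\<in>diamond T. \<bar>X n i z - X m i z\<bar> \<le> D * exp (\<kappa> * \<bar>fst z\<bar>)) \<longrightarrow>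
      (\<forall>i\<in>I. \<forall>z\<in>diamond T. \<bar>X (Suc n) i z - X (Suc m) i z\<bar> \<le> (e + D / 2) * exp (\<kappa> * \<bar>fst z\<bar>))"
      using contr[OF T] by blast
    define E where "E = exp (\<kappa> * T)"
    have E: "E > 0" by (simp add: E_def)
    define e where "e = \<epsilon> / (6 * E)"
    have e: "e > 0" using \<epsilon> E by (simp add: e_def)
    obtain N where N: "\<And>n m D. n \<ge> N \<Longrightarrow> m \<ge> N \<Longrightarrow> D \<ge> 0 \<Longrightarrow>
      (\<forall>i\<in>I. \<forall>z\<in>diamond T. \<bar>X n i z - X m i z\<bar> \<le> D * exp (\<kappa> * \<bar>fst z\<bar>)) \<Longrightarrow>
      (\<forall>i\<in>I. \<forall>z\<in>diamond T. \<bar>X (Suc n) i z - X (Suc m) i z\<bar> \<le> (e + D / 2) * exp (\<kappa> * \<bar>fst z\<bar>))"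
      using \<kappa>(2) e by meson
    define B' where "B' = 2 * \<bar>B\<bar>"
    have step: "\<forall>i\<in>I. \<forall>z\<in>diamond T. \<bar>X (n + k) i z - X (m + k) i z\<bar> \<le> (2 * e + B' / 2 ^ k) * exp (\<kappa> * \<bar>fst z\<bar>)"
      if nm: "n \<ge> N" "m \<ge> N" for n m k
    proof (induction k)
      case 0
      show ?case
      proof (intro ballI)
        fix i z assume iz: "i \<in> I" "z \<in> diamond T"
        have "\<bar>X n i z - X m i z\<bar> \<le> B'" using B[OF iz, of n] B[OF iz, of m] unfolding B'_def by linarith
        also have "\<dots> \<le> (2 * e + B') * 1" using e by simp
        also have "\<dots> \<le> (2 * e + B') * exp (\<kappa> * \<bar>fst z\<bar>)"
          using e \<kappa> by (intro mult_left_mono) (auto simp: B'_def)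
        finally show "\<bar>X (n + 0) i z - X (m + 0) i z\<bar> \<le> (2 * e + B' / 2 ^ 0) * exp (\<kappa> * \<bar>fst z\<bar>)" by simp
      qed
    next
      case (Suc k)
      have "0 \<le> 2 * e + B' / 2 ^ k" using e by (auto simp: B'_def intro!: add_nonneg_nonneg)
      from N[OF _ _ this Suc.IH] nm
      have "\<forall>i\<in>I. \<forall>z\<in>diamond T. \<bar>X (Suc (n + k)) i z - X (Suc (m + k)) i z\<bar> \<le> (e + (2 * e + B' / 2 ^ k) / 2) * exp (\<kappa> * \<bar>fst z\<bar>)"
        by simp
      moreover have "e + (2 * e + B' / 2 ^ k) / 2 = 2 * e + B' / 2 ^ Suc k" by (simp add: field_simps)
      ultimately show ?case by simp
    qed
    obtain k where k: "B' / e < 2 ^ k" using real_arch_pow[of 2 "B' / e"] by auto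
    then have "B' / 2 ^ k < e" using e by (simp add: field_simps)
    show "\<exists>M. \<forall>z\<in>diamond T. \<forall>m\<ge>M. \<forall>n\<ge>M. dist (X m i z) (X n i z) < \<epsilon>"
    proof (intro exI[of _ "N + k"] ballI allI impI)
      fix z m n assume z: "z \<in> diamond T" and mn: "N + k \<le> m" "N + k \<le> n"
      have tT: "\<bar>fst z\<bar> \<le> T" by (rule diamond_time[OF z])
      have "\<bar>X (m - k + k) i z - X (n - k + k) i z\<bar> \<le> (2 * e + B' / 2 ^ k) * exp (\<kappa> * \<bar>fst z\<bar>)"
        using step[of "m - k" "n - k" k] mn i z by simp
      also have "\<dots> \<le> (3 * e) * E"
        unfolding E_def using \<open>B' / 2 ^ k < e\<close> \<kappa> tT e by (intro mult_mono) auto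
      also have "\<dots> < \<epsilon>" using \<epsilon> E by (simp add: e_def)
      finally show "dist (X m i z) (X n i z) < \<epsilon>" using mn by (simp add: dist_real_def)
    qed
  qed
  show ?thesis
  proof (rule locally_convergentI[where l = "\<lambda>z. lim (\<lambda>n. X n i z)"])
    fix K :: "spacetime set" assume "compact K"
    then obtain T where T: "T > 0" "K \<subseteq> diamond T" by (rule compact_subset_diamond)
    from conv[OF T(1)] have "uniform_limit (diamond T) (\<lambda>n. X n i) (\<lambda>z. lim (\<lambda>n. X n i z)) sequentially"
      by (simp add: uniformly_convergent_uniform_limit_iff)
    then show "uniform_limit K (\<lambda>n. X n i) (\<lambda>z. lim (\<lambda>n. X n i z)) sequentially"
      using T(2) by (rule uniform_limit_on_subset)
  qed (rule cont[OF i])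
qed

lemma locally_convergent_Cauchy:
  assumes "locally_convergent u" "compact K" "e > 0"
  shows "\<exists>N. \<forall>n\<ge>N. \<forall>m\<ge>N. \<forall>z\<in>K. \<bar>u n z - u m z\<bar> \<le> e"
proof -
  have "uniformly_convergent_on K u"
    using assms by (auto simp: locally_convergent_def uniformly_convergent_on_def)
  then have "uniformly_Cauchy_on K u" by (rule uniformly_convergent_Cauchy)
  then show ?thesis using assms(3) unfolding uniformly_Cauchy_on_def dist_real_def
    by (meson less_imp_le)
qed

lemma uniform_Cauchy_finite:
  assumes I: "finite I" and S: "\<And>i. i \<in> I \<Longrightarrow> locally_convergent (u i)" and K: "compact K" and e: "e > 0"
  shows "\<exists>N. \<forall>n\<ge>N. \<forall>m\<ge>N. \<forall>i\<in>I. \<forall>z\<in>K. \<bar>u i n z - u i m z\<bar> \<le> e"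
proof -
  have "\<forall>i\<in>I. \<exists>N. \<forall>n\<ge>N. \<forall>m\<ge>N. \<forall>z\<in>K. \<bar>u i n z - u i m z\<bar> \<le> e"
    using locally_convergent_Cauchy[OF S K e] by blast
  then obtain N where N: "\<And>i n m z. i \<in> I \<Longrightarrow> n \<ge> N i \<Longrightarrow> m \<ge> N i \<Longrightarrow> z \<in> K \<Longrightarrow> \<bar>u i n z - u i m z\<bar> \<le> e"
    by metis
  have "N i \<le> Max (insert 0 (N ` I))" if "i \<in> I" for i using I that by (intro Max_ge) auto
  then show ?thesis using N by (meson order_trans)
qed

lemma uniform_bound_finite:
  assumes I: "finite I" and S: "\<And>i. i \<in> I \<Longrightarrow> locally_convergent (u i)" and K: "compact K"
  obtains B where "B \<ge> 0" "\<And>i n z. i \<in> I \<Longrightarrow> z \<in> K \<Longrightarrow> \<bar>u i n z\<bar> \<le> B"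
proof -
  have "\<exists>B\<ge>0. \<forall>n. \<forall>z\<in>K. \<bar>u i n z\<bar> \<le> B" if "i \<in> I" for i
    using locally_convergent_bounded[OF S[OF that] K] by metis
  then obtain b where b: "\<And>i. i \<in> I \<Longrightarrow> b i \<ge> 0" "\<And>i n z. i \<in> I \<Longrightarrow> z \<in> K \<Longrightarrow> \<bar>u i n z\<bar> \<le> b i"
    by metis
  have "b i \<le> Max (insert 0 (b ` I))" if "i \<in> I" for i using I that by (intro Max_ge) auto
  moreover have "0 \<le> Max (insert 0 (b ` I))" using I by (intro Max_ge) auto
  ultimately show ?thesis using b by (intro that[of "Max (insert 0 (b ` I))"]) (blast intro: order_trans)+
qed

text \<open>Iterating a linear system of Duhamel type converges, even if its coefficients and sources
  change with the step, as long as these converge themselves.\<close>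

lemma linear_iteration_convergent:
  fixes X :: "nat \<Rightarrow> 'i \<Rightarrow> spacetime \<Rightarrow> real"
  assumes I: "finite I" and a: "\<And>i j. i \<in> I \<Longrightarrow> j \<in> I \<Longrightarrow> cone.weight (a i j)"
    and aA: "\<And>i j. i \<in> I \<Longrightarrow> j \<in> I \<Longrightarrow> AE q in cone_measure. \<bar>a i j q\<bar> \<le> A * fst q" and A: "A \<ge> 0"
    and S: "\<And>i. i \<in> I \<Longrightarrow> locally_convergent (\<lambda>n. S n i)" and c: "locally_convergent c"
    and X0: "\<And>i. i \<in> I \<Longrightarrow> continuous_on UNIV (X 0 i)"
    and X: "\<And>n i z. i \<in> I \<Longrightarrow> X (Suc n) i z = S n i z +
      (\<Sum>j\<in>I. (fst z)\<^sup>2 * cone.superpose (a i j) (\<lambda>z. c n z * X n j z) z)"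
    and i: "i \<in> I"
  shows "locally_convergent (\<lambda>n. X n i)"
proof -
  have cc: "continuous_on UNIV (c n)" for n by (rule locally_convergent_continuous[OF c])
  have Sc: "continuous_on UNIV (S n i)" if "i \<in> I" for n i by (rule locally_convergent_continuous[OF S[OF that]])
  have Xc: "continuous_on UNIV (X n i)" if "i \<in> I" for n i
    using that
  proof (induction n arbitrary: i)
    case (Suc n)
    have e: "X (Suc n) i = (\<lambda>z. S n i z + (\<Sum>j\<in>I. (fst z)\<^sup>2 * cone.superpose (a i j) (\<lambda>z. c n z * X n j z) z))"
      by (rule ext) (rule X[OF Suc.prems])
    show ?case unfolding e
      by (intro continuous_on_add continuous_on_sum continuous_on_mult continuous_on_power continuous_on_fst continuous_on_id
        cone.superpose_continuous a cc Sc Suc)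
  qed (rule X0)
  define L where "L = real (card I) + 1"
  have L: "L > 0" "real (card I) \<le> L" by (simp_all add: L_def add_nonneg_pos)
  \<comment> \<open>The weight \<open>\<kappa>\<close> is so large that all terms of the sum together keep only half of \<open>D / C\<close>.\<close>
  have pair: "\<bar>\<Sum>j\<in>I. (fst z)\<^sup>2 * cone.superpose (a i j) (w j) z\<bar> \<le> D / 2 / C * exp (\<kappa> * \<bar>fst z\<bar>)"
    if i: "i \<in> I" and w: "\<And>j. j \<in> I \<Longrightarrow> continuous_on UNIV (w j)" and D: "D \<ge> 0" and C: "C > 0" and T: "T > 0"
      and \<kappa>: "\<kappa> = 2 * L * (A + 1) * C * T" and z: "z \<in> diamond T"
      and b: "\<And>j z. j \<in> I \<Longrightarrow> z \<in> diamond T \<Longrightarrow> \<bar>w j z\<bar> \<le> D * exp (\<kappa> * \<bar>fst z\<bar>)" for i w D C T \<kappa> z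
  proof -
    have \<kappa>0: "\<kappa> > 0" unfolding \<kappa> using L A C T by simp
    have "\<bar>\<Sum>j\<in>I. (fst z)\<^sup>2 * cone.superpose (a i j) (w j) z\<bar> \<le> (\<Sum>j\<in>I. A * (T / \<kappa>) * D * exp (\<kappa> * \<bar>fst z\<bar>))"
      by (intro order_trans[OF sum_abs] sum_mono weighted_cone_bound[OF a[OF i] aA[OF i] A w D \<kappa>0 b z])
    also have "\<dots> = real (card I) * A * (T / \<kappa> * D * exp (\<kappa> * \<bar>fst z\<bar>))" by (simp add: mult.assoc)
    also have "\<dots> \<le> L * (A + 1) * (T / \<kappa> * D * exp (\<kappa> * \<bar>fst z\<bar>))"
      using L A T \<kappa>0 D by (intro mult_right_mono mult_mono) auto
    also have "\<dots> = (L * (A + 1) * (T / \<kappa>)) * (D * exp (\<kappa> * \<bar>fst z\<bar>))" by (simp only: mult_ac)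
    also have "L * (A + 1) * (T / \<kappa>) = 1 / (2 * C)" unfolding \<kappa> using L A C T by (simp add: divide_simps)
    also have "1 / (2 * C) * (D * exp (\<kappa> * \<bar>fst z\<bar>)) = D / 2 / C * exp (\<kappa> * \<bar>fst z\<bar>)" by simp
    finally show ?thesis .
  qed
  have bound: "\<exists>B. \<forall>n. \<forall>i\<in>I. \<forall>z\<in>diamond T. \<bar>X n i z\<bar> \<le> B" if T: "T > 0" for T
  proof -
    obtain C0 where C0: "C0 \<ge> 0" "\<And>n z. z \<in> diamond T \<Longrightarrow> \<bar>c n z\<bar> \<le> C0"
      using locally_convergent_bounded[OF c compact_diamond] by metis
    define C where "C = C0 + 1"
    have C: "C > 0" "\<And>n z. z \<in> diamond T \<Longrightarrow> \<bar>c n z\<bar> \<le> C"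
      using C0(1) order_trans[OF C0(2), of _ C] by (simp_all add: C_def)
    obtain BS where BS: "BS \<ge> 0" "\<And>i n z. i \<in> I \<Longrightarrow> z \<in> diamond T \<Longrightarrow> \<bar>S n i z\<bar> \<le> BS"
      using uniform_bound_finite[OF I, of "\<lambda>i n. S n i" "diamond T", OF S compact_diamond] by metis
    obtain B0 where B0: "B0 \<ge> 0" "\<And>i z. i \<in> I \<Longrightarrow> z \<in> diamond T \<Longrightarrow> \<bar>X 0 i z\<bar> \<le> B0"
      using uniform_bound_finite[OF I, of "\<lambda>i n. X 0 i" "diamond T", OF locally_convergent_const[OF X0] compact_diamond]
      by metis
    define \<kappa> where "\<kappa> = 2 * L * (A + 1) * C * T"
    have \<kappa>: "\<kappa> > 0" unfolding \<kappa>_def using L A C T by simp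
    define D where "D = B0 + 2 * BS"
    have D: "D \<ge> 0" using B0 BS by (simp add: D_def)
    have step: "\<forall>i\<in>I. \<forall>z\<in>diamond T. \<bar>X n i z\<bar> \<le> D * exp (\<kappa> * \<bar>fst z\<bar>)" for n
    proof (induction n)
      case 0
      have "B0 * 1 \<le> D * exp (\<kappa> * \<bar>fst z\<bar>)" for z :: "spacetime"
        using B0 BS \<kappa> by (intro mult_mono) (auto simp: D_def)
      then show ?case using B0(2) by (fastforce intro: order_trans)
    next
      case (Suc n)
      show ?case
      proof (intro ballI)
        fix i z assume iz: "i \<in> I" "z \<in> diamond T"
        have "\<bar>\<Sum>j\<in>I. (fst z)\<^sup>2 * cone.superpose (a i j) (\<lambda>z. c n z * X n j z) z\<bar> \<le> C * D / 2 / C * exp (\<kappa> * \<bar>fst z\<bar>)"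
        proof (rule pair[OF iz(1) _ _ C(1) T \<kappa>_def iz(2)])
          show "continuous_on UNIV (\<lambda>z. c n z * X n j z)" if "j \<in> I" for j by (intro continuous_on_mult cc Xc that)
          show "\<bar>c n z * X n j z\<bar> \<le> C * D * exp (\<kappa> * \<bar>fst z\<bar>)" if "j \<in> I" "z \<in> diamond T" for j z
            unfolding abs_mult mult.assoc using Suc.IH that C D by (intro mult_mono) auto
        qed (use C D in simp)
        also have "\<dots> = D / 2 * exp (\<kappa> * \<bar>fst z\<bar>)" using C by simp
        finally have 1: "\<bar>\<Sum>j\<in>I. (fst z)\<^sup>2 * cone.superpose (a i j) (\<lambda>z. c n z * X n j z) z\<bar> \<le> D / 2 * exp (\<kappa> * \<bar>fst z\<bar>)" .
        have "BS * 1 \<le> D / 2 * exp (\<kappa> * \<bar>fst z\<bar>)"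
          using BS B0 \<kappa> by (intro mult_mono) (auto simp: D_def)
        then have "\<bar>S n i z\<bar> \<le> D / 2 * exp (\<kappa> * \<bar>fst z\<bar>)" using BS(2)[OF iz, of n] by linarith
        with 1 show "\<bar>X (Suc n) i z\<bar> \<le> D * exp (\<kappa> * \<bar>fst z\<bar>)"
          unfolding X[OF iz(1)] by linarith
      qed
    qed
    have "\<bar>X n i z\<bar> \<le> D * exp (\<kappa> * T)" if "i \<in> I" "z \<in> diamond T" for n i z
    proof -
      have "\<bar>fst z\<bar> \<le> T" by (rule diamond_time[OF that(2)])
      then have "D * exp (\<kappa> * \<bar>fst z\<bar>) \<le> D * exp (\<kappa> * T)" using \<kappa> D by (intro mult_left_mono) auto
      then show ?thesis using step[of n] that by fastforce
    qed
    then show ?thesis by blast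
  qed
  show ?thesis
  proof (rule contraction_locally_convergent[OF Xc bound _ i])
    fix T :: real assume T: "T > 0"
    obtain C0 where C0: "C0 \<ge> 0" "\<And>n z. z \<in> diamond T \<Longrightarrow> \<bar>c n z\<bar> \<le> C0"
      using locally_convergent_bounded[OF c compact_diamond] by metis
    define C where "C = C0 + 1"
    have C: "C \<ge> 1" "\<And>n z. z \<in> diamond T \<Longrightarrow> \<bar>c n z\<bar> \<le> C"
      using C0(1) order_trans[OF C0(2), of _ C] by (simp_all add: C_def)
    obtain B where B: "\<And>n i z. i \<in> I \<Longrightarrow> z \<in> diamond T \<Longrightarrow> \<bar>X n i z\<bar> \<le> B" using bound[OF T] by blast
    define \<kappa> where "\<kappa> = 2 * L * (A + 1) * C * T"
    have \<kappa>: "\<kappa> > 0" unfolding \<kappa>_def using L A C T by simp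
    show "\<exists>\<kappa>>0. \<forall>e>0. \<exists>N. \<forall>n\<ge>N. \<forall>m\<ge>N. \<forall>D\<ge>0.
      (\<forall>i\<in>I. \<forall>z\<in>diamond T. \<bar>X n i z - X m i z\<bar> \<le> D * exp (\<kappa> * \<bar>fst z\<bar>)) \<longrightarrow>
      (\<forall>i\<in>I. \<forall>z\<in>diamond T. \<bar>X (Suc n) i z - X (Suc m) i z\<bar> \<le> (e + D / 2) * exp (\<kappa> * \<bar>fst z\<bar>))"
    proof (intro exI[of _ \<kappa>] conjI allI impI \<kappa>)
      fix e :: real assume e: "e > 0"
      obtain N1 where N1: "\<And>n m i z. n \<ge> N1 \<Longrightarrow> m \<ge> N1 \<Longrightarrow> i \<in> I \<Longrightarrow> z \<in> diamond T \<Longrightarrow> \<bar>S n i z - S m i z\<bar> \<le> e / 2"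
        using uniform_Cauchy_finite[OF I, of "\<lambda>i n. S n i", OF S compact_diamond half_gt_zero[OF e]] by blast
      have e': "e / (\<bar>B\<bar> + 1) > 0" using e by (simp add: add_nonneg_pos)
      obtain N2 where N2: "\<And>n m z. n \<ge> N2 \<Longrightarrow> m \<ge> N2 \<Longrightarrow> z \<in> diamond T \<Longrightarrow> \<bar>c n z - c m z\<bar> \<le> e / (\<bar>B\<bar> + 1)"
        using locally_convergent_Cauchy[OF c compact_diamond e'] by blast
      show "\<exists>N. \<forall>n\<ge>N. \<forall>m\<ge>N. \<forall>D\<ge>0.
        (\<forall>i\<in>I. \<forall>z\<in>diamond T. \<bar>X n i z - X m i z\<bar> \<le> D * exp (\<kappa> * \<bar>fst z\<bar>)) \<longrightarrow>
        (\<forall>i\<in>I. \<forall>z\<in>diamond T. \<bar>X (Suc n) i z - X (Suc m) i z\<bar> \<le> (e + D / 2) * exp (\<kappa> * \<bar>fst z\<bar>))"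
      proof (intro exI[of _ "max N1 N2"] allI impI ballI)
        fix n m D i z
        assume nm: "max N1 N2 \<le> n" "max N1 N2 \<le> m" and D: "(0::real) \<le> D"
          and IH: "\<forall>i\<in>I. \<forall>z\<in>diamond T. \<bar>X n i z - X m i z\<bar> \<le> D * exp (\<kappa> * \<bar>fst z\<bar>)"
          and i: "i \<in> I" and z: "z \<in> diamond T"
        let ?d = "\<lambda>j z. c n z * X n j z - c m z * X m j z"
        have cd: "continuous_on UNIV (\<lambda>z. c n z * X n j z)" if "j \<in> I" for n j by (intro continuous_on_mult cc Xc that)
        have "\<bar>\<Sum>j\<in>I. (fst z)\<^sup>2 * cone.superpose (a i j) (?d j) z\<bar> \<le> C * (D + e) / 2 / C * exp (\<kappa> * \<bar>fst z\<bar>)"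
        proof (rule pair[OF i _ _ _ T \<kappa>_def z])
          show "continuous_on UNIV (?d j)" if "j \<in> I" for j by (intro continuous_on_diff cd that)
          show "\<bar>?d j y\<bar> \<le> C * (D + e) * exp (\<kappa> * \<bar>fst y\<bar>)" if j: "j \<in> I" and y: "y \<in> diamond T" for j y
          proof -
            have "?d j y = c n y * (X n j y - X m j y) + (c n y - c m y) * X m j y" by (simp add: algebra_simps)
            also have "\<bar>\<dots>\<bar> \<le> \<bar>c n y\<bar> * \<bar>X n j y - X m j y\<bar> + \<bar>c n y - c m y\<bar> * \<bar>X m j y\<bar>"
              by (rule order_trans[OF abs_triangle_ineq]) (simp add: abs_mult)
            also have "\<dots> \<le> C * (D * exp (\<kappa> * \<bar>fst y\<bar>)) + e / (\<bar>B\<bar> + 1) * (\<bar>B\<bar> + 1)"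
              using C(2)[OF y] IH N2[of n m y] B[OF j y, of m] nm j y D C(1) e'
              by (intro add_mono mult_mono) auto
            also have "e / (\<bar>B\<bar> + 1) * (\<bar>B\<bar> + 1) = e * 1" by simp
            also have "e * 1 \<le> (C * e) * exp (\<kappa> * \<bar>fst y\<bar>)" using C(1) e \<kappa> by (intro mult_mono) auto
            finally show ?thesis by (simp add: algebra_simps)
          qed
        qed (use C D e in auto)
        also have "\<dots> = (D + e) / 2 * exp (\<kappa> * \<bar>fst z\<bar>)" using C by simp
        finally have 1: "\<bar>\<Sum>j\<in>I. (fst z)\<^sup>2 * cone.superpose (a i j) (?d j) z\<bar> \<le> (D + e) / 2 * exp (\<kappa> * \<bar>fst z\<bar>)" .
        have "e / 2 * 1 \<le> e / 2 * exp (\<kappa> * \<bar>fst z\<bar>)" using e \<kappa> by (intro mult_left_mono) auto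
        then have 2: "\<bar>S n i z - S m i z\<bar> \<le> e / 2 * exp (\<kappa> * \<bar>fst z\<bar>)" using N1[of n m i z] nm i z by simp
        have "X (Suc n) i z - X (Suc m) i z = (S n i z - S m i z) + (\<Sum>j\<in>I. (fst z)\<^sup>2 * cone.superpose (a i j) (?d j) z)"
          unfolding X[OF i] by (simp add: cone.superpose_diff[OF a[OF i] cd cd] sum_subtractf algebra_simps)
        then have "\<bar>X (Suc n) i z - X (Suc m) i z\<bar> \<le> e / 2 * exp (\<kappa> * \<bar>fst z\<bar>) + (D + e) / 2 * exp (\<kappa> * \<bar>fst z\<bar>)"
          using 1 2 by linarith
        also have "\<dots> = (e + D / 2) * exp (\<kappa> * \<bar>fst z\<bar>)" by (simp add: field_simps)
        finally show "\<bar>X (Suc n) i z - X (Suc m) i z\<bar> \<le> (e + D / 2) * exp (\<kappa> * \<bar>fst z\<bar>)" .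
      qed
    qed
  qed
qed

section \<open>Convergence of the Picard iteration\<close>

lemma dir_deriv_time_sq_superpose:
  assumes a: "cone.weight a" and G: "Ck (Suc 0) G"
  shows "dir_deriv v (\<lambda>z. (fst z)\<^sup>2 * cone.superpose a G z) z =
    2 * fst z * fst v * cone.superpose a G z +
    (\<Sum>b\<in>Basis. (fst z)\<^sup>2 * cone.superpose (\<lambda>q. a q * (cone_point q v \<bullet> b)) (dir_deriv b G) z)"
proof -
  have \<Phi>: "Ck (Suc 0) (cone.superpose a G)" by (rule cone.Ck_superpose[OF a G])
  then have t\<Phi>: "Ck (Suc 0) (\<lambda>z. fst z * cone.superpose a G z)" by (intro Ck_mult Ck_fst)
  have "dir_deriv v (\<lambda>z. fst z * (fst z * cone.superpose a G z)) z =
      fst z * (fst z * dir_deriv v (cone.superpose a G) z + fst v * cone.superpose a G z) + fst v * (fst z * cone.superpose a G z)"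
    unfolding dir_deriv_time_mult[OF Ck_differentiable[OF t\<Phi>]] dir_deriv_time_mult[OF Ck_differentiable[OF \<Phi>]] ..
  then show ?thesis
    unfolding cone.dir_deriv_superpose[OF a G]
    by (simp add: power2_eq_square algebra_simps sum_distrib_left)
qed

lemma cone_weight_component:
  assumes a: "cone.weight a" and aA: "AE q in cone_measure. \<bar>a q\<bar> \<le> A * fst q" and A: "A \<ge> 0"
    and b: "b \<in> Basis" "b' \<in> Basis"
  shows "cone.weight (\<lambda>q. a q * (cone_point q b \<bullet> b'))"
    and "AE q in cone_measure. \<bar>a q * (cone_point q b \<bullet> b')\<bar> \<le> 3 * A * fst q"
proof -
  show "cone.weight (\<lambda>q. a q * (cone_point q b \<bullet> b'))" by (intro cone.weight_mult a cone.weight_inner)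
  show "AE q in cone_measure. \<bar>a q * (cone_point q b \<bullet> b')\<bar> \<le> 3 * A * fst q"
    using aA cone.bound AE_cone_measure
  proof eventually_elim
    case (elim q)
    have "\<bar>cone_point q b \<bullet> b'\<bar> \<le> norm (cone_point q b)" by (rule Basis_le_norm[OF b(2)])
    also have "\<dots> \<le> 3 * norm b" using elim(2) by blast
    finally have "\<bar>cone_point q b \<bullet> b'\<bar> \<le> 3" using b(1) by simp
    then have "\<bar>a q * (cone_point q b \<bullet> b')\<bar> \<le> (A * fst q) * 3"
      unfolding abs_mult using elim A by (intro mult_mono) auto
    then show ?case by simp
  qed
qed

lemma Ck_convergent_1I:
  fixes u :: "nat \<Rightarrow> 'a::euclidean_space \<Rightarrow> real"
  assumes u: "locally_convergent u" and d: "\<And>n. Ck (Suc 0) (u n)"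
    and b: "\<And>b. b \<in> Basis \<Longrightarrow> locally_convergent (\<lambda>n. dir_deriv b (u n))"
  shows "Ck_convergent 1 u"
proof -
  have "locally_convergent (\<lambda>n. dir_deriv v (u n))" for v
  proof -
    have "(\<lambda>n. dir_deriv v (u n)) = (\<lambda>n z. \<Sum>b\<in>Basis. (v \<bullet> b) * dir_deriv b (u n) z)"
      by (intro ext dir_deriv_basis Ck_differentiable[OF d])
    then show ?thesis
      by (simp only:) (intro locally_convergent_sum locally_convergent_mult locally_convergent_const b continuous_on_const)
  qed
  then show ?thesis using u d by simp
qed

lemma Ck_convergent_1D:
  fixes u :: "nat \<Rightarrow> 'a::euclidean_space \<Rightarrow> real"
  assumes "Ck_convergent 1 u"
  shows "locally_convergent u" and "locally_convergent (\<lambda>n. dir_deriv v (u n))"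
  using assms by simp_all

lemma locally_convergent_time:
  "locally_convergent (\<lambda>n z. c * fst z)" "locally_convergent (\<lambda>n z. (fst z)\<^sup>2)"
  by (intro locally_convergent_const continuous_intros)+

text \<open>The first derivatives of the iterates form a system of the same kind. Its index is a pair of a
  direction and an old index, because a derivative of a superposition is a sum of superpositions over
  the coordinate directions; terms without derivatives of \<open>X n j\<close> belong to the source.\<close>

lemma linear_iteration_C1:
  fixes X :: "nat \<Rightarrow> 'i \<Rightarrow> spacetime \<Rightarrow> real"
  assumes I: "finite I" and a: "\<And>i j. i \<in> I \<Longrightarrow> j \<in> I \<Longrightarrow> cone.weight (a i j)"
    and aA: "\<And>i j. i \<in> I \<Longrightarrow> j \<in> I \<Longrightarrow> AE q in cone_measure. \<bar>a i j q\<bar> \<le> A * fst q" and A: "A \<ge> 0"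
    and S: "\<And>i. i \<in> I \<Longrightarrow> Ck_convergent 1 (\<lambda>n. S n i)" and c: "Ck_convergent 1 c"
    and X0: "\<And>n i. i \<in> I \<Longrightarrow> Ck (Suc 0) (X n i)"
    and Sd: "\<And>n i. i \<in> I \<Longrightarrow> Ck (Suc 0) (S n i)" and cd: "\<And>n. Ck (Suc 0) (c n)"
    and X: "\<And>n i z. i \<in> I \<Longrightarrow> X (Suc n) i z = S n i z +
      (\<Sum>j\<in>I. (fst z)\<^sup>2 * cone.superpose (a i j) (\<lambda>z. c n z * X n j z) z)"
    and i: "i \<in> I"
  shows "Ck_convergent 1 (\<lambda>n. X n i)"
proof -
  have S0: "locally_convergent (\<lambda>n. S n i)" if "i \<in> I" for i by (rule Ck_convergent_1D[OF S[OF that]])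
  have c0: "locally_convergent c" by (rule Ck_convergent_1D[OF c])
  have X0': "continuous_on UNIV (X n i)" if "i \<in> I" for n i using Ck_continuous[OF X0[OF that]] .
  have conv: "locally_convergent (\<lambda>n. X n i)" if "i \<in> I" for i
    using linear_iteration_convergent[OF I a aA A S0 c0 X0' X that] .
  have DS: "locally_convergent (\<lambda>n. dir_deriv v (S n i))" if "i \<in> I" for v i by (rule Ck_convergent_1D[OF S[OF that]])
  have Dc: "locally_convergent (\<lambda>n. dir_deriv v (c n))" for v by (rule Ck_convergent_1D[OF c])
  define a' where "a' k l = (\<lambda>q. a (snd k) (snd l) q * (cone_point q (fst k) \<bullet> fst l))"
    for k l :: "spacetime \<times> 'i"
  define Y where "Y n k = dir_deriv (fst k) (X n (snd k))" for n and k :: "spacetime \<times> 'i"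
  define R where "R n k = (\<lambda>z. dir_deriv (fst k) (S n (snd k)) z +
      (\<Sum>j\<in>I. 2 * fst (fst k) * fst z * cone.superpose (a (snd k) j) (\<lambda>z. c n z * X n j z) z +
      (\<Sum>b\<in>Basis. (fst z)\<^sup>2 * cone.superpose (a' k (b, j)) (\<lambda>z. dir_deriv b (c n) z * X n j z) z)))"
    for n and k :: "spacetime \<times> 'i"
  let ?I = "Basis \<times> I"
  have a'_weight: "cone.weight (a' k l)" "AE q in cone_measure. \<bar>a' k l q\<bar> \<le> 3 * A * fst q"
    if "k \<in> ?I" "l \<in> ?I" for k l
    unfolding a'_def using cone_weight_component[OF a aA A] that by auto
  have "locally_convergent (\<lambda>n. Y n (b, i))" if b: "b \<in> Basis" for b
  proof (rule linear_iteration_convergent[where I = ?I and a = a' and A = "3 * A" and S = R and c = c])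
    show "finite ?I" using I by simp
    show "cone.weight (a' k l)" "AE q in cone_measure. \<bar>a' k l q\<bar> \<le> 3 * A * fst q"
      if "k \<in> ?I" "l \<in> ?I" for k l by (rule a'_weight[OF that])+
    show "locally_convergent (\<lambda>n. R n k)" if "k \<in> ?I" for k
      unfolding R_def
      by (intro locally_convergent_add locally_convergent_sum locally_convergent_mult locally_convergent_time
          cone.locally_convergent_superpose a a'_weight(1) DS Dc c0 conv) (use that in auto)
    show "continuous_on UNIV (Y 0 k)" if "k \<in> ?I" for k
      unfolding Y_def by (rule Ck_continuous[OF Ck_dir_deriv[OF X0]]) (use that in auto)
    show "Y (Suc n) k z = R n k z + (\<Sum>l\<in>?I. (fst z)\<^sup>2 * cone.superpose (a' k l) (\<lambda>z. c n z * Y n l z) z)"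
      if k: "k \<in> ?I" for n k z
    proof -
      obtain b i where bi: "k = (b, i)" "b \<in> Basis" "i \<in> I" using k by (cases k) auto
      have CX: "Ck (Suc 0) (\<lambda>z. c n z * X n j z)" if "j \<in> I" for j by (intro Ck_mult cd X0 that)
      have t: "Ck (Suc 0) (\<lambda>z. (fst z)\<^sup>2 * cone.superpose (a i j) (\<lambda>z. c n z * X n j z) z)" if "j \<in> I" for j
        unfolding power2_eq_square by (intro Ck_mult Ck_fst cone.Ck_superpose a CX bi that)
      have e: "X (Suc n) i = (\<lambda>z. S n i z + (\<Sum>j\<in>I. (fst z)\<^sup>2 * cone.superpose (a i j) (\<lambda>z. c n z * X n j z) z))"
        by (rule ext) (rule X[OF bi(3)])
      have p: "dir_deriv b' (\<lambda>z. c n z * X n j z) = (\<lambda>z. c n z * dir_deriv b' (X n j) z + dir_deriv b' (c n) z * X n j z)"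
        if "j \<in> I" for b' j
        by (rule ext) (rule dir_deriv_mult[OF Ck_differentiable[OF cd] Ck_differentiable[OF X0[OF that]]])
      have cc: "continuous_on UNIV (\<lambda>z. c n z * dir_deriv b' (X n j) z)" "continuous_on UNIV (\<lambda>z. dir_deriv b' (c n) z * X n j z)"
        if "j \<in> I" for b' j
        by (intro continuous_on_mult Ck_continuous[OF cd] Ck_continuous[OF Ck_dir_deriv[OF X0[OF that]]]
          Ck_continuous[OF Ck_dir_deriv[OF cd]] Ck_continuous[OF X0[OF that]])+
      have "Y (Suc n) k z = dir_deriv b (S n i) z + (\<Sum>j\<in>I. dir_deriv b (\<lambda>z. (fst z)\<^sup>2 * cone.superpose (a i j) (\<lambda>z. c n z * X n j z) z) z)"
        unfolding Y_def bi fst_conv snd_conv e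
        by (subst dir_deriv_add[OF Ck_differentiable[OF Sd[OF bi(3)]] Ck_differentiable[OF Ck_sum]], rule t, assumption)
          (subst dir_deriv_sum, rule Ck_differentiable[OF t], assumption, rule refl)
      also have "(\<Sum>j\<in>I. dir_deriv b (\<lambda>z. (fst z)\<^sup>2 * cone.superpose (a i j) (\<lambda>z. c n z * X n j z) z) z) =
          (\<Sum>j\<in>I. 2 * fst b * fst z * cone.superpose (a i j) (\<lambda>z. c n z * X n j z) z +
            (\<Sum>b'\<in>Basis. (fst z)\<^sup>2 * cone.superpose (a' k (b', j)) (\<lambda>z. dir_deriv b' (c n) z * X n j z) z) +
            (\<Sum>b'\<in>Basis. (fst z)\<^sup>2 * cone.superpose (a' k (b', j)) (\<lambda>z. c n z * Y n (b', j) z) z))"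
      proof (rule sum.cong[OF refl])
        fix j assume j: "j \<in> I"
        have "cone.superpose (\<lambda>q. a i j q * (cone_point q b \<bullet> b')) (dir_deriv b' (\<lambda>z. c n z * X n j z)) z =
            cone.superpose (a' k (b', j)) (\<lambda>z. c n z * Y n (b', j) z) z + cone.superpose (a' k (b', j)) (\<lambda>z. dir_deriv b' (c n) z * X n j z) z"
          if b': "b' \<in> Basis" for b'
        proof -
          have "a' k (b', j) = (\<lambda>q. a i j q * (cone_point q b \<bullet> b'))" by (simp add: a'_def bi)
          moreover have "cone.weight (a' k (b', j))" using a'_weight(1)[OF k] b' j by simp
          ultimately show ?thesis unfolding p[OF j] Y_def fst_conv snd_conv
            using cone.superpose_add[OF _ cc[OF j], of "a' k (b', j)" b' b' z] by simp
        qed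
        then show "dir_deriv b (\<lambda>z. (fst z)\<^sup>2 * cone.superpose (a i j) (\<lambda>z. c n z * X n j z) z) z =
          2 * fst b * fst z * cone.superpose (a i j) (\<lambda>z. c n z * X n j z) z +
            (\<Sum>b'\<in>Basis. (fst z)\<^sup>2 * cone.superpose (a' k (b', j)) (\<lambda>z. dir_deriv b' (c n) z * X n j z) z) +
            (\<Sum>b'\<in>Basis. (fst z)\<^sup>2 * cone.superpose (a' k (b', j)) (\<lambda>z. c n z * Y n (b', j) z) z)"
          unfolding dir_deriv_time_sq_superpose[OF a[OF bi(3) j] CX[OF j]]
          by (simp add: distrib_left sum.distrib)
      qed
      finally have "Y (Suc n) k z = R n k z + (\<Sum>j\<in>I. \<Sum>b'\<in>Basis. (fst z)\<^sup>2 * cone.superpose (a' k (b', j)) (\<lambda>z. c n z * Y n (b', j) z) z)"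
        unfolding R_def bi fst_conv snd_conv by (simp add: sum.distrib)
      moreover have "(\<Sum>j\<in>I. \<Sum>b'\<in>Basis. h (b', j)) = (\<Sum>l\<in>Basis \<times> I. h l)" for h :: "spacetime \<times> 'i \<Rightarrow> real"
        by (subst sum.swap) (simp add: sum.cartesian_product)
      ultimately show ?thesis by simp
    qed
    show "(b, i) \<in> ?I" using b i by simp
    show "0 \<le> 3 * A" using A by simp
    show "locally_convergent c" by (rule c0)
  qed
  then have D: "locally_convergent (\<lambda>n. dir_deriv b (X n i))" if "b \<in> Basis" for b
    using that unfolding Y_def by simp
  show ?thesis by (rule Ck_convergent_1I[OF conv[OF i] X0[OF i] D])
qed

lemma Lipschitz_on_bounded:
  fixes F :: "real \<Rightarrow> real"
  assumes F: "Ck (Suc 0) F"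
  obtains L where "L \<ge> 0" "\<And>x y. \<bar>x\<bar> \<le> m \<Longrightarrow> \<bar>y\<bar> \<le> m \<Longrightarrow> \<bar>F x - F y\<bar> \<le> L * \<bar>x - y\<bar>"
proof -
  have "compact (dir_deriv 1 F ` {-m..m})"
    by (rule compact_continuous_image[OF Ck_continuous[OF Ck_dir_deriv[OF F]]]) simp
  then obtain L where "\<forall>x\<in>{-m..m}. \<bar>dir_deriv 1 F x\<bar> \<le> L"
    using compact_imp_bounded[of "dir_deriv 1 F ` {-m..m}"] by (auto simp: bounded_iff)
  then have L: "\<And>x. x \<in> {-m..m} \<Longrightarrow> \<bar>dir_deriv 1 F x\<bar> \<le> L" by blast
  have "\<bar>F x - F y\<bar> \<le> \<bar>L\<bar> * \<bar>x - y\<bar>" if "\<bar>x\<bar> \<le> m" "\<bar>y\<bar> \<le> m" for x y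
  proof -
    have "norm (F x - F y) \<le> \<bar>L\<bar> * norm (x - y)"
    proof (rule differentiable_bound[where S = "{-m..m}" and f' = "\<lambda>x v. dir_deriv v F x"])
      fix z assume z: "z \<in> {-m..m}"
      show "(F has_derivative (\<lambda>v. dir_deriv v F z)) (at z within {-m..m})"
        by (rule has_derivative_at_withinI[OF has_derivative_dir_deriv[OF Ck_differentiable[OF F]]])
      show "onorm (\<lambda>v. dir_deriv v F z) \<le> \<bar>L\<bar>"
      proof (rule onorm_le)
        fix v
        have "dir_deriv v F z = v * dir_deriv 1 F z"
          using dir_deriv_basis[OF Ck_differentiable[OF F], of v z] by simp
        moreover have "\<bar>v\<bar> * \<bar>dir_deriv 1 F z\<bar> \<le> \<bar>v\<bar> * \<bar>L\<bar>" using L[OF z] by (intro mult_left_mono) auto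
        ultimately show "norm (dir_deriv v F z) \<le> \<bar>L\<bar> * norm v" by (simp add: abs_mult mult.commute)
      qed
    qed (use that in auto)
    then show ?thesis by simp
  qed
  then show ?thesis by (intro that[of "\<bar>L\<bar>"]) auto
qed

lemma duhamel_eq: "duhamel G z = (fst z)\<^sup>2 * cone.superpose fst G z"
  by (simp add: duhamel_def power2_eq_square)

lemma AE_abs_fst_cone: "AE q in cone_measure. \<bar>fst q\<bar> \<le> 1 * fst q"
  using AE_cone_measure by eventually_elim auto

text \<open>The iterates stay in an interval on which \<open>F\<close> is Lipschitz, so on each diamond a suitable weight
  makes the iteration a contraction.\<close>

lemma nonlinear_iteration_convergent:
  fixes F :: "real \<Rightarrow> real"
  assumes F: "Ck (Suc 0) F" and U: "continuous_on UNIV U"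
    and u0: "continuous_on UNIV (u 0)"
    and u: "\<And>n. u (Suc n) = (\<lambda>z. U z + duhamel (\<lambda>z. F (u n z)) z)"
    and m: "\<And>n z. \<bar>u n z\<bar> \<le> m"
  shows "locally_convergent u"
proof -
  have Fc: "continuous_on UNIV F" by (rule Ck_continuous[OF F])
  have uc: "continuous_on UNIV (u n)" for n
  proof (induction n)
    case (Suc n)
    then have "Ck 0 (duhamel (\<lambda>z. F (u n z)))"
      by (intro Ck_duhamel) (auto intro: continuous_on_compose2[OF Fc])
    then show ?case unfolding u using U by (auto intro: continuous_intros)
  qed (rule u0)
  have Fuc: "continuous_on UNIV (\<lambda>z. F (u n z))" for n
    by (rule continuous_on_compose2[OF Fc uc]) simp
  obtain L where L: "L \<ge> 0" "\<And>x y. \<bar>x\<bar> \<le> m \<Longrightarrow> \<bar>y\<bar> \<le> m \<Longrightarrow> \<bar>F x - F y\<bar> \<le> L * \<bar>x - y\<bar>"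
    using Lipschitz_on_bounded[OF F] by metis
  show ?thesis
  proof (rule contraction_locally_convergent[where X = "\<lambda>n (_ :: unit). u n" and I = UNIV])
    show "continuous_on UNIV (u n)" for n by (rule uc)
    show "\<exists>B. \<forall>n. \<forall>i\<in>(UNIV :: unit set). \<forall>z\<in>diamond T. \<bar>u n z\<bar> \<le> B" for T using m by blast
    fix T :: real assume T: "T > 0"
    define \<kappa> where "\<kappa> = 2 * (L + 1) * T"
    have \<kappa>: "\<kappa> > 0" using L T by (simp add: \<kappa>_def)
    have "\<bar>u (Suc n) z - u (Suc k) z\<bar> \<le> (e + D / 2) * exp (\<kappa> * \<bar>fst z\<bar>)"
      if e: "e > 0" and D: "D \<ge> 0" and b: "\<And>z. z \<in> diamond T \<Longrightarrow> \<bar>u n z - u k z\<bar> \<le> D * exp (\<kappa> * \<bar>fst z\<bar>)"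
        and z: "z \<in> diamond T" for e D n k z
    proof -
      have "u (Suc n) z - u (Suc k) z = (fst z)\<^sup>2 * cone.superpose fst (\<lambda>z. F (u n z) - F (u k z)) z"
        unfolding u duhamel_eq by (simp add: cone.superpose_diff[OF cone_weight_fst Fuc Fuc] algebra_simps)
      also have "\<bar>\<dots>\<bar> \<le> 1 * (T / \<kappa>) * (L * D) * exp (\<kappa> * \<bar>fst z\<bar>)"
      proof (rule weighted_cone_bound[OF cone_weight_fst AE_abs_fst_cone _ _ _ \<kappa> _ z])
        show "continuous_on UNIV (\<lambda>z. F (u n z) - F (u k z))" by (intro continuous_on_diff Fuc)
        show "\<bar>F (u n y) - F (u k y)\<bar> \<le> L * D * exp (\<kappa> * \<bar>fst y\<bar>)" if "y \<in> diamond T" for y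
          using L(2)[OF m m, of n y k y] mult_left_mono[OF b[OF that] L(1)] by (simp add: mult.assoc)
      qed (use L D in auto)
      also have "\<dots> = (L / (L + 1)) * (D / 2) * exp (\<kappa> * \<bar>fst z\<bar>)"
      proof -
        have "T / \<kappa> = 1 / (2 * (L + 1))" unfolding \<kappa>_def using T L by simp
        then show ?thesis by simp
      qed
      also have "\<dots> \<le> 1 * (D / 2) * exp (\<kappa> * \<bar>fst z\<bar>)" using L D by (intro mult_right_mono) auto
      also have "\<dots> \<le> (e + D / 2) * exp (\<kappa> * \<bar>fst z\<bar>)" using e by (intro mult_right_mono) auto
      finally show ?thesis .
    qed
    then show "\<exists>\<kappa>>0. \<forall>e>0. \<exists>N. \<forall>n\<ge>N. \<forall>k\<ge>N. \<forall>D\<ge>0.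
        (\<forall>i\<in>(UNIV :: unit set). \<forall>z\<in>diamond T. \<bar>u n z - u k z\<bar> \<le> D * exp (\<kappa> * \<bar>fst z\<bar>)) \<longrightarrow>
        (\<forall>i\<in>(UNIV :: unit set). \<forall>z\<in>diamond T. \<bar>u (Suc n) z - u (Suc k) z\<bar> \<le> (e + D / 2) * exp (\<kappa> * \<bar>fst z\<bar>))"
      using \<kappa> by (intro exI[of _ \<kappa>] conjI allI impI exI[of _ 0]) auto
  qed simp
qed

lemma Ck_convergent_1_compose:
  fixes F :: "real \<Rightarrow> real"
  assumes F: "Ck (Suc 0) F" and u: "Ck_convergent 1 u" and ud: "\<And>n. Ck (Suc 0) (u n)"
  shows "Ck_convergent 1 (\<lambda>n z. F (u n z))"
proof (rule Ck_convergent_1I)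
  show "locally_convergent (\<lambda>n z. F (u n z))"
    by (rule locally_convergent_compose[OF Ck_convergent_1D(1)[OF u] Ck_continuous[OF F]])
  show "Ck (Suc 0) (\<lambda>z. F (u n z))" for n by (rule Ck_compose[OF F ud])
  have "(\<lambda>n. dir_deriv b (\<lambda>z. F (u n z))) = (\<lambda>n z. dir_deriv 1 F (u n z) * dir_deriv b (u n) z)" for b
    by (intro ext dir_deriv_compose Ck_differentiable[OF ud] Ck_differentiable[OF F])
  then show "locally_convergent (\<lambda>n. dir_deriv b (\<lambda>z. F (u n z)))" for b
    by (simp only:) (intro locally_convergent_mult Ck_convergent_1D(2)[OF u]
      locally_convergent_compose[OF Ck_convergent_1D(1)[OF u] Ck_continuous[OF Ck_dir_deriv[OF F]]])
qed

text \<open>The derivatives of the iterates solve a linear system with coefficient \<open>F' (u n)\<close>. This coefficient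
  converges once the iterates do, and then the first derivatives converge. Now \<open>F' (u n)\<close> converges
  together with its derivatives, although without a rate when \<open>F''\<close> is merely continuous, and so the
  second derivatives converge.\<close>

lemma nonlinear_iteration_C2:
  fixes F :: "real \<Rightarrow> real"
  assumes F: "Ck 2 F" and U: "Ck 2 U" and u0: "Ck 2 (u 0)"
    and u: "\<And>n. u (Suc n) = (\<lambda>z. U z + duhamel (\<lambda>z. F (u n z)) z)"
    and m: "\<And>n z. \<bar>u n z\<bar> \<le> m"
  shows "Ck_convergent 2 u"
proof -
  have F2: "Ck (Suc (Suc 0)) F" and U2: "Ck (Suc (Suc 0)) U" using F U by (simp_all only: numeral_2_eq_2)
  have ud: "Ck 2 (u n)" for n
    by (induction n) (auto simp only: u intro!: u0 Ck_add U Ck_duhamel Ck_compose[OF F])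
  have ud2: "Ck (Suc (Suc 0)) (u n)" for n using ud[of n] by (simp only: numeral_2_eq_2)
  have ud1: "Ck (Suc 0) (u n)" for n by (rule Ck_SucD[OF ud2])
  have conv: "locally_convergent u"
    by (rule nonlinear_iteration_convergent[OF Ck_SucD[OF F2] Ck_continuous[OF U] Ck_continuous[OF u0] u m])
  let ?F' = "dir_deriv 1 F"
  have F'1: "Ck (Suc 0) ?F'" by (rule Ck_dir_deriv[OF F2])
  have Fu: "Ck (Suc 0) (\<lambda>z. F (u n z))" for n by (rule Ck_compose[OF Ck_SucD[OF F2] ud1])
  define S where "S n b = (\<lambda>z. dir_deriv b U z + 2 * fst b * fst z * cone.superpose fst (\<lambda>z. F (u n z)) z)"
    for n and b :: "spacetime"
  define a where "a b b' = (\<lambda>q. fst q * (cone_point q b \<bullet> b'))" for b b' :: "spacetime"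
  have a: "cone.weight (a b b')" "AE q in cone_measure. \<bar>a b b' q\<bar> \<le> 3 * fst q"
    if "b \<in> Basis" "b' \<in> Basis" for b b'
    unfolding a_def using cone_weight_component[OF cone_weight_fst AE_abs_fst_cone _ that] by simp_all
  have rec: "dir_deriv b (u (Suc n)) z = S n b z +
      (\<Sum>b'\<in>Basis. (fst z)\<^sup>2 * cone.superpose (a b b') (\<lambda>z. ?F' (u n z) * dir_deriv b' (u n) z) z)"
    if "b \<in> Basis" for n b z
  proof -
    have "Ck (Suc 0) (\<lambda>z. (fst z)\<^sup>2 * cone.superpose fst (\<lambda>z. F (u n z)) z)"
      unfolding power2_eq_square by (intro Ck_mult Ck_fst cone.Ck_superpose cone_weight_fst Fu)
    then have "dir_deriv b (u (Suc n)) z = dir_deriv b U z + dir_deriv b (\<lambda>z. (fst z)\<^sup>2 * cone.superpose fst (\<lambda>z. F (u n z)) z) z"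
      unfolding u duhamel_eq by (intro dir_deriv_add Ck_differentiable[OF U2]) (rule Ck_differentiable)
    moreover have "dir_deriv b' (\<lambda>z. F (u n z)) = (\<lambda>z. ?F' (u n z) * dir_deriv b' (u n) z)" for b'
      by (rule ext) (rule dir_deriv_compose[OF Ck_differentiable[OF ud1] Ck_differentiable[OF F2]])
    ultimately show ?thesis
      unfolding dir_deriv_time_sq_superpose[OF cone_weight_fst Fu] S_def a_def by simp
  qed
  have Xd: "Ck (Suc 0) (dir_deriv b (u n))" for b n by (rule Ck_dir_deriv[OF ud2])
  have S0: "locally_convergent (\<lambda>n. S n b)" for b
    unfolding S_def
    by (intro locally_convergent_add locally_convergent_mult locally_convergent_time cone.locally_convergent_superpose
        cone_weight_fst locally_convergent_compose[OF conv Ck_continuous[OF F]] locally_convergent_const Ck_continuous[OF Ck_dir_deriv[OF U2]])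
  have F'c: "locally_convergent (\<lambda>n z. ?F' (u n z))" by (rule locally_convergent_compose[OF conv Ck_continuous[OF F'1]])
  have D: "locally_convergent (\<lambda>n. dir_deriv b (u n))" if "b \<in> Basis" for b
    by (rule linear_iteration_convergent[where X = "\<lambda>n b. dir_deriv b (u n)" and a = a and A = 3 and I = Basis and S = S,
        OF finite_Basis a _ S0 F'c Ck_continuous[OF Xd] rec that]) auto
  have u1: "Ck_convergent 1 u" by (rule Ck_convergent_1I[OF conv ud1 D])
  have Sd: "Ck (Suc 0) (S n b)" for n b
    unfolding S_def by (intro Ck_add Ck_mult Ck_const Ck_fst cone.Ck_superpose cone_weight_fst Fu Ck_dir_deriv[OF U2])
  have S1: "Ck_convergent 1 (\<lambda>n. S n b)" for b
  proof (rule Ck_convergent_1I[OF S0 Sd])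
    fix v :: "spacetime"
    let ?\<Phi> = "\<lambda>n. cone.superpose fst (\<lambda>z. F (u n z))"
    have \<Phi>: "Ck (Suc 0) (?\<Phi> n)" for n by (rule cone.Ck_superpose[OF cone_weight_fst Fu])
    have t\<Phi>: "Ck (Suc 0) (\<lambda>z. fst z * ?\<Phi> n z)" for n by (intro Ck_mult Ck_fst \<Phi>)
    have ct\<Phi>: "Ck (Suc 0) (\<lambda>z. 2 * fst b * (fst z * ?\<Phi> n z))" for n by (intro Ck_cmult t\<Phi>)
    have "dir_deriv v (S n b) = (\<lambda>z. dir_deriv v (dir_deriv b U) z + 2 * fst b * (fst z *
        (\<Sum>b'\<in>Basis. cone.superpose (\<lambda>q. fst q * (cone_point q v \<bullet> b')) (dir_deriv b' (\<lambda>z. F (u n z))) z) + fst v * ?\<Phi> n z))" for n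
    proof (rule ext)
      fix z
      have "dir_deriv v (S n b) z = dir_deriv v (\<lambda>z. dir_deriv b U z + 2 * fst b * (fst z * ?\<Phi> n z)) z"
        unfolding S_def by (simp only: mult.assoc)
      then show "dir_deriv v (S n b) z = dir_deriv v (dir_deriv b U) z + 2 * fst b * (fst z *
        (\<Sum>b'\<in>Basis. cone.superpose (\<lambda>q. fst q * (cone_point q v \<bullet> b')) (dir_deriv b' (\<lambda>z. F (u n z))) z) + fst v * ?\<Phi> n z)"
        unfolding dir_deriv_add[OF Ck_differentiable[OF Ck_dir_deriv[OF U2]] Ck_differentiable[OF ct\<Phi>]]
          dir_deriv_cmult[OF Ck_differentiable[OF t\<Phi>]] dir_deriv_time_mult[OF Ck_differentiable[OF \<Phi>]]
          cone.dir_deriv_superpose[OF cone_weight_fst Fu] .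
    qed
    then show "locally_convergent (\<lambda>n. dir_deriv v (S n b))"
      by (simp only:) (intro locally_convergent_add locally_convergent_mult locally_convergent_sum locally_convergent_const
        cone.locally_convergent_superpose cone.weight_mult cone.weight_inner cone_weight_fst continuous_on_const continuous_on_fst continuous_on_id
        locally_convergent_compose[OF conv Ck_continuous[OF F]] Ck_continuous[OF Ck_dir_deriv[OF Ck_dir_deriv[OF U2]]]
        Ck_convergent_1D(2)[OF Ck_convergent_1_compose[OF Ck_SucD[OF F2] u1 ud1]])
  qed
  have D1: "Ck_convergent 1 (\<lambda>n. dir_deriv b (u n))" if "b \<in> Basis" for b
    by (rule linear_iteration_C1[where X = "\<lambda>n b. dir_deriv b (u n)" and a = a and A = 3 and I = Basis and S = S,
        OF finite_Basis a _ S1 Ck_convergent_1_compose[OF F'1 u1 ud1] Xd Sd Ck_compose[OF F'1 ud1] rec that]) auto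
  have D1': "Ck_convergent 1 (\<lambda>n. dir_deriv v (u n))" for v
  proof (rule Ck_convergent_1I[OF Ck_convergent_1D(2)[OF u1] Xd])
    fix b :: "spacetime"
    have "dir_deriv b (dir_deriv v (u n)) = (\<lambda>z. \<Sum>b'\<in>Basis. (v \<bullet> b') * dir_deriv b (dir_deriv b' (u n)) z)" for n
      by (rule ext) (rule cone.second_deriv_expand[OF ud])
    then show "locally_convergent (\<lambda>n. dir_deriv b (dir_deriv v (u n)))"
      by (simp only:) (intro locally_convergent_sum locally_convergent_mult locally_convergent_const continuous_on_const
        Ck_convergent_1D(2)[OF D1])
  qed
  have "Ck_convergent (Suc 1) u"
    using conv D1' Ck_differentiable[OF ud1] unfolding Ck_convergent.simps(2)[of 1] by blast
  then show ?thesis by (simp only: Suc_1)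
qed

section \<open>Global existence for small data\<close>

context critical_nonlinearity
begin

text \<open>Since \<open>F\<close> is increasing in \<open>\<bar>u\<bar>\<close> and the Duhamel operator is positive, an iterate below the
  envelope contributes at most \<open>c / 2 * envelope\<close> to the next one, and the free wave contributes the
  other half.\<close>

lemma global_solution_below_envelope:
  assumes U: "Ck 2 U" and U0: "\<And>z. wave_op U z = 0"
    and c: "0 \<le> c" "c * (\<mu> 1 + 1) \<le> 1" "c powr (1 + sqrt 2) * (profile_mass / (2 * crit_decay)) \<le> c / 2"
    and Ub: "\<And>t x. \<bar>U (t, x)\<bar> \<le> c / 2 * envelope t (norm x)"
  shows "\<exists>u. global_classical_solution F (\<lambda>x. U (0, x)) (\<lambda>x. time_deriv U (0, x)) u"
proof -
  define u where "u = rec_nat U (\<lambda>n v z. U z + duhamel (\<lambda>z. F (v z)) z)"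
  have u0: "u 0 = U" and uS: "u (Suc n) = (\<lambda>z. U z + duhamel (\<lambda>z. F (u n z)) z)" for n
    by (simp_all add: u_def)
  have uC: "Ck 2 (u n)" for n
  proof (induction n)
    case (Suc n)
    show ?case unfolding uS by (intro Ck_add U Ck_duhamel Ck_compose[OF F_C2] Suc)
  qed (simp add: u0 U)
  have below: "\<bar>u n (t, x)\<bar> \<le> c * envelope t (norm x)" for n t x
  proof (induction n arbitrary: t x)
    case 0
    have "c / 2 * envelope t (norm x) \<le> c * envelope t (norm x)"
      using c envelope_nonneg by (intro mult_right_mono) auto
    then show ?case using Ub[of t x] u0 by simp
  next
    case (Suc n)
    have "\<bar>duhamel (\<lambda>z. F (u n z)) (t, x)\<bar> \<le> c powr (1 + sqrt 2) * (profile_mass / (2 * crit_decay)) * envelope t (norm x)"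
    proof (rule duhamel_bound[OF _ c(1,2)])
      show "continuous_on UNIV (\<lambda>z. F (u n z))" by (rule Ck_continuous[OF Ck_compose[OF F_C2 uC]])
      show "\<bar>F (u n (s, y))\<bar> \<le> F (c * envelope s (norm y))" for s y
        using F_mono[OF Suc.IH] F_nonneg by simp
    qed
    also have "\<dots> \<le> c / 2 * envelope t (norm x)" using c(3) envelope_nonneg by (rule mult_right_mono)
    finally show ?case unfolding uS using Ub[of t x] by simp
  qed
  have bounded: "\<bar>u n z\<bar> \<le> 1" for n z
  proof -
    obtain t x where z: "z = (t, x)" by (cases z)
    have "envelope t (norm x) \<le> profile (\<bar>t\<bar> - \<bar>norm x\<bar>) / 1"
      unfolding envelope_def
    proof (rule divide_left_mono[OF _ profile_nonneg])
      have "0 < 1 + (\<bar>t\<bar> + \<bar>norm x\<bar>)" by (rule add_pos_nonneg) auto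
      then show "0 < (1 + \<bar>t\<bar> + \<bar>norm x\<bar>) * 1" by (simp only: mult_1_right add.assoc)
    qed simp
    then have "c * envelope t (norm x) \<le> c * (\<mu> 1 + 1)"
      using profile_le[of "\<bar>t\<bar> - \<bar>norm x\<bar>"] c by (intro mult_left_mono) auto
    then show ?thesis using below[of n t x] c z by simp
  qed
  have conv: "Ck_convergent 2 u"
    by (rule nonlinear_iteration_C2[where u = u and F = F and U = U and m = 1, OF F_C2 U uC uS bounded])
  then have "locally_convergent u" by (simp add: numeral_2_eq_2)
  then obtain l where l: "continuous_on UNIV l" "\<And>K. compact K \<Longrightarrow> uniform_limit K u l sequentially"
    by (rule locally_convergentE) blast
  have lC: "Ck 2 l" by (rule Ck_convergent_limit[OF conv l(2)])
  have lim: "(\<lambda>n. u n z) \<longlonglongrightarrow> l z" for z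
    by (rule tendsto_uniform_limitI[OF l(2)[of "{z}"]]) auto
  have FlC: "Ck 2 (\<lambda>z. F (l z))" by (rule Ck_compose[OF F_C2 lC])
  have integral_eq: "l = (\<lambda>z. U z + duhamel (\<lambda>z. F (l z)) z)"
  proof (rule ext)
    fix z
    have Fl: "(\<lambda>n. F (u n y)) \<longlonglongrightarrow> F (l y)" for y
      by (rule isCont_tendsto_compose[OF _ lim]) (use F_continuous in \<open>simp add: continuous_on_eq_continuous_at\<close>)
    have "(\<lambda>n. cone.superpose fst (\<lambda>z. F (u n z)) z) \<longlonglongrightarrow> cone.superpose fst (\<lambda>z. F (l z)) z"
      unfolding cone.superpose_def
    proof (rule integral_dominated_convergence[where w = "\<lambda>_. F 1"])
      have c1: "continuous_on UNIV (\<lambda>z. F (v z))" if "Ck 2 v" for v :: "spacetime \<Rightarrow> real"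
        by (rule Ck_continuous[OF Ck_compose[OF F_C2 that]])
      show "(\<lambda>q. fst q * F (l (cone_point q z))) \<in> borel_measurable cone_measure"
        by (rule borel_measurable_integrable[OF cone.superpose_integrable[OF cone_weight_fst c1[OF lC]]])
      show "(\<lambda>q. fst q * F (u n (cone_point q z))) \<in> borel_measurable cone_measure" for n
        by (rule borel_measurable_integrable[OF cone.superpose_integrable[OF cone_weight_fst c1[OF uC]]])
      show "AE q in cone_measure. (\<lambda>n. fst q * F (u n (cone_point q z))) \<longlonglongrightarrow> fst q * F (l (cone_point q z))"
        by (intro AE_I2 tendsto_intros Fl)
      show "AE q in cone_measure. norm (fst q * F (u n (cone_point q z))) \<le> F 1" for n
        using AE_cone_measure
      proof eventually_elim
        case (elim q)
        have "\<bar>fst q\<bar> * \<bar>F (u n (cone_point q z))\<bar> \<le> 1 * F 1"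
          using elim F_mono[OF bounded] F_nonneg by (intro mult_mono) auto
        then show ?case by (simp add: abs_mult)
      qed
    qed auto
    then have "(\<lambda>n. u (Suc n) z) \<longlonglongrightarrow> U z + duhamel (\<lambda>z. F (l z)) z"
      unfolding uS duhamel_eq by (intro tendsto_intros)
    moreover have "(\<lambda>n. u (Suc n) z) \<longlonglongrightarrow> l z" using lim by (rule LIMSEQ_Suc)
    ultimately show "l z = U z + duhamel (\<lambda>z. F (l z)) z" using LIMSEQ_unique by blast
  qed
  have "wave_op l z = F (l z)" for z
    by (subst integral_eq) (simp add: wave_op_add[OF U Ck_duhamel[OF FlC]] U0 wave_op_duhamel[OF FlC])
  moreover have "l (0, x) = U (0, x)" for x
    by (subst integral_eq) (simp add: duhamel_initial[OF FlC])
  moreover have "time_deriv l (0, x) = time_deriv U (0, x)" for x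
    using dir_deriv_add[OF Ck2_differentiable(1)[OF U] Ck2_differentiable(1)[OF Ck_duhamel[OF FlC]], of "(1, 0)" "(0, x)"]
      duhamel_initial(2)[OF FlC, of x]
    unfolding time_deriv_def integral_eq[symmetric] by simp
  ultimately show ?thesis
    using lC unfolding global_classical_solution_def wave_op_def by blast
qed

text \<open>For \<open>c \<le> 1\<close> the power is at most \<open>c\<^sup>2\<close>, which beats the linear right-hand side.\<close>

lemma small_amplitude:
  fixes B M :: real
  assumes "0 \<le> B" "0 \<le> M"
  obtains d where "d > 0" "\<And>c. 0 \<le> c \<Longrightarrow> c < d \<Longrightarrow> c * B \<le> 1"
    "\<And>c. 0 \<le> c \<Longrightarrow> c < d \<Longrightarrow> c powr (1 + sqrt 2) * M \<le> c / 2"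
proof -
  define d where "d = min 1 (min (1 / (B + 1)) (1 / (2 * (M + 1))))"
  have "d > 0" using assms by (simp add: d_def)
  moreover have "c * B \<le> 1" if "0 \<le> c" "c < d" for c
  proof -
    have "c * B \<le> 1 / (B + 1) * (B + 1)" using that assms by (intro mult_mono) (auto simp: d_def)
    then show ?thesis using assms by simp
  qed
  moreover have "c powr (1 + sqrt 2) * M \<le> c / 2" if c: "0 \<le> c" "c < d" for c
  proof -
    have "c powr (1 + sqrt 2) = c * c powr sqrt 2" using c by (simp add: powr_add)
    also have "c powr sqrt 2 \<le> c powr 1" using c by (intro powr_mono') (auto simp: d_def)
    also have "c powr 1 = c" using c by simp
    finally have "c powr (1 + sqrt 2) \<le> c * c" using c by (simp add: mult_left_mono)
    then have "c powr (1 + sqrt 2) * M \<le> c * c * M" using assms by (intro mult_right_mono)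
    also have "c * c * M = c * (c * M)" by simp
    also have "\<dots> \<le> c * (1 / 2)"
    proof (rule mult_left_mono)
      have "c * M \<le> 1 / (2 * (M + 1)) * (M + 1)" using c assms by (intro mult_mono) (auto simp: d_def)
      also have "\<dots> = 1 / 2" using assms by simp
      finally show "c * M \<le> 1 / 2" .
    qed (use c in simp)
    finally show ?thesis by simp
  qed
  ultimately show ?thesis by (rule that)
qed

text \<open>The free wave scales linearly with \<open>\<epsilon>\<close> and is dominated by a multiple of the envelope; here the
  second summand of the profile is used.\<close>

lemma small_data_global_existence:
  assumes f: "Ck_c 3 f" and g: "Ck_c 2 g"
  shows "\<exists>\<epsilon>\<^sub>0>0. \<forall>\<epsilon>. \<bar>\<epsilon>\<bar> < \<epsilon>\<^sub>0 \<longrightarrow> (\<exists>u. global_classical_solution F (\<lambda>x. \<epsilon> * f x) (\<lambda>x. \<epsilon> * g x) u)"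
proof -
  let ?W = "free_wave f g"
  have f3: "Ck 3 f" and g2: "Ck 2 g" using f g by (simp_all add: Ck_c_def)
  note W = free_wave_solution[OF f3 g2]
  obtain M where M: "M \<ge> 0"
    "\<And>t x. \<bar>?W (t, x)\<bar> \<le> M / ((1 + (\<bar>t\<bar> - norm x)\<^sup>2) * (1 + \<bar>t\<bar> + norm x))"
    using free_wave_decay[OF f g] by blast
  define A where "A = 4 * M + 1"
  have A: "A > 0" using M by (simp add: A_def)
  have WA: "\<bar>?W (t, x)\<bar> \<le> A / 2 * envelope t (norm x)" for t x
  proof -
    have p: "1 + \<bar>t\<bar> + norm x > 0" by (simp add: add_pos_nonneg)
    have "M / ((1 + (\<bar>t\<bar> - norm x)\<^sup>2) * (1 + \<bar>t\<bar> + norm x)) = M * (1 / (1 + (\<bar>t\<bar> - norm x)\<^sup>2)) / (1 + \<bar>t\<bar> + norm x)" by simp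
    also have "\<dots> \<le> M * (2 * profile (\<bar>t\<bar> - norm x)) / (1 + \<bar>t\<bar> + norm x)"
      using M p profile_lower by (intro divide_right_mono mult_left_mono) auto
    also have "\<dots> = 2 * M * envelope t (norm x)" by (simp add: envelope_def)
    also have "\<dots> \<le> A / 2 * envelope t (norm x)" by (intro mult_right_mono envelope_nonneg) (simp add: A_def)
    finally show ?thesis using M(2)[of t x] by linarith
  qed
  obtain d where d: "d > 0" "\<And>c. 0 \<le> c \<Longrightarrow> c < d \<Longrightarrow> c * (\<mu> 1 + 1) \<le> 1"
    "\<And>c. 0 \<le> c \<Longrightarrow> c < d \<Longrightarrow> c powr (1 + sqrt 2) * (profile_mass / (2 * crit_decay)) \<le> c / 2"
    using small_amplitude[of "\<mu> 1 + 1" "profile_mass / (2 * crit_decay)"] \<mu>_nonneg[of 1] profile_mass(2) crit_decay(1)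
    by auto
  show ?thesis
  proof (intro exI[of _ "d / A"] conjI allI impI)
    show "d / A > 0" using d A by simp
    fix \<epsilon> :: real assume \<epsilon>: "\<bar>\<epsilon>\<bar> < d / A"
    define c where "c = \<bar>\<epsilon>\<bar> * A"
    have c: "0 \<le> c" "c < d" using \<epsilon> A by (auto simp: c_def field_simps)
    let ?U = "\<lambda>z. \<epsilon> * ?W z"
    have "\<exists>u. global_classical_solution F (\<lambda>x. ?U (0, x)) (\<lambda>x. time_deriv ?U (0, x)) u"
    proof (rule global_solution_below_envelope[OF _ _ c(1) d(2)[OF c] d(3)[OF c]])
      show "Ck 2 ?U" by (intro Ck_cmult W)
      show "wave_op ?U z = 0" for z by (simp add: wave_op_cmult[OF W(1)] W(2))
      show "\<bar>?U (t, x)\<bar> \<le> c / 2 * envelope t (norm x)" for t x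
        using mult_left_mono[OF WA[of t x], of "\<bar>\<epsilon>\<bar>"] by (simp add: abs_mult c_def mult.assoc)
    qed
    moreover have "time_deriv ?U (0, x) = \<epsilon> * g x" for x
      using dir_deriv_cmult[OF Ck2_differentiable(1)[OF W(1)], of "(1, 0)" \<epsilon> "(0, x)"] W(4)[of x]
      by (simp add: time_deriv_def)
    ultimately show "\<exists>u. global_classical_solution F (\<lambda>x. \<epsilon> * f x) (\<lambda>x. \<epsilon> * g x) u"
      by (simp add: W(3))
  qed
qed

end

theorem theorem1p1:
  fixes p :: real and \<mu> F :: "real \<Rightarrow> real"
  assumes p: "p = 1 + sqrt 2"
    and \<mu>_nonneg: "\<And>s. 0 \<le> s \<Longrightarrow> 0 \<le> \<mu> s"
    and \<mu>_cont: "continuous_on {0..} \<mu>"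
    and \<mu>_mono: "mono_on {0..} \<mu>"
    and F: "F = (\<lambda>u. \<bar>u\<bar> powr p * \<mu> \<bar>u\<bar>)"
    and F_C2: "Ck 2 F"
    and \<mu>_int: "(\<integral>\<^sup>+ s\<in>{0<..1}. ennreal (\<mu> s powr (1 + sqrt 2) / s) \<partial>lborel) < \<infinity>"
  shows "\<forall>f g. Ck_c 3 f \<and> Ck_c 2 g \<longrightarrow>
    (\<exists>\<epsilon>\<^sub>0>0. \<forall>\<epsilon>. \<bar>\<epsilon>\<bar> < \<epsilon>\<^sub>0 \<longrightarrow>
      (\<exists>u. global_classical_solution F (\<lambda>x. \<epsilon> * f x) (\<lambda>x. \<epsilon> * g x) u))"
proof -
  interpret critical_nonlinearity \<mu> F
    by unfold_locales (use assms in auto)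
  show ?thesis using small_data_global_existence by blast
qed

end
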